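(* Let $\ell,s,r$ be positive integers with $s$ and $\ell$ coprime, and let $a,b>0$. For $\lambda>0$ let $p_\lambda:\mathbb{C}\times[0,2\pi]\to\mathbb{C}$ and $f_\lambda:\mathbb{C}^2\to\mathbb{C}$ be the maps associated with $(s,r,\ell,a,b,\lambda)$ as defined in the context. Suppose that for one value of $\lambda>0$ (equivalently, for all $\lambda>0$) the map $p_\lambda$ has no phase-critical points, i.e. there is no point $x_0\in\mathbb{C}\times[0,2\pi]$ with $p_\lambda(x_0)\neq0$ at which $\nabla_{\mathbb{C}\times[0,2\pi]}\arg(p_\lambda)=0$. Then for all sufficiently small $\lambda>0$, writing $K_\lambda=f_\lambda^{-1}(0)\cap S^3$, there is no point of $S^3\setminus K_\lambda$ at which $\nabla_{S^3}\arg(f_\lambda)=0$, and hence $\arg(f_\lambda):S^3\setminus K_\lambda\to S^1$ is a fibration.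
   Context: $S^3=\{(u,v)\in\mathbb{C}^2: |u|^2+|v|^2=1\}$. For $j=1,\dots,s$, $h\in[0,2\pi]$ and $\lambda>0$ put $$Z_{\lambda,j}(h)=\lambda\left(a\cos\left(\frac{rh+2\pi(j-1)}{s}\right)+\mathrm{i}\,\frac{b}{\ell}\sin\left(\frac{\ell\,(rh+2\pi(j-1))}{s}\right)\right),\qquad p_\lambda(u,h)=\prod_{j=1}^s\bigl(u-Z_{\lambda,j}(h)\bigr).$$ The function $p_\lambda$ can be written uniquely as a polynomial in $u$ whose coefficients are Laurent polynomials in $\mathrm{e}^{\mathrm{i}h}$. The polynomial $f_\lambda(u,v)$ in the variables $u,v,\overline{v}$ is obtained by replacing $\mathrm{e}^{\mathrm{i}kh}$ by $v^k$ for $k\ge 0$ and by $\overline{v}^{\,|k|}$ for $k<0$. The set $K_\lambda$ is, for small $\lambda$, a link (the lemniscate link, the closure of the braid with strands $(\operatorname{Re}Z_{1,j}(h),\operatorname{Im}Z_{1,j}(h),h)$). For a nowhere-zero complex function $g$, $\arg(g)$ is regarded as a map to $S^1=\mathbb{R}/2\pi\mathbb{Z}$; $\nabla_M$ denotes the gradient on the manifold $M$ (for $M=\mathbb{C}\times[0,2\pi]$, the gradient with respect to $\operatorname{Re}u,\operatorname{Im}u,h$, with $h$ understood $2\pi$-periodically; for $M=S^3$, the gradient of the restriction to $S^3$). "Fibration" means a smooth locally trivial fibre bundle. *)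

theory Defs
  imports
    "HOL-Analysis.Analysis"
    "HOL-Computational_Algebra.Polynomial"
    "HOL-Library.Poly_Mapping"
begin

subsection \<open>The functions $p_\lambda$ and $f_\lambda$\<close>

definition lem_Z :: "nat \<Rightarrow> nat \<Rightarrow> nat \<Rightarrow> real \<Rightarrow> real \<Rightarrow> real \<Rightarrow> nat \<Rightarrow> real \<Rightarrow> complex" where
  "lem_Z s r l a b lam j h =
     of_real lam *
       (of_real (a * cos ((real r * h + 2 * pi * (real j - 1)) / real s)) +
        \<i> * of_real (b / real l * sin (real l * (real r * h + 2 * pi * (real j - 1)) / real s)))"

text \<open>
  The function \<open>p\<close> is given by its formula for every real \<open>h\<close>. As \<open>h\<close> increases by \<open>2 * pi\<close> the
  factors are permuted (\<open>j\<close> goes to \<open>j + r\<close> modulo \<open>s\<close>), so this is the \<open>2 * pi\<close>-periodic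
  extension of the function on $\mathbb{C} \times [0, 2\pi]$.
\<close>

definition lem_p :: "nat \<Rightarrow> nat \<Rightarrow> nat \<Rightarrow> real \<Rightarrow> real \<Rightarrow> real \<Rightarrow> complex \<times> real \<Rightarrow> complex" where
  "lem_p s r l a b lam = (\<lambda>(u, h). \<Prod>j = 1..s. (u - lem_Z s r l a b lam j h))"

text \<open>
  Laurent polynomials over the complex numbers are the finitely supported maps
  \<^typ>\<open>int \<Rightarrow>\<^sub>0 complex\<close> from exponents to coefficients.
\<close>

definition laurent_exp :: "(int \<Rightarrow>\<^sub>0 complex) \<Rightarrow> real \<Rightarrow> complex" where
  "laurent_exp c h = (\<Sum>k\<in>Poly_Mapping.keys c. Poly_Mapping.lookup c k * exp (\<i> * of_int k * of_real h))"

definition laurent_mixed :: "(int \<Rightarrow>\<^sub>0 complex) \<Rightarrow> complex \<Rightarrow> complex" where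
  "laurent_mixed c v =
     (\<Sum>k\<in>Poly_Mapping.keys c. Poly_Mapping.lookup c k *
        (if k \<ge> 0 then v ^ nat k else cnj v ^ nat \<bar>k\<bar>))"

definition lem_poly :: "nat \<Rightarrow> nat \<Rightarrow> nat \<Rightarrow> real \<Rightarrow> real \<Rightarrow> real \<Rightarrow> (int \<Rightarrow>\<^sub>0 complex) poly" where
  "lem_poly s r l a b lam =
     (THE P. \<forall>u. \<forall>h\<in>{0..2 * pi}.
        lem_p s r l a b lam (u, h) = poly (map_poly (\<lambda>c. laurent_exp c h) P) u)"

definition lem_f :: "nat \<Rightarrow> nat \<Rightarrow> nat \<Rightarrow> real \<Rightarrow> real \<Rightarrow> real \<Rightarrow> complex \<times> complex \<Rightarrow> complex" where
  "lem_f s r l a b lam =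
     (\<lambda>(u, v). poly (map_poly (\<lambda>c. laurent_mixed c v) (lem_poly s r l a b lam)) u)"

definition S3 :: "(complex \<times> complex) set" where
  "S3 = {(u, v). (cmod u)\<^sup>2 + (cmod v)\<^sup>2 = 1}"

definition lem_K :: "nat \<Rightarrow> nat \<Rightarrow> nat \<Rightarrow> real \<Rightarrow> real \<Rightarrow> real \<Rightarrow> (complex \<times> complex) set" where
  "lem_K s r l a b lam = lem_f s r l a b lam -` {0} \<inter> S3"


subsection \<open>The gradient of the argument\<close>

text \<open>
  $S^1 = \mathbb{R}/2\pi\mathbb{Z}$ is identified with the unit circle of the complex plane by
  \<^const>\<open>cis\<close>.
\<close>

definition arg_circle :: "complex \<Rightarrow> complex" where
  "arg_circle z = cis (Arg z)"

definition tangent_space :: "'a::euclidean_space set \<Rightarrow> 'a \<Rightarrow> 'a set" where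
  "tangent_space M x =
     {w. \<exists>c :: real \<Rightarrow> 'a. c 0 = x \<and> (\<forall>t. c t \<in> M) \<and> (c has_vector_derivative w) (at 0)}"

text \<open>
  A derivative within a submanifold \<open>M\<close> is determined on tangent vectors only; requiring
  \<open>w\<close> to be tangent makes the gradient unique.
\<close>

definition has_gradient_on :: "'a::euclidean_space set \<Rightarrow> ('a \<Rightarrow> real) \<Rightarrow> 'a \<Rightarrow> 'a \<Rightarrow> bool" where
  "has_gradient_on M \<theta> x w \<longleftrightarrow>
     w \<in> tangent_space M x \<and> (\<theta> has_derivative (\<lambda>y. w \<bullet> y)) (at x within M)"

text \<open>
  A map into $\mathbb{R}/2\pi\mathbb{Z}$ is differentiated through a local continuous real-valued lift.
\<close>

definition has_arg_gradient_on :: "'a::euclidean_space set \<Rightarrow> ('a \<Rightarrow> complex) \<Rightarrow> 'a \<Rightarrow> 'a \<Rightarrow> bool" where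
  "has_arg_gradient_on M g x w \<longleftrightarrow>
     (\<exists>U \<theta>. openin (top_of_set M) U \<and> x \<in> U \<and> continuous_on U \<theta> \<and>
        (\<forall>y\<in>U. g y \<noteq> 0 \<and> cis (\<theta> y) = arg_circle (g y)) \<and>
        has_gradient_on M \<theta> x w)"

definition phase_critical :: "'a::euclidean_space set \<Rightarrow> ('a \<Rightarrow> complex) \<Rightarrow> 'a \<Rightarrow> bool" where
  "phase_critical M g x \<longleftrightarrow> g x \<noteq> 0 \<and> has_arg_gradient_on M g x 0"


subsection \<open>Smooth fibre bundles\<close>

primrec Ck_on :: "nat \<Rightarrow> 'a::euclidean_space set \<Rightarrow> ('a \<Rightarrow> 'b::euclidean_space) \<Rightarrow> bool" where
  "Ck_on 0 S f \<longleftrightarrow> continuous_on S f"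
| "Ck_on (Suc k) S f \<longleftrightarrow>
     (\<forall>x\<in>S. f differentiable (at x)) \<and> (\<forall>v. Ck_on k S (\<lambda>x. frechet_derivative f (at x) v))"

text \<open>
  Smoothness on an arbitrary subset of a Euclidean space: locally there is a smooth extension
  to an open set.
\<close>

definition smooth_map :: "'a::euclidean_space set \<Rightarrow> ('a \<Rightarrow> 'b::euclidean_space) \<Rightarrow> bool" where
  "smooth_map M f \<longleftrightarrow>
     (\<forall>x\<in>M. \<exists>U g. open U \<and> x \<in> U \<and> (\<forall>k. Ck_on k U g) \<and> (\<forall>y\<in>U \<inter> M. g y = f y))"

definition diffeomorphism_betw ::
    "('a::euclidean_space \<Rightarrow> 'b::euclidean_space) \<Rightarrow> 'a set \<Rightarrow> 'b set \<Rightarrow> bool" where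
  "diffeomorphism_betw \<Phi> M N \<longleftrightarrow>
     bij_betw \<Phi> M N \<and> smooth_map M \<Phi> \<and> smooth_map N (inv_into M \<Phi>)"

text \<open>
  \<open>E\<close> and \<open>B\<close> are meant to be embedded submanifolds. Since every fibre lies in \<open>E\<close>, it is no
  restriction to look for the model fibre \<open>F\<close> in the ambient space of \<open>E\<close>. That \<open>F\<close> is a
  submanifold need not be demanded: \<open>U \<times> F\<close> is diffeomorphic to an open subset of \<open>E\<close>, hence
  an embedded submanifold, and its projection to \<open>U\<close> is a submersion with fibre \<open>F\<close>.
\<close>

definition smooth_fibre_bundle ::
    "('a::euclidean_space \<Rightarrow> 'b::euclidean_space) \<Rightarrow> 'a set \<Rightarrow> 'b set \<Rightarrow> bool" where
  "smooth_fibre_bundle \<pi> E B \<longleftrightarrow>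
     smooth_map E \<pi> \<and> \<pi> ` E = B \<and>
     (\<exists>F :: 'a set. \<forall>b\<in>B. \<exists>U (\<Phi> :: 'a \<Rightarrow> 'b \<times> 'a).
        openin (top_of_set B) U \<and> b \<in> U \<and>
        diffeomorphism_betw \<Phi> (E \<inter> \<pi> -` U) (U \<times> F) \<and>
        (\<forall>x\<in>E \<inter> \<pi> -` U. fst (\<Phi> x) = \<pi> x))"

end

theory Submission
  imports Defs
begin

text \<open>
  All the polynomials \<open>f\<^sub>\<lambda>\<close> are rescalings of \<open>F = f\<^sub>1\<close>, namely \<open>f\<^sub>\<lambda>(\<lambda> w, v) = \<lambda>\<^sup>s F(w, v)\<close>, and \<open>F\<close> restricts
  to \<open>p\<^sub>1\<close> on \<open>|v| = 1\<close>. As \<open>\<lambda>\<close> tends to 0, the part of the sphere where \<open>w\<close> is bounded tends to the solid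
  torus on which \<open>p\<^sub>1\<close> lives. There the roots of \<open>p\<^sub>1\<close> are simple, because \<open>s\<close> and \<open>l\<close> are coprime, and there
  are no phase-critical points, because the hypothesis on \<open>p\<^sub>\<lambda>\<close> is invariant under the rescaling. Both
  facts together are the positivity of one continuous function, so by compactness they survive
  for small \<open>\<lambda>\<close> (\<open>near_region\<close>). Where \<open>w\<close> is large, the leading term \<open>w\<^sup>s\<close> dominates and
  rotating \<open>w\<close> increases the argument (\<open>far_region\<close>). The outcome, \<open>transversality\<close>, says
  that on the sphere \<open>f\<^sub>\<lambda>\<close> has no phase-critical points and that 0 is a regular value.

  For the fibration an Ehresmann type argument works although the fibres are not compact
  (\<open>sphere_arg_fibration\<close>). The gradient of the argument, divided by the square of its length, is a
  tangent field along which the argument grows at unit speed. By a compactness argument its length is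
  at most a multiple of \<open>|f|\<close>, and it is even Lipschitz when extended by 0 over the zeros of \<open>f\<close>. Hence its
  flow exists for all times and fixes the zeros, and it is smooth outside of them. Since it moves the
  fibre over \<open>z\<close> to the fibre over \<open>z * cis t\<close>, it trivialises the argument locally.

  The flow of a globally Lipschitz field is constructed by Picard iteration. It is smooth because
  solutions of differential equations are as smooth in parameters as the equation is
  (\<open>ode_param_Ck\<close>), by induction over the variational equation.
\<close>

section \<open>Functions of class \<open>C\<^sup>k\<close> on open sets\<close>

text \<open>
  The derivatives in \<^const>\<open>Ck_on\<close> are two-sided derivatives at the points of the set, so that the
  set has to be open for them to depend only on the values of the function on it.
\<close>

lemma Ck_on_cong:
  assumes "open S" "\<And>x. x \<in> S \<Longrightarrow> f x = g x" "Ck_on k S f"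
  shows "Ck_on k S g"
  using assms(2,3)
proof (induction k arbitrary: f g)
  case 0
  then show ?case using continuous_on_cong[of S S f g] by auto
next
  case (Suc k)
  have fg: "(g has_derivative frechet_derivative f (at x)) (at x)" if "x \<in> S" for x
  proof (rule has_derivative_transform_within_open[OF _ assms(1) that])
    show "(f has_derivative frechet_derivative f (at x)) (at x)"
      using Suc.prems(2) that by (simp add: frechet_derivative_works)
  qed (use Suc.prems in auto)
  have eq: "frechet_derivative f (at x) = frechet_derivative g (at x)" if "x \<in> S" for x
    using frechet_derivative_at[OF fg[OF that]] .
  show ?case
    unfolding Ck_on.simps
  proof (intro conjI ballI allI)
    show "g differentiable at x" if "x \<in> S" for x
      using fg[OF that] differentiable_def by blast
    show "Ck_on k S (\<lambda>x. frechet_derivative g (at x) v)" for v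
      by (rule Suc.IH[of "\<lambda>x. frechet_derivative f (at x) v"]) (use eq Suc.prems(2) in auto)
  qed
qed

lemma Ck_on_SucI:
  assumes "open S" "\<And>x. x \<in> S \<Longrightarrow> (f has_derivative f' x) (at x)"
    "\<And>v. Ck_on k S (\<lambda>x. f' x v)"
  shows "Ck_on (Suc k) S f"
  unfolding Ck_on.simps
proof (intro conjI ballI allI)
  show "f differentiable at x" if "x \<in> S" for x
    using assms(2)[OF that] differentiable_def by blast
  show "Ck_on k S (\<lambda>x. frechet_derivative f (at x) v)" for v
    by (rule Ck_on_cong[OF assms(1) _ assms(3)[of v]])
      (use frechet_derivative_at[OF assms(2)] in auto)
qed

lemma Ck_on_Suc_has_derivative:
  "Ck_on (Suc k) S f \<Longrightarrow> x \<in> S \<Longrightarrow> (f has_derivative frechet_derivative f (at x)) (at x)"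
  by (simp add: frechet_derivative_works)

lemma Ck_on_SucD: "Ck_on (Suc k) S f \<Longrightarrow> Ck_on k S f"
proof (induction k arbitrary: f)
  case 0
  then show ?case
    by (simp add: continuous_at_imp_continuous_on differentiable_imp_continuous_within)
next
  case (Suc k)
  then show ?case by (metis Ck_on.simps(2))
qed

lemma Ck_on_le: "Ck_on k S f \<Longrightarrow> j \<le> k \<Longrightarrow> Ck_on j S f"
  by (induction k) (auto simp: le_Suc_eq simp del: Ck_on.simps(2) dest: Ck_on_SucD)

lemma Ck_on_imp_continuous_on: "Ck_on k S f \<Longrightarrow> continuous_on S f"
  using Ck_on_le[of k S f 0] by simp

lemma Ck_on_subset: "Ck_on k S f \<Longrightarrow> T \<subseteq> S \<Longrightarrow> Ck_on k T f"
proof (induction k arbitrary: f)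
  case 0
  then show ?case using continuous_on_subset by auto
qed auto

lemma Ck_on_const: "open S \<Longrightarrow> Ck_on k S (\<lambda>x. c)"
proof (induction k arbitrary: c)
  case (Suc k)
  show ?case
    by (rule Ck_on_SucI[where f'="\<lambda>x v. 0"]) (use Suc in auto)
qed simp

lemma Ck_on_bounded_linear:
  assumes "bounded_linear f" "open S"
  shows "Ck_on k S f"
proof (cases k)
  case 0
  then show ?thesis using linear_continuous_on[OF assms(1)] by simp
next
  case (Suc j)
  show ?thesis unfolding Suc
    by (rule Ck_on_SucI[where f'="\<lambda>x. f"])
      (use assms bounded_linear_imp_has_derivative Ck_on_const in auto)
qed

lemma Ck_on_add:
  assumes "open S" "Ck_on k S f" "Ck_on k S g"
  shows "Ck_on k S (\<lambda>x. f x + g x)"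
  using assms(2,3)
proof (induction k arbitrary: f g)
  case 0
  then show ?case by (simp add: continuous_on_add)
next
  case (Suc k)
  show ?case
    by (rule Ck_on_SucI[OF assms(1) has_derivative_add[OF
          Ck_on_Suc_has_derivative[OF Suc.prems(1)] Ck_on_Suc_has_derivative[OF Suc.prems(2)]]])
      (use Suc in auto)
qed

lemma Ck_on_sum:
  assumes "open S" "\<And>i. i \<in> I \<Longrightarrow> Ck_on k S (f i)"
  shows "Ck_on k S (\<lambda>x. \<Sum>i\<in>I. f i x)"
  using assms(2)
  by (induction I rule: infinite_finite_induct)
     (auto intro: Ck_on_const Ck_on_add assms(1))

lemma Ck_on_bilinear:
  assumes "bounded_bilinear B" "open S" "Ck_on k S f" "Ck_on k S g"
  shows "Ck_on k S (\<lambda>x. B (f x) (g x))"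
  using assms(3,4)
proof (induction k arbitrary: f g)
  case 0
  then show ?case using bounded_bilinear.continuous_on[OF assms(1)] by simp
next
  case (Suc k)
  show ?case
  proof (rule Ck_on_SucI[OF assms(2) bounded_bilinear.FDERIV[OF assms(1)
          Ck_on_Suc_has_derivative[OF Suc.prems(1)] Ck_on_Suc_has_derivative[OF Suc.prems(2)]]])
    fix v
    show "Ck_on k S (\<lambda>x. B (f x) (frechet_derivative g (at x) v)
        + B (frechet_derivative f (at x) v) (g x))"
      by (intro Ck_on_add Suc.IH assms(2))
         (use Suc.prems Ck_on_SucD[OF Suc.prems(1)] Ck_on_SucD[OF Suc.prems(2)] in auto)
  qed
qed

lemmas Ck_on_mult = Ck_on_bilinear[OF bounded_bilinear_mult]
lemmas Ck_on_scaleR = Ck_on_bilinear[OF bounded_bilinear_scaleR]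
lemmas Ck_on_inner = Ck_on_bilinear[OF bounded_bilinear_inner]

lemma linear_basis_expansion:
  assumes "linear (L :: 'a::euclidean_space \<Rightarrow> 'b::real_vector)"
  shows "L v = (\<Sum>e\<in>Basis. (v \<bullet> e) *\<^sub>R L e)"
  using linear_sum[OF assms, of "\<lambda>e. (v \<bullet> e) *\<^sub>R e" Basis] linear_cmul[OF assms]
  by (simp add: euclidean_representation)

text \<open>
  The chain rule expresses the derivative of a composition by applying \<open>Df (g x)\<close> to a varying
  vector. Expanding this vector in a basis turns the application into a sum of products of scalar
  functions with functions \<open>x \<mapsto> Df (g x) e\<close>, to which the induction hypothesis applies.
\<close>

lemma Ck_on_compose:
  fixes f :: "'b::euclidean_space \<Rightarrow> 'c::euclidean_space" and g :: "'a::euclidean_space \<Rightarrow> 'b"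
  assumes "open S" "Ck_on k T f" "Ck_on k S g" "g ` S \<subseteq> T"
  shows "Ck_on k S (\<lambda>x. f (g x))"
  using assms(2,3)
proof (induction k arbitrary: f)
  case 0
  then show ?case using assms(4) by (auto intro: continuous_on_compose2)
next
  case (Suc k)
  note df = Ck_on_Suc_has_derivative[OF Suc.prems(1)]
    and dg = Ck_on_Suc_has_derivative[OF Suc.prems(2)]
  show ?case
  proof (rule Ck_on_SucI[OF assms(1)])
    show "((\<lambda>x. f (g x)) has_derivative
       (\<lambda>v. \<Sum>e\<in>Basis. (frechet_derivative g (at x) v \<bullet> e) *\<^sub>R frechet_derivative f (at (g x)) e)) (at x)"
      if "x \<in> S" for x
    proof -
      have gx: "g x \<in> T" using that assms(4) by auto
      have lin: "linear (frechet_derivative f (at (g x)))"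
        using df[OF gx] has_derivative_linear by blast
      have "((\<lambda>x. f (g x)) has_derivative
          (\<lambda>v. frechet_derivative f (at (g x)) (frechet_derivative g (at x) v))) (at x)"
        using diff_chain_at[OF dg[OF that] df[OF gx]] by (simp add: o_def)
      moreover
      from linear_basis_expansion[OF lin] have "(\<lambda>v. frechet_derivative f (at (g x)) (frechet_derivative g (at x) v)) =
          (\<lambda>v. \<Sum>e\<in>Basis. (frechet_derivative g (at x) v \<bullet> e) *\<^sub>R
             frechet_derivative f (at (g x)) e)" by (intro ext)
      ultimately show ?thesis by metis
    qed
    show "Ck_on k S (\<lambda>x. \<Sum>e\<in>Basis. (frechet_derivative g (at x) v \<bullet> e) *\<^sub>R
        frechet_derivative f (at (g x)) e)" for v
    proof (intro Ck_on_sum Ck_on_scaleR Ck_on_inner Ck_on_const assms(1))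
      fix e
      show "Ck_on k S (\<lambda>x. frechet_derivative g (at x) v)" using Suc.prems(2) by simp
      show "Ck_on k S (\<lambda>x. frechet_derivative f (at (g x)) e)"
        by (rule Suc.IH) (use Suc.prems(1) Ck_on_SucD[OF Suc.prems(2)] in simp_all)
    qed
  qed
qed

lemma Ck_on_linear_compose:
  assumes "bounded_linear L" "open S" "Ck_on k S g"
  shows "Ck_on k S (\<lambda>x. L (g x))"
  by (rule Ck_on_compose[OF assms(2) Ck_on_bounded_linear[OF assms(1) open_UNIV] assms(3)]) auto

lemma Ck_on_ident: "open S \<Longrightarrow> Ck_on k S (\<lambda>x. x)"
  by (rule Ck_on_bounded_linear) (rule bounded_linear_ident)

lemma Ck_on_minus:
  assumes "open S" "Ck_on k S f" shows "Ck_on k S (\<lambda>x. - f x)"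
  by (rule Ck_on_linear_compose[OF _ assms]) (rule bounded_linear_minus[OF bounded_linear_ident])

lemma Ck_on_diff:
  assumes "open S" "Ck_on k S f" "Ck_on k S g"
  shows "Ck_on k S (\<lambda>x. f x - g x)"
  using Ck_on_add[OF assms(1,2) Ck_on_minus[OF assms(1,3)]] by simp

lemma Ck_on_Pair:
  assumes "open S" "Ck_on k S f" "Ck_on k S g"
  shows "Ck_on k S (\<lambda>x. (f x, g x))"
proof -
  have "Ck_on k S (\<lambda>x. (f x, 0) + (0, g x))"
    using assms by (intro Ck_on_add Ck_on_linear_compose[of "\<lambda>y. (y, 0)"]
      Ck_on_linear_compose[of "\<lambda>y. (0, y)"] bounded_linear_Pair bounded_linear_ident bounded_linear_zero)
  then show ?thesis by simp
qed

lemma Ck_on_fst: "open S \<Longrightarrow> Ck_on k S f \<Longrightarrow> Ck_on k S (\<lambda>x. fst (f x))"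
  by (rule Ck_on_linear_compose[OF bounded_linear_fst])

lemma Ck_on_snd: "open S \<Longrightarrow> Ck_on k S f \<Longrightarrow> Ck_on k S (\<lambda>x. snd (f x))"
  by (rule Ck_on_linear_compose[OF bounded_linear_snd])

lemma Ck_on_power:
  fixes f :: "'a::euclidean_space \<Rightarrow> 'b::{euclidean_space,real_normed_field}"
  assumes "open S" "Ck_on k S f"
  shows "Ck_on k S (\<lambda>x. f x ^ n)"
  by (induction n) (auto intro: Ck_on_const Ck_on_mult assms)

text \<open>
  The derivatives of the inverse, the square root and the logarithm of \<open>f\<close> are products of \<open>Df\<close>
  with inverses of the function itself or of \<open>f\<close>, so each order of differentiability gives the next.
\<close>

lemma Ck_on_inverse:
  fixes f :: "'a::euclidean_space \<Rightarrow> 'b::{euclidean_space,real_normed_field}"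
  assumes "open S" "Ck_on k S f" "\<And>x. x \<in> S \<Longrightarrow> f x \<noteq> 0"
  shows "Ck_on k S (\<lambda>x. inverse (f x))"
  using assms(2)
proof (induction k)
  case 0
  then show ?case using assms(3) by (auto intro: continuous_on_inverse)
next
  case (Suc k)
  show ?case
  proof (rule Ck_on_SucI[OF assms(1) Deriv.has_derivative_inverse[OF assms(3)
        Ck_on_Suc_has_derivative[OF Suc.prems]]])
    show "Ck_on k S (\<lambda>x. - (inverse (f x) * frechet_derivative f (at x) v * inverse (f x)))" for v
      using Suc.prems Suc.IH[OF Ck_on_SucD[OF Suc.prems]]
      by (intro Ck_on_minus Ck_on_mult assms(1)) (auto simp: Ck_on.simps(2)[of k])
  qed
qed

lemma Ck_on_sqrt:
  fixes f :: "'a::euclidean_space \<Rightarrow> real"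
  assumes "open S" "Ck_on k S f" "\<And>x. x \<in> S \<Longrightarrow> f x > 0"
  shows "Ck_on k S (\<lambda>x. sqrt (f x))"
  using assms(2)
proof (induction k)
  case 0
  then show ?case by (auto intro: continuous_on_real_sqrt)
next
  case (Suc k)
  show ?case
  proof (rule Ck_on_SucI[OF assms(1)])
    show "((\<lambda>x. sqrt (f x)) has_derivative
        (\<lambda>v. inverse (2 * sqrt (f x)) * frechet_derivative f (at x) v)) (at x)" if "x \<in> S" for x
    proof -
      have "(sqrt has_derivative (*) (inverse (2 * sqrt (f x)))) (at (f x))"
        using DERIV_real_sqrt[OF assms(3)[OF that]]
        by (simp add: has_field_derivative_def field_simps)
      then show ?thesis
        using diff_chain_at[OF Ck_on_Suc_has_derivative[OF Suc.prems that], of sqrt]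
        by (simp only: o_def)
    qed
    have k: "Ck_on k S (\<lambda>x. 2 * sqrt (f x))"
      by (intro Ck_on_mult Ck_on_const assms(1) Suc.IH Ck_on_SucD[OF Suc.prems])
    have "2 * sqrt (f x) \<noteq> 0" if "x \<in> S" for x
      using assms(3)[OF that] by simp
    from Ck_on_inverse[OF assms(1) k this]
    show "Ck_on k S (\<lambda>x. inverse (2 * sqrt (f x)) * frechet_derivative f (at x) v)" for v
      by (rule Ck_on_mult[OF assms(1)]) (use Suc.prems in auto)
  qed
qed

lemma Ck_on_Ln:
  fixes f :: "'a::euclidean_space \<Rightarrow> complex"
  assumes "open S" "Ck_on k S f" "\<And>x. x \<in> S \<Longrightarrow> f x \<notin> \<real>\<^sub>\<le>\<^sub>0"
  shows "Ck_on k S (\<lambda>x. Ln (f x))"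
  using assms(2)
proof (induction k)
  case 0
  then show ?case using assms(3) by (auto intro!: continuous_on_Ln' simp: image_iff)
next
  case (Suc k)
  have nz: "f x \<noteq> 0" if "x \<in> S" for x using assms(3)[OF that] by auto
  show ?case
  proof (rule Ck_on_SucI[OF assms(1)])
    show "((\<lambda>x. Ln (f x)) has_derivative
        (\<lambda>v. inverse (f x) * frechet_derivative f (at x) v)) (at x)" if "x \<in> S" for x
    proof -
      have "(Ln has_derivative (*) (inverse (f x))) (at (f x))"
        using has_field_derivative_Ln[OF assms(3)[OF that]]
        by (simp add: has_field_derivative_def)
      then show ?thesis
        using diff_chain_at[OF Ck_on_Suc_has_derivative[OF Suc.prems that], of Ln]
        by (simp only: o_def)
    qed
    show "Ck_on k S (\<lambda>x. inverse (f x) * frechet_derivative f (at x) v)" for v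
      by (intro Ck_on_mult Ck_on_inverse assms(1) Ck_on_SucD[OF Suc.prems] nz)
        (use Suc.prems in auto)
  qed
qed

lemma Ck_on_norm:
  fixes f :: "'a::euclidean_space \<Rightarrow> 'b::euclidean_space"
  assumes "open S" "Ck_on k S f" "\<And>x. x \<in> S \<Longrightarrow> f x \<noteq> 0"
  shows "Ck_on k S (\<lambda>x. norm (f x))"
  unfolding norm_eq_sqrt_inner
  by (intro Ck_on_sqrt Ck_on_inner) (use assms in auto)

lemma linear_norm_bound:
  fixes L :: "'a::euclidean_space \<Rightarrow> 'b::real_normed_vector"
  assumes "linear L" "\<And>e. e \<in> Basis \<Longrightarrow> norm (L e) \<le> M e"
  shows "norm (L v) \<le> (\<Sum>e\<in>Basis. M e) * norm v"
proof -
  have "norm (\<Sum>e\<in>(Basis::'a set). (v \<bullet> e) *\<^sub>R L e) \<le> (\<Sum>e\<in>(Basis::'a set). M e * norm v)"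
  proof (rule sum_norm_le)
    fix e :: 'a assume e: "e \<in> Basis"
    have "\<bar>v \<bullet> e\<bar> * norm (L e) \<le> norm v * M e"
      using Basis_le_norm[OF e, of v] assms(2)[OF e] by (intro mult_mono) auto
    then show "norm ((v \<bullet> e) *\<^sub>R L e) \<le> M e * norm v" by (simp add: mult.commute)
  qed
  then show ?thesis
    unfolding linear_basis_expansion[OF assms(1), of v] sum_distrib_right .
qed

lemma Ck_on_linear_apply:
  assumes "open W" "\<And>p. p \<in> W \<Longrightarrow> linear (A p)"
    and "\<And>v. Ck_on k W (\<lambda>p. A p v)" "Ck_on k W f"
  shows "Ck_on k W (\<lambda>p. A p (f p))"
proof (rule Ck_on_cong[OF assms(1)])
  show "(\<Sum>e\<in>Basis. (f p \<bullet> e) *\<^sub>R A p e) = A p (f p)" if "p \<in> W" for p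
    using linear_basis_expansion[OF assms(2)[OF that]] by metis
  show "Ck_on k W (\<lambda>p. \<Sum>e\<in>Basis. (f p \<bullet> e) *\<^sub>R A p e)"
    by (intro Ck_on_sum Ck_on_scaleR Ck_on_inner Ck_on_const assms)
qed

section \<open>Differential equations with Lipschitz right-hand side\<close>

text \<open>
  The square of the norm is differentiable where the norm need not be. With
  \<open>2 e |y| \<le> |y|\<^sup>2 + e\<^sup>2\<close> the hypothesis becomes a linear differential inequality for \<open>|y|\<^sup>2\<close>, and the
  integrating factor \<open>exp (- (2 L + 1) t)\<close> makes the solution of it nonincreasing up to \<open>e\<^sup>2 t\<close>.
\<close>

lemma gronwall_forward:
  fixes y :: "real \<Rightarrow> 'a::real_inner"
  assumes d: "\<And>t. (y has_vector_derivative y' t) (at t)"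
    and b: "\<And>t. 0 \<le> t \<Longrightarrow> t \<le> T \<Longrightarrow> norm (y' t) \<le> L * norm (y t) + e"
    and "0 \<le> T" "0 \<le> L"
  shows "(norm (y T))\<^sup>2 \<le> ((norm (y 0))\<^sup>2 + e\<^sup>2 * T) * exp ((2 * L + 1) * T)"
proof -
  let ?k = "2 * L + 1"
  let ?w = "\<lambda>t. (y t \<bullet> y t) * exp (- ?k * t) - e\<^sup>2 * t"
  have "?w 0 \<ge> ?w T"
  proof (rule DERIV_nonpos_imp_nonincreasing[OF \<open>0 \<le> T\<close>])
    fix t assume t: "0 \<le> t" "t \<le> T"
    let ?D = "(2 * (y t \<bullet> y' t) - ?k * (y t \<bullet> y t)) * exp (- ?k * t) - e\<^sup>2"
    have yd: "(y has_derivative (\<lambda>h. h *\<^sub>R y' t)) (at t)"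
      using d[of t] by (simp add: has_vector_derivative_def)
    have in1: "((\<lambda>t. y t \<bullet> y t) has_field_derivative 2 * (y t \<bullet> y' t)) (at t)"
      unfolding has_field_derivative_def
      by (rule has_derivative_eq_rhs[OF has_derivative_inner[OF yd yd]])
         (auto simp: inner_commute algebra_simps)
    have "(?w has_field_derivative ?D) (at t)"
      by (rule derivative_eq_intros in1 refl | simp)+ (simp add: algebra_simps)
    moreover have "?D \<le> 0"
    proof -
      have "2 * (y t \<bullet> y' t) \<le> 2 * (norm (y t) * norm (y' t))"
        using norm_cauchy_schwarz[of "y t" "y' t"] by simp
      also have "\<dots> \<le> 2 * (norm (y t) * (L * norm (y t) + e))"
        using b[OF t] by (simp add: mult_left_mono)
      also have "\<dots> \<le> ?k * (norm (y t))\<^sup>2 + e\<^sup>2"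
        using sum_squares_bound[of "norm (y t)" e]
        by (simp add: algebra_simps power2_eq_square)
      finally have "2 * (y t \<bullet> y' t) - ?k * (y t \<bullet> y t) \<le> e\<^sup>2"
        by (simp add: power2_norm_eq_inner)
      then have "(2 * (y t \<bullet> y' t) - ?k * (y t \<bullet> y t)) * exp (- ?k * t) \<le> e\<^sup>2 * exp (- ?k * t)"
        by (simp add: mult_right_mono)
      also have "\<dots> \<le> e\<^sup>2 * 1"
        using \<open>0 \<le> L\<close> t by (intro mult_left_mono) (auto intro: mult_nonpos_nonneg)
      finally show ?thesis by simp
    qed
    ultimately show "\<exists>D. DERIV ?w t :> D \<and> D \<le> 0" by blast
  qed
  then have "(y T \<bullet> y T) * exp (- ?k * T) \<le> y 0 \<bullet> y 0 + e\<^sup>2 * T" by simp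
  then have "(y T \<bullet> y T) * exp (- ?k * T) * exp (?k * T) \<le> (y 0 \<bullet> y 0 + e\<^sup>2 * T) * exp (?k * T)"
    by (rule mult_right_mono) simp
  moreover
  have "exp (- ?k * T) * exp (?k * T) = 1" by (simp add: algebra_simps flip: exp_add)
  then have "(y T \<bullet> y T) * exp (- ?k * T) * exp (?k * T) = y T \<bullet> y T"
    unfolding mult.assoc by simp
  ultimately show ?thesis by (simp only: power2_norm_eq_inner)
qed

lemma has_vector_derivative_reflect:
  assumes "\<And>t. (y has_vector_derivative y' t) (at t)"
  shows "((\<lambda>t. y (- t)) has_vector_derivative - y' (- t)) (at (t::real))"
proof -
  have "(uminus has_vector_derivative (-1)) (at t)"
    by (auto intro!: derivative_eq_intros simp: has_vector_derivative_def)
  from vector_diff_chain_at[OF this assms[of "- t"]]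
  show ?thesis by (simp add: o_def)
qed

lemma gronwall:
  fixes y :: "real \<Rightarrow> 'a::real_inner"
  assumes d: "\<And>t. (y has_vector_derivative y' t) (at t)"
    and b: "\<And>t. \<bar>t\<bar> \<le> T \<Longrightarrow> norm (y' t) \<le> L * norm (y t) + e"
    and "0 \<le> L" "\<bar>t\<bar> \<le> T"
  shows "(norm (y t))\<^sup>2 \<le> ((norm (y 0))\<^sup>2 + e\<^sup>2 * T) * exp ((2 * L + 1) * T)"
proof -
  have "(norm (y t))\<^sup>2 \<le> ((norm (y 0))\<^sup>2 + e\<^sup>2 * \<bar>t\<bar>) * exp ((2 * L + 1) * \<bar>t\<bar>)"
  proof (cases "t \<ge> 0")
    case True
    show ?thesis using gronwall_forward[OF d, of t L e] b assms(3,4) True by auto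
  next
    case False
    show ?thesis
      using gronwall_forward[OF has_vector_derivative_reflect[OF d], of "- t" L e] b assms(3,4) False
      by auto
  qed
  also have "\<dots> \<le> ((norm (y 0))\<^sup>2 + e\<^sup>2 * T) * exp ((2 * L + 1) * T)"
    using assms(3,4)
    by (intro mult_mono add_mono) (auto simp: mult_left_mono)
  finally show ?thesis .
qed

lemma gronwall_zero:
  fixes d :: "real \<Rightarrow> 'a::real_inner"
  assumes "\<And>t. (d has_vector_derivative d' t) (at t)"
    and "\<And>t. norm (d' t) \<le> L * norm (d t)" and "0 \<le> L" and "d 0 = 0"
  shows "d t = 0"
  using gronwall[OF assms(1), of "\<bar>t\<bar>" L 0 t] assms(2-4) by simp

lemma antiderivative_exists:
  fixes f :: "real \<Rightarrow> 'a::euclidean_space"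
  assumes "continuous_on UNIV f"
  shows "\<exists>F. F 0 = x0 \<and> (\<forall>t. (F has_vector_derivative f t) (at t))"
proof -
  have "\<exists>F. \<forall>x :: real. - \<infinity> < ereal x \<longrightarrow> ereal x < \<infinity> \<longrightarrow> (F has_vector_derivative f x) (at x)"
    by (rule einterval_antiderivative) (use assms in \<open>auto simp: continuous_on_eq_continuous_at\<close>)
  then obtain F where F: "\<And>t. (F has_vector_derivative f t) (at t)" by auto
  have "((\<lambda>t. F t - F 0 + x0) has_vector_derivative f t) (at t)" for t
    by (auto intro!: derivative_eq_intros F)
  then show ?thesis by (intro exI[of _ "\<lambda>t. F t - F 0 + x0"]) auto
qed

text \<open>
  Integration gains the factor \<open>K\<close> of the exponential weight. In the Picard iteration this gain outweighs
  the Lipschitz constant.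
\<close>

lemma exponential_weight_bound:
  fixes D :: "real \<Rightarrow> 'a::real_normed_vector"
  assumes d: "\<And>t. (D has_vector_derivative D' t) (at t)"
    and b: "\<And>t. \<bar>t\<bar> \<le> T \<Longrightarrow> norm (D' t) \<le> c * (K * exp (K * \<bar>t\<bar>))"
    and D0: "D 0 = 0" and "\<bar>t\<bar> \<le> T" and c: "0 \<le> c"
  shows "norm (D t) \<le> c * exp (K * \<bar>t\<bar>)"
proof -
  have *: "norm (E s) \<le> c * exp (K * s)"
    if "\<And>t. (E has_vector_derivative E' t) (at t)" "E 0 = 0" "0 \<le> s"
      "\<And>t. 0 < t \<Longrightarrow> t < s \<Longrightarrow> norm (E' t) \<le> c * (K * exp (K * t))"
    for E E' :: "real \<Rightarrow> 'a" and s
  proof (cases "s = 0")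
    case False
    have "norm (E s - E 0) \<le> c * exp (K * s) - c * exp (K * 0)"
    proof (rule differentiable_bound_general)
      show "continuous_on {0..s} E"
        using that(1) by (intro continuous_at_imp_continuous_on)
          (auto intro: has_vector_derivative_continuous)
      show "((\<lambda>s. c * exp (K * s)) has_vector_derivative c * (K * exp (K * t))) (at t)" for t
        by (auto intro!: derivative_eq_intros simp flip: has_real_derivative_iff_has_vector_derivative)
    qed (use that False in \<open>auto intro!: continuous_intros\<close>)
    also have "\<dots> \<le> c * exp (K * s)" using c by simp
    finally show ?thesis using that by simp
  qed (use that c in auto)
  show ?thesis
  proof (cases "t \<ge> 0")
    case True
    have "norm (D' u) \<le> c * (K * exp (K * u))" if "0 < u" "u < t" for u
      using b[of u] that assms(4) by auto
    from *[OF d D0 True this] True show ?thesis by simp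
  next
    case False
    have "norm (- D' (- u)) \<le> c * (K * exp (K * u))" if "0 < u" "u < - t" for u
      using b[of "- u"] that assms(4) False by auto
    from *[OF has_vector_derivative_reflect[OF d] _ _ this, of "- t"] False D0 show ?thesis by simp
  qed
qed

text \<open>
  Picard iteration. Successive differences are measured against the weight \<open>exp (K |t|)\<close> with \<open>K\<close>
  larger than twice the Lipschitz constant, so that each step halves them on every bounded interval
  at once; no continuation of local solutions is needed.
\<close>

theorem ode_exists:
  fixes G :: "real \<Rightarrow> 'a::euclidean_space \<Rightarrow> 'a"
  assumes cont: "continuous_on UNIV (\<lambda>(t, a). G t a)"
    and lip: "\<And>t a b. norm (G t a - G t b) \<le> L * norm (a - b)"
  shows "\<exists>y. y 0 = x0 \<and> (\<forall>t. (y has_vector_derivative G t (y t)) (at t))"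
proof -
  define K where "K = 2 * (\<bar>L\<bar> + 1)"
  have K: "K > 0" "L \<le> K / 2" by (auto simp: K_def)
  have Gc: "continuous_on UNIV (\<lambda>t. G t (y t))" if "continuous_on UNIV y" for y
    using continuous_on_compose2[OF cont, of UNIV "\<lambda>t. (t, y t)"]
      continuous_on_Pair[OF continuous_on_id that] by auto
  define step where "step = (\<lambda>y. SOME z. z 0 = x0 \<and> (\<forall>t. (z has_vector_derivative G t (y t)) (at t)))"
  have step: "step y 0 = x0" "\<And>t. (step y has_vector_derivative G t (y t)) (at t)"
    if "continuous_on UNIV y" for y
    using someI_ex[OF antiderivative_exists[OF Gc[OF that], of x0]] by (auto simp: step_def)
  define Y where "Y = (\<lambda>n. (step ^^ n) (\<lambda>t. x0))"
  have Ycont: "continuous_on UNIV (Y n)" for n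
  proof (induction n)
    case (Suc n)
    then show ?case using step(2)[OF Suc]
      by (auto simp: Y_def continuous_on_eq_continuous_at intro: has_vector_derivative_continuous)
  qed (simp add: Y_def)
  have Y0: "Y n 0 = x0" for n
    by (cases n) (use step(1)[OF Ycont] in \<open>auto simp: Y_def\<close>)
  have Yd: "(Y (Suc n) has_vector_derivative G t (Y n t)) (at t)" for n t
    using step(2)[OF Ycont[of n]] by (simp add: Y_def)
  define y where "y = (\<lambda>t. x0 + suminf (\<lambda>i. Y (Suc i) t - Y i t))"
  have unif: "uniform_limit {-T..T} Y y sequentially" for T
  proof -
    have "compact ((\<lambda>t. Y (Suc 0) t - Y 0 t) ` {-T..T})"
      by (intro compact_continuous_image continuous_intros)
        (auto intro: continuous_on_subset[OF Ycont])
    then obtain M where M: "\<And>t. t \<in> {-T..T} \<Longrightarrow> norm (Y (Suc 0) t - Y 0 t) \<le> M"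
      by (metis (no_types, lifting) bounded_iff compact_imp_bounded imageI)
    define c where "c = max M 0"
    have est: "norm (Y (Suc n) t - Y n t) \<le> (c / 2 ^ n) * exp (K * \<bar>t\<bar>)" if "\<bar>t\<bar> \<le> T" for n t
      using that
    proof (induction n arbitrary: t)
      case 0
      have "norm (Y (Suc 0) t - Y 0 t) \<le> c" using M[of t] 0 by (auto simp: c_def abs_le_iff)
      also have "c \<le> c * exp (K * \<bar>t\<bar>)" using K by (simp add: c_def mult_le_cancel_left1)
      finally show ?case by simp
    next
      case (Suc n)
      show ?case
      proof (rule exponential_weight_bound[where T=T and K=K
            and D="\<lambda>t. Y (Suc (Suc n)) t - Y (Suc n) t"
            and D'="\<lambda>t. G t (Y (Suc n) t) - G t (Y n t)"])
        fix s assume s: "\<bar>s\<bar> \<le> T"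
        have "norm (G s (Y (Suc n) s) - G s (Y n s)) \<le> L * norm (Y (Suc n) s - Y n s)"
          by (rule lip)
        also have "\<dots> \<le> (K / 2) * ((c / 2 ^ n) * exp (K * \<bar>s\<bar>))"
          using Suc.IH[OF s] K by (intro mult_mono) auto
        finally show "norm (G s (Y (Suc n) s) - G s (Y n s))
            \<le> (c / 2 ^ Suc n) * (K * exp (K * \<bar>s\<bar>))" by (simp add: mult_ac)
      qed (use Suc.prems Y0 in \<open>auto intro!: has_vector_derivative_diff Yd simp: c_def\<close>)
    qed
    have "uniform_limit {-T..T} (\<lambda>n t. \<Sum>i<n. Y (Suc i) t - Y i t)
        (\<lambda>t. suminf (\<lambda>i. Y (Suc i) t - Y i t)) sequentially"
    proof (rule Weierstrass_m_test)
      fix n t assume t: "t \<in> {-T..T}"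
      have "norm (Y (Suc n) t - Y n t) \<le> (c / 2 ^ n) * exp (K * \<bar>t\<bar>)"
        using est t by auto
      also have "\<dots> \<le> (c / 2 ^ n) * exp (K * T)"
        using t K by (intro mult_left_mono) (auto simp: c_def)
      finally show "norm (Y (Suc n) t - Y n t) \<le> (c * exp (K * T)) * (1 / 2) ^ n"
        by (simp add: power_divide)
    next
      show "summable (\<lambda>n. (c * exp (K * T)) * (1 / 2) ^ n)"
        by (intro summable_mult summable_geometric) simp
    qed
    then have "uniform_limit {-T..T} (\<lambda>n t. x0 + (\<Sum>i<n. Y (Suc i) t - Y i t)) y sequentially"
      unfolding y_def by (intro uniform_limit_intros)
    moreover have "x0 + (\<Sum>i<n. Y (Suc i) t - Y i t) = Y n t" for n t
      using sum_lessThan_telescope[of "\<lambda>i. Y i t" n] by (simp add: Y_def)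
    ultimately show ?thesis by simp
  qed
  have lim: "(\<lambda>n. Y n t) \<longlonglongrightarrow> y t" for t
    by (rule tendsto_uniform_limitI[OF unif[of "\<bar>t\<bar>"]]) auto
  have "(y has_vector_derivative G t (y t)) (at t)" for t
  proof -
    define T where "T = \<bar>t\<bar> + 1"
    have "\<exists>g. \<forall>s\<in>{-T..T}. (\<lambda>n. Y (Suc n) s) \<longlonglongrightarrow> g s \<and>
        (g has_derivative (\<lambda>h. h *\<^sub>R G s (y s))) (at s within {-T..T})"
    proof (rule has_derivative_sequence[where f="\<lambda>n. Y (Suc n)" and l=x0 and f'="\<lambda>n s h. h *\<^sub>R G s (Y n s)" and ?x0.0=0])
      show "(Y (Suc n) has_derivative (\<lambda>h. h *\<^sub>R G s (Y n s))) (at s within {-T..T})" for n s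
        using Yd[of n s] by (auto simp: has_vector_derivative_def intro: has_derivative_at_withinI)
      fix e :: real assume "e > 0"
      then have "e / K > 0" using K by simp
      from uniform_limitD[OF unif this, of T]
      show "\<forall>\<^sub>F n in sequentially. \<forall>s\<in>{-T..T}. \<forall>h.
          norm (h *\<^sub>R G s (Y n s) - h *\<^sub>R G s (y s)) \<le> e * norm h"
      proof eventually_elim
        case (elim n)
        show ?case
        proof (intro ballI allI)
          fix s h assume s: "s \<in> {-T..T}"
          have "norm (G s (Y n s) - G s (y s)) \<le> L * norm (Y n s - y s)" by (rule lip)
          also have "\<dots> \<le> K * (e / K)"
            using elim s K by (intro mult_mono) (auto simp: dist_norm less_imp_le)
          finally have "norm (G s (Y n s) - G s (y s)) \<le> e" using K by simp
          from mult_left_mono[OF this, of "\<bar>h\<bar>"]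
          show "norm (h *\<^sub>R G s (Y n s) - h *\<^sub>R G s (y s)) \<le> e * norm h"
            by (simp add: mult.commute flip: scaleR_diff_right)
        qed
      qed
    next
      show "(\<lambda>n. Y (Suc n) 0) \<longlonglongrightarrow> x0" using Y0 by simp
    qed (auto simp: T_def)
    then obtain g where g: "\<And>s. s \<in> {-T..T} \<Longrightarrow> (\<lambda>n. Y (Suc n) s) \<longlonglongrightarrow> g s"
      "\<And>s. s \<in> {-T..T} \<Longrightarrow> (g has_derivative (\<lambda>h. h *\<^sub>R G s (y s))) (at s within {-T..T})"
      by blast
    have gy: "g s = y s" if "s \<in> {-T..T}" for s
      using LIMSEQ_unique[OF g(1)[OF that] LIMSEQ_Suc[OF lim]] .
    have t: "t \<in> {-T<..<T}" by (auto simp: T_def)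
    have "(g has_derivative (\<lambda>h. h *\<^sub>R G t (y t))) (at t within {-T<..<T})"
      by (rule has_derivative_subset[OF g(2)]) (use t in auto)
    then have "(g has_derivative (\<lambda>h. h *\<^sub>R G t (y t))) (at t)"
      using t at_within_open[OF t] by simp
    then have "(y has_derivative (\<lambda>h. h *\<^sub>R G t (y t))) (at t)"
      by (rule has_derivative_transform_within_open[OF _ _ t]) (use gy in auto)
    then show ?thesis by (simp add: has_vector_derivative_def)
  qed
  moreover have "y 0 = x0"
    using LIMSEQ_unique[OF lim[of 0]] Y0 by simp
  ultimately show ?thesis by blast
qed

text \<open>
  The difference of two solutions for nearby parameters satisfies a Gronwall inequality whose
  inhomogeneity is the change of the right-hand side along the fixed solution. On the compact time
  interval this is uniformly small by continuity.
\<close>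

lemma ode_param_uniform:
  fixes y :: "real \<Rightarrow> 'p::metric_space \<Rightarrow> 'b::euclidean_space"
  assumes Om: "open Om" "x0 \<in> Om"
    and sol: "\<And>t x. x \<in> Om \<Longrightarrow> ((\<lambda>t. y t x) has_vector_derivative G t x (y t x)) (at t)"
    and lip: "\<And>t x a b. x \<in> Om \<Longrightarrow> norm (G t x a - G t x b) \<le> L * norm (a - b)" and "0 \<le> L"
    and init: "continuous_on Om (y 0)"
    and contG: "continuous_on (UNIV \<times> Om) (\<lambda>p. G (fst p) (snd p) (y (fst p) x0))"
    and "e > 0"
  shows "\<exists>d>0. \<forall>x. dist x x0 < d \<longrightarrow> x \<in> Om \<and> (\<forall>t. \<bar>t\<bar> \<le> T \<longrightarrow> norm (y t x - y t x0) < e)"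
proof -
  define T' where "T' = max T 0"
  have T': "T' \<ge> 0" "T \<le> T'" by (auto simp: T'_def)
  define E where "E = exp ((2 * L + 1) * T')"
  have E: "E \<ge> 1" using T' \<open>0 \<le> L\<close> by (simp add: E_def)
  \<comment> \<open>a bound on the initial difference and on the inhomogeneity for which Gronwall gives less than \<open>e\<close>\<close>
  define \<eta> where "\<eta> = e / (2 * ((1 + T') * E))"
  have TE: "(1 + T') * E \<ge> 1" using mult_mono[of 1 "1+T'" 1 E] T' E by simp
  have \<eta>: "\<eta> > 0" using \<open>e > 0\<close> TE by (simp add: \<eta>_def)
  have swap: "continuous_on (Om \<times> {-T'..T'}) (\<lambda>q. G (snd q) (fst q) (y (snd q) x0))"
  proof -
    have "continuous_on (Om \<times> {-T'..T'}) (\<lambda>q. (snd q, fst q))"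
      by (intro continuous_intros)
    then show ?thesis by (rule continuous_on_compose2[OF contG, of _ "\<lambda>q. (snd q, fst q)", simplified]) auto
  qed
  obtain X0 where X0: "x0 \<in> X0" "open X0"
    "\<And>x t. x \<in> X0 \<inter> Om \<Longrightarrow> t \<in> {-T'..T'} \<Longrightarrow> dist (G t x (y t x0)) (G t x0 (y t x0)) \<le> \<eta>"
    by (rule continuous_on_prod_compactE[OF swap compact_Icc Om(2) \<eta>]) auto
  obtain d1 where d1: "d1 > 0" "ball x0 d1 \<subseteq> X0 \<inter> Om"
    using X0 Om by (meson IntI open_Int open_contains_ball)
  obtain d2 where d2: "d2 > 0" "\<And>x. x \<in> Om \<Longrightarrow> dist x x0 < d2 \<Longrightarrow> dist (y 0 x) (y 0 x0) < \<eta>"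
    using init Om(2) \<eta> unfolding continuous_on_iff by metis
  have "norm (y t x - y t x0) < e" if x: "dist x x0 < min d1 d2" and t: "\<bar>t\<bar> \<le> T" for x t
  proof -
    have xO: "x \<in> X0 \<inter> Om" using x d1 by (auto simp: dist_commute)
    have "(norm (y t x - y t x0))\<^sup>2 \<le> ((norm (y 0 x - y 0 x0))\<^sup>2 + \<eta>\<^sup>2 * T') * exp ((2 * L + 1) * T')"
    proof (rule gronwall[where y'="\<lambda>t. G t x (y t x) - G t x0 (y t x0)"])
      show "((\<lambda>t. y t x - y t x0) has_vector_derivative G t x (y t x) - G t x0 (y t x0)) (at t)" for t
        using xO Om(2) by (intro has_vector_derivative_diff sol) auto
      fix t assume "\<bar>t\<bar> \<le> T'"
      then have "norm (G t x (y t x0) - G t x0 (y t x0)) \<le> \<eta>"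
        using X0(3)[OF xO, of t] by (auto simp: dist_norm abs_le_iff)
      moreover have "norm (G t x (y t x) - G t x (y t x0)) \<le> L * norm (y t x - y t x0)"
        using xO by (intro lip) auto
      ultimately show "norm (G t x (y t x) - G t x0 (y t x0)) \<le> L * norm (y t x - y t x0) + \<eta>"
        using norm_triangle_ineq[of "G t x (y t x) - G t x (y t x0)" "G t x (y t x0) - G t x0 (y t x0)"]
        by simp
    qed (use \<open>0 \<le> L\<close> t T' in auto)
    also have "\<dots> \<le> (\<eta>\<^sup>2 + \<eta>\<^sup>2 * T') * E"
      unfolding E_def[symmetric] using d2(2)[of x] xO x E \<eta> T'
      by (intro mult_right_mono add_mono power_mono) (auto simp: dist_norm)
    also have "\<dots> = \<eta>\<^sup>2 * ((1 + T') * E)" by (simp add: algebra_simps)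
    also have "\<dots> \<le> \<eta>\<^sup>2 * (((1 + T') * E) * ((1 + T') * E))"
      using TE using mult_left_mono[OF TE, of "(1 + T') * E"] by (intro mult_left_mono) auto
    also have "\<dots> = (e / 2)\<^sup>2"
    proof -
      have "\<eta> * ((1 + T') * E) = e / 2" using TE unfolding \<eta>_def by (simp only: times_divide_eq_left) (auto simp: field_simps)
      then show ?thesis by (metis power2_eq_square power_mult_distrib)
    qed
    also have "\<dots> < e\<^sup>2" using \<open>e > 0\<close> by (simp add: power2_eq_square)
    finally show ?thesis by (rule power2_less_imp_less) (use \<open>e > 0\<close> in simp)
  qed
  then show ?thesis using d1 d2(1)
    by (intro exI[of _ "min d1 d2"]) (auto simp: dist_commute subset_eq)
qed

lemma ode_param_continuous:
  fixes y :: "real \<Rightarrow> 'p::metric_space \<Rightarrow> 'b::euclidean_space"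
  assumes Om: "open Om"
    and sol: "\<And>t x. x \<in> Om \<Longrightarrow> ((\<lambda>t. y t x) has_vector_derivative G t x (y t x)) (at t)"
    and lip: "\<And>t x a b. x \<in> Om \<Longrightarrow> norm (G t x a - G t x b) \<le> L * norm (a - b)" and "0 \<le> L"
    and init: "continuous_on Om (y 0)"
    and contG: "\<And>x0. x0 \<in> Om \<Longrightarrow>
      continuous_on (UNIV \<times> Om) (\<lambda>p. G (fst p) (snd p) (y (fst p) x0))"
  shows "continuous_on (UNIV \<times> Om) (\<lambda>p. y (fst p) (snd p))"
  unfolding continuous_on_iff
proof (safe, simp only: fst_conv snd_conv)
  fix t0 :: real and x0 and e :: real assume x0: "x0 \<in> Om" and e: "e > 0"
  obtain d1 where d1: "d1 > 0" "\<And>x t. dist x x0 < d1 \<Longrightarrow> \<bar>t\<bar> \<le> \<bar>t0\<bar> + 1 \<Longrightarrow> norm (y t x - y t x0) < e / 2"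
    using ode_param_uniform[OF Om x0 sol lip \<open>0 \<le> L\<close> init contG[OF x0], of "e / 2" "\<bar>t0\<bar> + 1"] e
    by auto
  have "isCont (\<lambda>t. y t x0) t0" using has_vector_derivative_continuous[OF sol[OF x0]] by simp
  then obtain d2 where d2: "d2 > 0" "\<And>t. dist t t0 < d2 \<Longrightarrow> dist (y t x0) (y t0 x0) < e / 2"
    using e unfolding continuous_at_eps_delta by (metis half_gt_zero)
  show "\<exists>d>0. \<forall>p\<in>UNIV \<times> Om. dist p (t0, x0) < d \<longrightarrow>
      dist (y (fst p) (snd p)) (y t0 x0) < e"
  proof (intro exI conjI ballI impI)
    show "min (min d1 d2) 1 > 0" using d1 d2 by auto
    fix p :: "real \<times> 'p" assume p: "dist p (t0, x0) < min (min d1 d2) 1"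
    obtain t x where tx: "p = (t, x)" by (cases p)
    have "dist t t0 < min (min d1 d2) 1" "dist x x0 < min (min d1 d2) 1"
      using p dist_fst_le[of p "(t0, x0)"] dist_snd_le[of p "(t0, x0)"] tx by auto
    then have "norm (y t x - y t x0) < e / 2" "dist (y t x0) (y t0 x0) < e / 2"
      using d1(2)[of x t] d2(2)[of t] by (auto simp: dist_real_def)
    then show "dist (y (fst p) (snd p)) (y t0 x0) < e"
      using dist_triangle[of "y t x" "y t0 x0" "y t x0"] tx by (auto simp: dist_norm)
  qed
qed

text \<open>
  The first order Taylor remainder is uniform over a compact set, because the derivative is
  uniformly continuous on a compact neighbourhood of it.
\<close>

lemma C1_uniform_remainder:
  fixes G :: "'a::euclidean_space \<Rightarrow> 'b::euclidean_space"
  assumes D: "open D" and K: "compact K" "K \<subseteq> D"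
    and dG: "\<And>q. q \<in> D \<Longrightarrow> (G has_derivative DG q) (at q)"
    and cG: "\<And>k. continuous_on D (\<lambda>q. DG q k)" and e: "e > 0"
  shows "\<exists>d>0. \<forall>q\<in>K. \<forall>k. norm k < d \<longrightarrow>
    q + k \<in> D \<and> norm (G (q + k) - G q - DG q k) \<le> e * norm k"
proof -
  obtain r where r: "r > 0" "(\<Union>x\<in>K. cball x r) \<subseteq> D"
    using compact_subset_open_imp_cball_epsilon_subset[OF K(1) D K(2)] by metis
  let ?N = "\<Union>x\<in>K. cball x r"
  have N: "compact ?N" by (rule compact_minkowski_sum_cball[OF K(1)])
  define c where "c = e / real DIM('a)"
  have c: "c > 0" using e by (simp add: c_def)
  have "\<exists>d>0. \<forall>q\<in>?N. \<forall>q'\<in>?N. dist q' q < d \<longrightarrow> dist (DG q' b) (DG q b) < c" for b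
    using compact_uniformly_continuous[OF continuous_on_subset[OF cG r(2)] N, of b] c
    unfolding uniformly_continuous_on_def by blast
  then obtain d where d: "\<And>b. d b > 0"
    "\<And>b q q'. q \<in> ?N \<Longrightarrow> q' \<in> ?N \<Longrightarrow> dist q' q < d b \<Longrightarrow> dist (DG q' b) (DG q b) < c"
    by metis
  define \<delta> where "\<delta> = Min (insert r (d ` Basis))"
  have \<delta>: "\<delta> > 0" "\<delta> \<le> r" "\<And>b. b \<in> Basis \<Longrightarrow> \<delta> \<le> d b"
    using r d by (auto simp: \<delta>_def intro!: min.coboundedI2 Min_le)
  show ?thesis
  proof (intro exI conjI ballI allI impI)
    show "\<delta> > 0" by (rule \<delta>)
    fix q k :: 'a assume q: "q \<in> K" and k: "norm k < \<delta>"
    show "q + k \<in> D" using q k \<delta>(2) r(2) by (force simp: dist_norm)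
    have cb: "ball q \<delta> \<subseteq> ?N" using q \<delta> by (auto simp: dist_commute)
    then have bD: "ball q \<delta> \<subseteq> D" using r by blast
    have "norm (G (q + k) - G q - DG q (q + k - q)) \<le> norm (q + k - q) * e"
    proof (rule differentiable_bound_linearization[where S="ball q \<delta>" and f'=DG])
      fix t :: real assume "t \<in> {0..1}"
      then have "norm (t *\<^sub>R k) \<le> 1 * norm k" unfolding norm_scaleR by (intro mult_right_mono) auto
      then show "q + t *\<^sub>R (q + k - q) \<in> ball q \<delta>" using k by (simp add: dist_norm)
    next
      fix p assume p: "p \<in> ball q \<delta>"
      show "(G has_derivative DG p) (at p within ball q \<delta>)"
        using dG bD p has_derivative_at_withinI by blast
      have lin: "linear (DG p)" "linear (DG q)"
        using dG p q bD K(2) has_derivative_linear by blast+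
      have "norm (DG p v - DG q v) \<le> e * norm v" for v
      proof -
        have "norm (DG p b - DG q b) \<le> c" if "b \<in> Basis" for b
          using d(2)[of q p b] p q r(1) cb \<delta>(3)[OF that] by (force simp: dist_commute simp flip: dist_norm)
        from linear_norm_bound[OF linear_compose_sub[OF lin] this] show ?thesis by (simp add: c_def)
      qed
      then show "onorm (DG p - DG q) \<le> e"
        by (intro onorm_bound) (use e in auto)
    qed (use \<delta> in auto)
    then show "norm (G (q + k) - G q - DG q k) \<le> e * norm k" by (simp add: mult.commute)
  qed
qed

lemma norm_triple_le: "norm (0, h, d) \<le> norm h + norm d"
  for h :: "'a::real_normed_vector" and d :: "'b::real_normed_vector"
  using norm_Pair_le[of h d] by (simp add: norm_Pair)

text \<open>
  The candidate derivative \<open>z\<close> is the solution of the variational equation. Gronwall is used twice: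
  first the solution is Lipschitz in the parameter, and then the error \<open>y(t, x\<^sub>0 + h) - y(t, x\<^sub>0) - z(t) h\<close>
  solves the linear equation up to a Taylor remainder, which is now \<open>o(|h|)\<close>.
\<close>

lemma ode_param_derivative:
  fixes y :: "real \<Rightarrow> 'p::euclidean_space \<Rightarrow> 'b::euclidean_space"
    and G :: "real \<times> 'p \<times> 'b \<Rightarrow> 'b" and z :: "real \<Rightarrow> 'p \<Rightarrow> 'b"
  assumes D: "open D"
    and dG: "\<And>q. q \<in> D \<Longrightarrow> (G has_derivative DG q) (at q)"
    and cG: "\<And>k. continuous_on D (\<lambda>q. DG q k)"
    and curve: "\<And>t. (t, x0, y t x0) \<in> D"
    and sol: "\<And>t x. x \<in> Om \<Longrightarrow> ((\<lambda>t. y t x) has_vector_derivative G (t, x, y t x)) (at t)"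
    and x0: "x0 \<in> Om"
    and unif: "\<And>e T. e > 0 \<Longrightarrow> \<exists>d>0. \<forall>x. dist x x0 < d \<longrightarrow>
      x \<in> Om \<and> (\<forall>t. \<bar>t\<bar> \<le> T \<longrightarrow> norm (y t x - y t x0) < e)"
    and bd: "\<And>t b. norm (DG (t, x0, y t x0) (0, 0, b)) \<le> L * norm b" and L: "0 \<le> L"
    and init: "(y 0 has_derivative z 0) (at x0)"
    and var: "\<And>h t. ((\<lambda>t. z t h) has_vector_derivative DG (t, x0, y t x0) (0, h, z t h)) (at t)"
  shows "(y t has_derivative z t) (at x0)"
proof -
  define T where "T = \<bar>t\<bar>"
  have T: "T \<ge> 0" by (simp add: T_def)
  let ?q = "\<lambda>s. (s, x0, y s x0)"
  let ?rem = "\<lambda>s h b. G (s, x0 + h, y s x0 + b) - G (?q s) - DG (?q s) (0, h, b)"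
  have lin: "linear (DG (?q s))" for s
    using dG[OF curve] has_derivative_linear by blast
  have split: "DG (?q s) (0, h, b) = DG (?q s) (0, h, 0) + DG (?q s) (0, 0, b)" for s h b
    using linear_add[OF lin, of s "(0, h, 0)" "(0, 0, b)"] by simp
  have ycont: "continuous_on S (\<lambda>s. y s x0)" for S
    by (intro continuous_at_imp_continuous_on ballI has_vector_derivative_continuous[OF sol[OF x0]])
  have qcont: "continuous_on S ?q" for S by (intro continuous_intros ycont)
  have K: "compact (?q ` {-T..T})" "?q ` {-T..T} \<subseteq> D"
    using curve by (auto intro!: compact_continuous_image qcont)
  have zlin: "linear (z s)" for s
  proof -
    have z0: "linear (z 0)" using init has_derivative_linear by blast
    show ?thesis
    proof (rule linearI)
      fix h h' :: 'p and c :: real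
      have "z s (h + h') - (z s h + z s h') = 0"
      proof (rule gronwall_zero[OF _ _ L])
        fix s
        show "((\<lambda>s. z s (h + h') - (z s h + z s h')) has_vector_derivative
            DG (?q s) (0, h + h', z s (h + h')) - (DG (?q s) (0, h, z s h) + DG (?q s) (0, h', z s h'))) (at s)"
          by (intro has_vector_derivative_diff has_vector_derivative_add var)
        show "norm (DG (?q s) (0, h + h', z s (h + h')) - (DG (?q s) (0, h, z s h) + DG (?q s) (0, h', z s h')))
            \<le> L * norm (z s (h + h') - (z s h + z s h'))"
          unfolding linear_add[OF lin, symmetric] linear_diff[OF lin, symmetric]
          using bd by simp
      qed (simp add: linear_add[OF z0])
      then show "z s (h + h') = z s h + z s h'" by simp
      have "z s (c *\<^sub>R h) - c *\<^sub>R z s h = 0"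
      proof (rule gronwall_zero[OF _ _ L])
        fix s
        show "((\<lambda>s. z s (c *\<^sub>R h) - c *\<^sub>R z s h) has_vector_derivative
            DG (?q s) (0, c *\<^sub>R h, z s (c *\<^sub>R h)) - c *\<^sub>R DG (?q s) (0, h, z s h)) (at s)"
          by (intro has_vector_derivative_diff bounded_linear.has_vector_derivative[OF bounded_linear_scaleR_right] var)
        show "norm (DG (?q s) (0, c *\<^sub>R h, z s (c *\<^sub>R h)) - c *\<^sub>R DG (?q s) (0, h, z s h))
            \<le> L * norm (z s (c *\<^sub>R h) - c *\<^sub>R z s h)"
          unfolding linear_cmul[OF lin, symmetric] linear_diff[OF lin, symmetric]
          using bd by simp
      qed (simp add: linear_cmul[OF z0])
      then show "z s (c *\<^sub>R h) = c *\<^sub>R z s h" by simp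
    qed
  qed
  obtain C where C: "C \<ge> 0" "\<And>s h. s \<in> {-T..T} \<Longrightarrow> norm (DG (?q s) (0, h, 0)) \<le> C * norm h"
  proof -
    have "\<exists>M. \<forall>s\<in>{-T..T}. norm (DG (?q s) (0, b, 0)) \<le> M" for b
    proof -
      have "compact ((\<lambda>s. DG (?q s) (0, b, 0)) ` {-T..T})"
        using continuous_on_compose2[OF cG qcont, of "{-T..T}" "(0, b, 0)"] K(2)
        by (intro compact_continuous_image) auto
      from compact_imp_bounded[OF this] show ?thesis unfolding bounded_iff by blast
    qed
    then obtain M where M: "\<And>b s. s \<in> {-T..T} \<Longrightarrow> norm (DG (?q s) (0, b, 0)) \<le> M b" by metis
    have "norm (DG (?q s) (0, h, 0)) \<le> (\<Sum>b\<in>Basis. \<bar>M b\<bar>) * norm h" if s: "s \<in> {-T..T}" for s h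
    proof (rule linear_norm_bound)
      show "linear (\<lambda>h. DG (?q s) (0, h, 0))"
        by (rule linearI) (simp_all flip: linear_add[OF lin] linear_cmul[OF lin])
    qed (use M[OF s] abs_ge_self order_trans in blast)
    then show ?thesis using that[of "\<Sum>b\<in>Basis. \<bar>M b\<bar>"] by (auto intro: sum_nonneg)
  qed
  have rem: "\<exists>d>0. \<forall>s\<in>{-T..T}. \<forall>h b. norm h + norm b < d \<longrightarrow>
      norm (?rem s h b) \<le> e * (norm h + norm b)"
    if e: "e > 0" for e
  proof -
    obtain d where d: "d > 0" "\<And>q k. q \<in> ?q ` {-T..T} \<Longrightarrow> norm k < d \<Longrightarrow>
        norm (G (q + k) - G q - DG q k) \<le> e * norm k"
      using C1_uniform_remainder[OF D K dG cG e] by blast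
    show ?thesis
    proof (intro exI[of _ d] conjI ballI allI impI)
      fix s and h :: 'p and b :: 'b assume s: "s \<in> {-T..T}" and hb: "norm h + norm b < d"
      have "norm (G (?q s + (0, h, b)) - G (?q s) - DG (?q s) (0, h, b)) \<le> e * norm (0::real, h, b)"
        by (rule d(2)) (use s hb norm_triple_le[of h b] in auto)
      also have "\<dots> \<le> e * (norm h + norm b)" using e norm_triple_le[of h b] by (simp add: mult_left_mono)
      finally show "norm (?rem s h b) \<le> e * (norm h + norm b)"
        by simp
    qed (rule d)
  qed
  define E where "E = exp ((2 * (L + 1) + 1) * T)"
  have E1: "E \<ge> 1" using L T by (simp add: E_def)
  let ?d = "\<lambda>s h. y s (x0 + h) - y s x0"
  have dd: "((\<lambda>s. ?d s h) has_vector_derivative G (s, x0 + h, y s x0 + ?d s h) - G (?q s)) (at s)"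
    if "x0 + h \<in> Om" for s h
    using has_vector_derivative_diff[OF sol[OF that] sol[OF x0]] by simp
  obtain B where B: "\<And>h. norm (z 0 h) \<le> B * norm h" "B > 0"
  proof -
    obtain K where "K > 0" "\<forall>h. norm (z 0 h) \<le> norm h * K"
      using bounded_linear.pos_bounded[OF has_derivative_bounded_linear[OF init]] by blast
    then have "norm (z 0 h) \<le> K * norm h" for h by (metis mult.commute)
    then show ?thesis using \<open>K > 0\<close> by (rule that)
  qed
  have init': "\<exists>d>0. \<forall>h. norm h < d \<longrightarrow> norm (?d 0 h - z 0 h) \<le> e * norm h" if e: "e > 0" for e
  proof -
    obtain d where d: "d > 0" "\<And>x. norm (x - x0) < d \<Longrightarrow> norm (y 0 x - y 0 x0 - z 0 (x - x0)) \<le> e * norm (x - x0)"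
      using init[unfolded has_derivative_at_alt, THEN conjunct2, rule_format, OF e] by blast
    then show ?thesis using d(2)[of "x0 + _"] by (intro exI[of _ d]) auto
  qed
  have unif': "\<exists>d>0. \<forall>h. norm h < d \<longrightarrow> x0 + h \<in> Om \<and> (\<forall>s\<in>{-T..T}. norm (?d s h) < e)" if e: "e > 0" for e
  proof -
    obtain d where "d > 0" "\<forall>x. dist x x0 < d \<longrightarrow> x \<in> Om \<and> (\<forall>t. \<bar>t\<bar> \<le> T \<longrightarrow> norm (y t x - y t x0) < e)"
      using unif[OF e, of T] by auto
    then show ?thesis by (intro exI[of _ d]) (auto simp: dist_norm)
  qed
  \<comment> \<open>the constant that Gronwall yields for the Lipschitz dependence on the parameter\<close>
  define C2 where "C2 = sqrt (((B + 1)\<^sup>2 + (C + 1)\<^sup>2 * T) * E)"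
  have C2: "C2 \<ge> 0" using T E1 by (simp add: C2_def)
  obtain r1 where r1: "r1 > 0"
    "\<And>h s. norm h < r1 \<Longrightarrow> s \<in> {-T..T} \<Longrightarrow> x0 + h \<in> Om \<and> norm (?d s h) \<le> C2 * norm h"
  proof -
    obtain d1 where d1: "d1 > 0" "\<And>s h b. s \<in> {-T..T} \<Longrightarrow> norm h + norm b < d1 \<Longrightarrow>
       norm (?rem s h b) \<le> 1 * (norm h + norm b)"
      using rem[of 1] by auto
    obtain d2 where d2: "d2 > 0" "\<And>h. norm h < d2 \<Longrightarrow> norm (?d 0 h - z 0 h) \<le> 1 * norm h"
      using init'[of 1] by auto
    obtain d3 where d3: "d3 > 0" "\<And>h. norm h < d3 \<Longrightarrow> x0 + h \<in> Om \<and> (\<forall>s\<in>{-T..T}. norm (?d s h) < d1 / 2)"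
      using unif'[of "d1 / 2"] d1(1) by auto
    have "x0 + h \<in> Om \<and> norm (?d s h) \<le> C2 * norm h"
      if h: "norm h < min (min d2 d3) (d1 / 2)" and s: "s \<in> {-T..T}" for h s
    proof
      show hO: "x0 + h \<in> Om" using d3(2) h by auto
      have "norm (?d 0 h) \<le> (B + 1) * norm h"
      proof -
        have "norm (?d 0 h) \<le> norm (?d 0 h - z 0 h) + norm (z 0 h)"
          using norm_triangle_ineq[of "?d 0 h - z 0 h" "z 0 h"] by simp
        also have "\<dots> \<le> 1 * norm h + B * norm h" using h by (intro add_mono d2(2) B(1)) auto
        finally show ?thesis by (simp add: distrib_right)
      qed
      have "(norm (?d s h))\<^sup>2 \<le> ((norm (?d 0 h))\<^sup>2 + ((C + 1) * norm h)\<^sup>2 * T) * exp ((2 * (L + 1) + 1) * T)"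
      proof (rule gronwall[OF dd[OF hO]])
        fix s assume "\<bar>s\<bar> \<le> T"
        then have s: "s \<in> {-T..T}" by auto
        let ?b = "?d s h"
        have "norm h + norm ?b < d1" using d3(2)[of h] h s by fastforce
        from d1(2)[OF s this]
        have "norm (?rem s h ?b) \<le> norm h + norm ?b" by simp
        moreover have "norm (DG (?q s) (0, h, ?b)) \<le> C * norm h + L * norm ?b"
          unfolding split[of s h ?b]
          using norm_triangle_ineq[of "DG (?q s) (0, h, 0)" "DG (?q s) (0, 0, ?b)"]
            C(2)[OF s, of h] bd[of s ?b] by linarith
        ultimately show "norm (G (s, x0 + h, y s x0 + ?b) - G (?q s))
            \<le> (L + 1) * norm ?b + (C + 1) * norm h"
          using norm_triangle_ineq[of "?rem s h ?b"
              "DG (?q s) (0, h, ?b)"]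
          by (simp add: algebra_simps)
      qed (use L s in auto)
      also have "\<dots> \<le> (((B + 1) * norm h)\<^sup>2 + ((C + 1) * norm h)\<^sup>2 * T) * E"
        unfolding E_def using \<open>norm (?d 0 h) \<le> _\<close> T C(1)
        by (intro mult_right_mono add_mono power_mono) auto
      also have "\<dots> = (C2 * norm h)\<^sup>2"
      proof -
        have "C2\<^sup>2 = ((B + 1)\<^sup>2 + (C + 1)\<^sup>2 * T) * E" using T E1 by (simp add: C2_def)
        then show ?thesis by algebra
      qed
      finally show "norm (?d s h) \<le> C2 * norm h"
        by (rule power2_le_imp_le) (use C2 in simp)
    qed
    then show ?thesis using that[of "min (min d2 d3) (d1 / 2)"] d1(1) d2(1) d3(1) by auto
  qed
  \<comment> \<open>the amplification of the error by Gronwall, which fixes the accuracy \<open>e'\<close> of the remainder\<close>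
  define M where "M = (1 + (1 + C2)\<^sup>2 * T) * E"
  have M: "M \<ge> 1"
    using mult_mono[of 1 "1 + (1 + C2)\<^sup>2 * T" 1 E] T E1 by (simp add: M_def)
  show ?thesis
    unfolding has_derivative_at_alt
  proof (intro conjI allI impI)
    show "bounded_linear (z t)" using zlin linear_conv_bounded_linear by blast
    fix e :: real assume e: "e > 0"
    define e' where "e' = e / sqrt M"
    have e': "e' > 0" using e M by (simp add: e'_def)
    obtain d1 where d1: "d1 > 0" "\<And>s h b. s \<in> {-T..T} \<Longrightarrow> norm h + norm b < d1 \<Longrightarrow>
       norm (?rem s h b) \<le> e' * (norm h + norm b)"
      using rem[OF e'] by auto
    obtain d2 where d2: "d2 > 0" "\<And>h. norm h < d2 \<Longrightarrow> norm (?d 0 h - z 0 h) \<le> e' * norm h"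
      using init'[OF e'] by auto
    define \<rho> where "\<rho> = min (min r1 d2) (d1 / (1 + C2))"
    show "\<exists>d>0. \<forall>x. norm (x - x0) < d \<longrightarrow> norm (y t x - y t x0 - z t (x - x0)) \<le> e * norm (x - x0)"
    proof (intro exI[of _ \<rho>] conjI allI impI)
      show "\<rho> > 0" using r1 d1 d2 C2 by (auto simp: \<rho>_def)
      fix x assume x: "norm (x - x0) < \<rho>"
      define h where "h = x - x0"
      have h: "norm h < r1" "norm h < d2" "(1 + C2) * norm h < d1"
        using x C2 by (auto simp: \<rho>_def h_def field_simps pos_less_divide_eq)
      have hO: "x0 + h \<in> Om" using r1(2)[OF h(1), of 0] T by auto
      let ?r = "\<lambda>s. ?d s h - z s h"
      have "(norm (?r t))\<^sup>2 \<le> ((norm (?r 0))\<^sup>2 + (e' * ((1 + C2) * norm h))\<^sup>2 * T) * exp ((2 * (L + 1) + 1) * T)"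
      proof (rule gronwall[OF has_vector_derivative_diff[OF dd[OF hO] var]])
        fix s assume "\<bar>s\<bar> \<le> T"
        then have s: "s \<in> {-T..T}" by auto
        let ?b = "?d s h"
        have hb: "norm h + norm ?b \<le> (1 + C2) * norm h"
          using r1(2)[OF h(1) s] by (simp add: algebra_simps)
        have "norm (?rem s h ?b) \<le> e' * (norm h + norm ?b)"
          by (rule d1(2)[OF s]) (use hb h(3) in linarith)
        also have "\<dots> \<le> e' * ((1 + C2) * norm h)" using hb e' by (simp add: mult_left_mono)
        finally have 1: "norm (?rem s h ?b) \<le> e' * ((1 + C2) * norm h)" .
        have "DG (?q s) (0, h, ?b) - DG (?q s) (0, h, z s h) = DG (?q s) (0, 0, ?r s)"
          unfolding linear_diff[OF lin, symmetric] by simp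
        then have 2: "norm (DG (?q s) (0, h, ?b) - DG (?q s) (0, h, z s h)) \<le> L * norm (?r s)"
          using bd by simp
        have "norm (G (s, x0 + h, y s x0 + ?b) - G (?q s) - DG (?q s) (0, h, z s h))
            \<le> e' * ((1 + C2) * norm h) + L * norm (?r s)"
          using norm_triangle_le[OF add_mono[OF 1 2]] by simp
        also have "\<dots> \<le> (L + 1) * norm (?r s) + e' * ((1 + C2) * norm h)" by (simp add: algebra_simps)
        finally show "norm (G (s, x0 + h, y s x0 + ?b) - G (?q s) - DG (?q s) (0, h, z s h))
            \<le> (L + 1) * norm (?r s) + e' * ((1 + C2) * norm h)" .
      qed (use L in \<open>auto simp: T_def\<close>)
      also have "\<dots> \<le> ((e' * norm h)\<^sup>2 + (e' * ((1 + C2) * norm h))\<^sup>2 * T) * E"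
        unfolding E_def using d2(2)[OF h(2)] T C2 e'
        by (intro mult_right_mono add_mono power_mono) auto
      also have "\<dots> = (e' * norm h)\<^sup>2 * M"
        unfolding M_def by algebra
      also have "\<dots> = (e * norm h)\<^sup>2"
        using M by (simp add: e'_def power_mult_distrib power_divide)
      finally have "norm (?r t) \<le> e * norm h" by (rule power2_le_imp_le) (use e in simp)
      then show "norm (y t x - y t x0 - z t (x - x0)) \<le> e * norm (x - x0)" by (simp add: h_def)
    qed
  qed
qed

section \<open>Smoothness of flows\<close>

lemma lipschitz_derivative_bound:
  fixes V :: "'a::real_normed_vector \<Rightarrow> 'b::real_normed_vector"
  assumes "(V has_derivative V') (at x)" "\<And>a b. norm (V a - V b) \<le> L * norm (a - b)"
  shows "norm (V' v) \<le> L * norm v"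
proof (cases "v = 0")
  case True
  then show ?thesis using has_derivative_zero_unique linear_0[OF has_derivative_linear[OF assms(1)]] by simp
next
  case False
  show ?thesis
  proof (rule field_le_epsilon)
    fix e :: real assume "e > 0"
    then have e': "e / norm v > 0" using False by simp
    obtain d where d: "d > 0"
      "\<And>y. norm (y - x) < d \<Longrightarrow> norm (V y - V x - V' (y - x)) \<le> e / norm v * norm (y - x)"
      using assms(1)[unfolded has_derivative_at_alt, THEN conjunct2, rule_format, OF e'] by blast
    define s where "s = d / (2 * norm v)"
    have s: "s > 0" "s * norm v < d" using d False by (auto simp: s_def)
    have "norm (V (x + s *\<^sub>R v) - V x - V' (s *\<^sub>R v)) \<le> e * s"
      using d(2)[of "x + s *\<^sub>R v"] s False by simp
    moreover have "norm (V (x + s *\<^sub>R v) - V x) \<le> L * (s * norm v)"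
      using assms(2)[of "x + s *\<^sub>R v" x] s by simp
    moreover have "norm (V' (s *\<^sub>R v)) = s * norm (V' v)"
      using s linear_cmul[OF has_derivative_linear[OF assms(1)]] by simp
    ultimately have "s * norm (V' v) \<le> s * (L * norm v + e)"
      using norm_triangle_ineq2[of "V' (s *\<^sub>R v)" "V (x + s *\<^sub>R v) - V x"]
      by (simp add: norm_minus_commute algebra_simps)
    then show "norm (V' v) \<le> L * norm v + e" using s by simp
  qed
qed

lemma joint_time_derivative:
  fixes y :: "real \<Rightarrow> 'p::euclidean_space \<Rightarrow> 'b::euclidean_space"
  assumes Om: "open Om" "x \<in> Om"
    and sol: "\<And>t x. x \<in> Om \<Longrightarrow> ((\<lambda>t. y t x) has_vector_derivative g (t, x)) (at t)"
    and cg: "continuous_on (UNIV \<times> Om) g"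
    and dx: "(y t has_derivative z) (at x)"
  shows "((\<lambda>p. y (fst p) (snd p)) has_derivative (\<lambda>v. fst v *\<^sub>R g (t, x) + z (snd v))) (at (t, x))"
proof -
  let ?bl = "\<lambda>x t. blinfun_scaleR_left (g (t, x))"
  have "((\<lambda>(x, t). y t x) has_derivative (\<lambda>(h, \<tau>). z h + ?bl x t \<tau>)) (at (x, t) within Om \<times> UNIV)"
  proof (rule has_derivative_partialsI)
    show "((\<lambda>x. y t x) has_derivative z) (at x within Om)"
      using dx by (rule has_derivative_at_withinI)
    show "((\<lambda>t. y t x) has_derivative blinfun_apply (?bl x t)) (at t within UNIV)" if "x \<in> Om" for x t
      using sol[OF that, of t] by (simp add: has_vector_derivative_def)
    have c: "continuous_on (Om \<times> UNIV) (\<lambda>p. g (snd p, fst p))"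
      by (rule continuous_on_compose2[OF cg]) (auto intro!: continuous_intros)
    have "continuous_on (Om \<times> UNIV) (\<lambda>p. blinfun_scaleR_left (g (snd p, fst p)))"
      by (rule bounded_linear.continuous_on[OF bounded_linear_blinfun_scaleR_left c])
    then show "continuous (at (x, t) within Om \<times> UNIV) (\<lambda>(x, t). ?bl x t)"
      unfolding case_prod_beta using Om(2) by (auto simp: continuous_on_eq_continuous_within)
  qed (auto simp: Om)
  then have "((\<lambda>(x, t). y t x) has_derivative (\<lambda>(h, \<tau>). z h + \<tau> *\<^sub>R g (t, x))) (at (x, t))"
    using at_within_open[of "(x, t)" "Om \<times> UNIV"] Om by (simp add: open_Times)
  moreover have "((\<lambda>p. (snd p, fst p)) has_derivative (\<lambda>p. (snd p, fst p))) (at (t, x))"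
    by (auto intro!: derivative_eq_intros)
  ultimately show ?thesis
    using diff_chain_at[of "\<lambda>p. (snd p, fst p)" "\<lambda>p. (snd p, fst p)" "(t, x)"
        "\<lambda>(x, t). y t x" "\<lambda>(h, \<tau>). z h + \<tau> *\<^sub>R g (t, x)"]
    by (simp add: o_def add.commute)
qed

text \<open>
  The derivative of the solution in a parameter direction \<open>h\<close> solves the variational equation, whose
  right-hand side \<open>DG (t, x, y t x) (0, h, c)\<close> has one order of smoothness less than \<open>G\<close> provided that
  this is known of \<open>y\<close>. Hence the induction hypothesis is used twice, for \<open>y\<close> and for its derivative,
  with \<open>G\<close> and \<open>y\<close> varying. The variational equation has the same state space and the same Lipschitz
  constant as the original one, so the induction does not leave the types at hand, as an induction over
  iterated tangent lifts would.
\<close>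

theorem ode_param_Ck:
  fixes G :: "real \<times> 'p::euclidean_space \<times> 'b::euclidean_space \<Rightarrow> 'b"
  assumes Om: "open Om" and L: "0 \<le> L"
  shows "open Y \<Longrightarrow> Ck_on k (UNIV \<times> Om \<times> Y) G \<Longrightarrow> Ck_on k Om (y 0) \<Longrightarrow>
    (\<And>t x a b. x \<in> Om \<Longrightarrow> norm (G (t, x, a) - G (t, x, b)) \<le> L * norm (a - b)) \<Longrightarrow>
    (\<And>t x. x \<in> Om \<Longrightarrow> y t x \<in> Y) \<Longrightarrow>
    (\<And>t x. x \<in> Om \<Longrightarrow> ((\<lambda>t. y t x) has_vector_derivative G (t, x, y t x)) (at t)) \<Longrightarrow>
    Ck_on k (UNIV \<times> Om) (\<lambda>p. y (fst p) (snd p))"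
proof (induction k arbitrary: G y Y)
  case (0 G y Y)
  have "continuous_on (UNIV \<times> Om) (\<lambda>p. y (fst p) (snd p))"
  proof (rule ode_param_continuous[OF Om, where L=L and y=y and G="\<lambda>t x b. G (t, x, b)"])
    fix x0 assume x0: "x0 \<in> Om"
    have "continuous_on UNIV (\<lambda>t. y t x0)"
      by (intro continuous_at_imp_continuous_on ballI has_vector_derivative_continuous[OF "0.prems"(6)[OF x0]])
    then have "continuous_on (UNIV \<times> Om) (\<lambda>p. y (fst p) x0)"
      by (rule continuous_on_compose2) (auto intro: continuous_intros)
    then have "continuous_on (UNIV \<times> Om) (\<lambda>p. (fst p, snd p, y (fst p) x0))"
      by (intro continuous_intros)
    from continuous_on_compose2[OF Ck_on_imp_continuous_on[OF "0.prems"(2)] this]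
    show "continuous_on (UNIV \<times> Om) (\<lambda>p. G (fst p, snd p, y (fst p) x0))"
      using "0.prems"(5)[OF x0] by (simp add: image_subset_iff)
  qed (use "0.prems" L in auto)
  then show ?case by simp
next
  case (Suc k G y Y)
  note sol = Suc.prems(6) and lipG = Suc.prems(4) and inY = Suc.prems(5)
  let ?W = "UNIV \<times> Om" and ?D = "UNIV \<times> Om \<times> Y :: (real \<times> 'p \<times> 'b) set"
    and ?D' = "UNIV \<times> Om \<times> UNIV :: (real \<times> 'p \<times> 'b) set"
  have W: "open ?W" and D: "open ?D" and D': "open ?D'"
    using Om Suc.prems(1) by (simp_all add: open_Times)
  define DG where "DG = (\<lambda>q. frechet_derivative G (at q))"
  have dG: "(G has_derivative DG q) (at q)" if "q \<in> ?D" for q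
    unfolding DG_def by (rule Ck_on_Suc_has_derivative[OF Suc.prems(2) that])
  have CDG: "Ck_on k ?D (\<lambda>q. DG q v)" for v using Suc.prems(2) by (simp add: DG_def del: split_paired_All)
  have lin: "linear (DG (t, x, y t x))" if "x \<in> Om" for t x
    using dG[of "(t, x, y t x)"] inY[OF that] that has_derivative_linear by auto
  have bd: "norm (DG (t, x, y t x) (0, 0, c)) \<le> L * norm c" if x: "x \<in> Om" for t x c
  proof (rule lipschitz_derivative_bound)
    have "((\<lambda>b. (t, x, b)) has_derivative (\<lambda>c. (0, 0, c))) (at (y t x))"
      by (auto intro!: derivative_eq_intros)
    from diff_chain_at[OF this dG] x inY[OF x]
    show "((\<lambda>b. G (t, x, b)) has_derivative (\<lambda>c. DG (t, x, y t x) (0, 0, c))) (at (y t x))"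
      by (simp add: o_def)
  qed (rule lipG[OF x])
  have Cy: "Ck_on k ?W (\<lambda>p. y (fst p) (snd p))"
    by (rule Suc.IH[of Y G y]) (use Suc.prems Ck_on_SucD in blast)+
  \<comment> \<open>the right-hand side of the variational equation\<close>
  define G' where "G' = (\<lambda>h (t, x, c). DG (t, x, y t x) (0, h, c))"
  have lipG': "norm (G' h (t, x, a) - G' h (t, x, b)) \<le> L * norm (a - b)" if "x \<in> Om" for h t x a b
    using bd[OF that, of t "a - b"] linear_diff[OF lin[OF that], of t "(0, h, a)" "(0, h, b)"]
    by (simp add: G'_def)
  have CG': "Ck_on k ?D' (G' h)" for h
  proof -
    have C: "Ck_on k ?D' (\<lambda>q. (fst q, fst (snd q), y (fst q) (fst (snd q))))"
    proof -
      have "Ck_on k ?D' (\<lambda>q. (fst q, fst (snd q)))"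
        by (intro Ck_on_Pair Ck_on_fst Ck_on_snd Ck_on_ident D')
      from Ck_on_compose[OF D' Cy this]
      have "Ck_on k ?D' (\<lambda>q. y (fst q) (fst (snd q)))" by (simp add: image_subset_iff)
      then show ?thesis by (intro Ck_on_Pair Ck_on_fst Ck_on_snd Ck_on_ident D')
    qed
    have CV: "Ck_on k ?D' (\<lambda>q. DG (fst q, fst (snd q), y (fst q) (fst (snd q))) v)" for v
      by (rule Ck_on_compose[OF D' CDG C]) (use inY in auto)
    have "Ck_on k ?D' (\<lambda>q. DG (fst q, fst (snd q), y (fst q) (fst (snd q))) (0, h, snd (snd q)))"
      by (rule Ck_on_linear_apply[where A="\<lambda>q. DG (fst q, fst (snd q), y (fst q) (fst (snd q)))", OF D' _ CV])
        (use lin in \<open>auto intro!: Ck_on_Pair Ck_on_const Ck_on_snd Ck_on_ident D'\<close>)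
    then show ?thesis by (simp add: G'_def case_prod_beta')
  qed
  have "\<exists>\<zeta>. x \<in> Om \<longrightarrow> \<zeta> 0 = frechet_derivative (y 0) (at x) h \<and>
      (\<forall>t. (\<zeta> has_vector_derivative G' h (t, x, \<zeta> t)) (at t))" for x h
  proof (cases "x \<in> Om")
    case True
    have "continuous_on UNIV (\<lambda>q :: real \<times> 'b. (fst q, x, snd q))" by (intro continuous_intros)
    from continuous_on_compose2[OF Ck_on_imp_continuous_on[OF CG'] this] True
    have "continuous_on UNIV (\<lambda>(t, a). G' h (t, x, a))" by (auto simp: case_prod_beta')
    from ode_exists[OF this lipG'[OF True]] show ?thesis by blast
  qed blast
  then obtain \<zeta> where \<zeta>: "\<And>x h. x \<in> Om \<Longrightarrow> \<zeta> x h 0 = frechet_derivative (y 0) (at x) h"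
    "\<And>x h t. x \<in> Om \<Longrightarrow> ((\<lambda>t. \<zeta> x h t) has_vector_derivative G' h (t, x, \<zeta> x h t)) (at t)"
    by metis
  have C\<zeta>: "Ck_on k ?W (\<lambda>p. \<zeta> (snd p) h (fst p))" for h
  proof (rule Suc.IH[OF open_UNIV CG', where y="\<lambda>t x. \<zeta> x h t"])
    show "Ck_on k Om (\<lambda>x. \<zeta> x h 0)"
      by (rule Ck_on_cong[OF Om, of "\<lambda>x. frechet_derivative (y 0) (at x) h"])
        (use \<zeta>(1) Suc.prems(3) in auto)
  qed (use \<zeta>(2) lipG' in auto)
  have dy: "(y t has_derivative (\<lambda>h. \<zeta> x h t)) (at x)" if x: "x \<in> Om" for t x
  proof (rule ode_param_derivative[OF D dG _ _ sol x _ bd[OF x] L, where z="\<lambda>t h. \<zeta> x h t"])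
    show "continuous_on ?D (\<lambda>q. DG q v)" for v by (rule Ck_on_imp_continuous_on[OF CDG])
    show "\<exists>d>0. \<forall>x'. dist x' x < d \<longrightarrow> x' \<in> Om \<and> (\<forall>t. \<bar>t\<bar> \<le> T \<longrightarrow> norm (y t x' - y t x) < e)"
      if "e > 0" for e T
    proof (rule ode_param_uniform[OF Om x, where L=L and y=y and G="\<lambda>t x b. G (t, x, b)"])
      show "continuous_on Om (y 0)" by (rule Ck_on_imp_continuous_on[OF Suc.prems(3)])
      have "continuous_on ?W (\<lambda>p. (fst p, x))" by (intro continuous_intros)
      from continuous_on_compose2[OF Ck_on_imp_continuous_on[OF Cy] this] x
      have "continuous_on ?W (\<lambda>p. (fst p, snd p, y (fst p) x))" by (auto intro!: continuous_intros)
      from continuous_on_compose2[OF Ck_on_imp_continuous_on[OF Suc.prems(2)] this]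
      show "continuous_on ?W (\<lambda>p. G (fst p, snd p, y (fst p) x))"
        using inY[OF x] by (simp add: image_subset_iff)
    qed (use that sol L lipG in auto)
    show "(y 0 has_derivative (\<lambda>h. \<zeta> x h 0)) (at x)"
      using Ck_on_Suc_has_derivative[OF Suc.prems(3) x] \<zeta>(1)[OF x] by simp
    show "((\<lambda>t. \<zeta> x h t) has_vector_derivative DG (t, x, y t x) (0, h, \<zeta> x h t)) (at t)" for h t
      using \<zeta>(2)[OF x, of h t] by (simp add: G'_def)
  qed (use x inY in auto)
  have "Ck_on k ?W (\<lambda>p. (fst p, snd p, y (fst p) (snd p)))"
    by (intro Ck_on_Pair[OF W] Ck_on_fst[OF W] Ck_on_snd[OF W] Ck_on_ident[OF W] Cy)
  from Ck_on_compose[OF W Ck_on_SucD[OF Suc.prems(2)] this]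
  have Cg: "Ck_on k ?W (\<lambda>p. G (fst p, snd p, y (fst p) (snd p)))"
    using inY by (simp add: image_subset_iff)
  show ?case
  proof (rule Ck_on_SucI[OF W])
    show "((\<lambda>p. y (fst p) (snd p)) has_derivative
        (\<lambda>v. fst v *\<^sub>R G (fst p, snd p, y (fst p) (snd p)) + \<zeta> (snd p) (snd v) (fst p))) (at p)" if "p \<in> ?W" for p
    proof -
      have x: "snd p \<in> Om" using that by auto
      have "((\<lambda>p. y (fst p) (snd p)) has_derivative
          (\<lambda>v. fst v *\<^sub>R G (fst (fst p, snd p), snd (fst p, snd p), y (fst (fst p, snd p)) (snd (fst p, snd p)))
            + \<zeta> (snd p) (snd v) (fst p))) (at (fst p, snd p))"
        by (rule joint_time_derivative[OF Om x _ Ck_on_imp_continuous_on[OF Cg] dy[OF x]]) (simp add: sol)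
      then show ?thesis by (simp only: prod.collapse)
    qed
    show "Ck_on k ?W (\<lambda>p. fst v *\<^sub>R G (fst p, snd p, y (fst p) (snd p)) + \<zeta> (snd p) (snd v) (fst p))" for v
      by (intro Ck_on_add[OF W] Ck_on_scaleR[OF W] Ck_on_const[OF W] Cg C\<zeta>)
  qed
qed

text \<open>
  The value is only meaningful for fields with a unique global integral curve through \<open>x\<close>, such as
  the globally Lipschitz ones below.
\<close>

definition flow :: "('a::euclidean_space \<Rightarrow> 'a) \<Rightarrow> real \<Rightarrow> 'a \<Rightarrow> 'a" where
  "flow V t x = (SOME y. y 0 = x \<and> (\<forall>t. (y has_vector_derivative V (y t)) (at t))) t"

context
  fixes V :: "'a::euclidean_space \<Rightarrow> 'a" and L :: real
  assumes lip: "\<And>a b. norm (V a - V b) \<le> L * norm (a - b)"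
begin

lemma lipschitz_constant_nonneg: "0 \<le> L"
proof -
  obtain e :: 'a where "e \<in> Basis" using nonempty_Basis by blast
  then show ?thesis using lip[of e 0] order_trans[OF norm_ge_zero[of "V e - V 0"]] by auto
qed

lemma flow_ode:
  shows flow_0: "flow V 0 x = x"
    and flow_derivative: "((\<lambda>t. flow V t x) has_vector_derivative V (flow V t x)) (at t)"
proof -
  have "continuous_on UNIV V"
    by (rule lipschitz_on_continuous_on[of L]) (auto simp: lipschitz_on_def dist_norm lip lipschitz_constant_nonneg)
  then have "continuous_on UNIV (\<lambda>p :: real \<times> 'a. V (snd p))"
    by (rule continuous_on_compose2) (auto intro: continuous_intros)
  then have "continuous_on UNIV (\<lambda>(t :: real, a). V a)" by (simp add: case_prod_beta)
  from someI_ex[OF ode_exists[OF this lip, of x]]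
  show "flow V 0 x = x" "((\<lambda>t. flow V t x) has_vector_derivative V (flow V t x)) (at t)"
    by (auto simp: flow_def)
qed

lemma flow_unique:
  assumes "\<And>t. (y has_vector_derivative V (y t)) (at t)"
  shows "y t = flow V t (y 0)"
proof -
  have "y t - flow V t (y 0) = 0"
    by (rule gronwall_zero[OF has_vector_derivative_diff[OF assms flow_derivative] lip lipschitz_constant_nonneg])
      (simp add: flow_0)
  then show ?thesis by simp
qed

lemma flow_add: "flow V (s + t) x = flow V s (flow V t x)"
proof -
  have "((\<lambda>s. flow V (s + t) x) has_vector_derivative V (flow V (s + t) x)) (at s)" for s
  proof -
    have "((\<lambda>s. s + t) has_vector_derivative 1) (at s)" by (auto intro!: derivative_eq_intros)
    from vector_diff_chain_at[OF this flow_derivative] show ?thesis by (simp add: o_def)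
  qed
  from flow_unique[of "\<lambda>s. flow V (s + t) x", OF this] show ?thesis by simp
qed

lemma flow_fixed: "V x = 0 \<Longrightarrow> flow V t x = x"
  using flow_unique[of "\<lambda>_. x"] by simp

text \<open>
  Outside \<open>Om\<close> the flow is stationary, so by uniqueness no integral curve can enter or leave \<open>Om\<close>. In
  particular the restriction of the field to \<open>Om\<close> is complete.
\<close>

lemma flow_invariant:
  assumes zero: "\<And>x. x \<notin> Om \<Longrightarrow> V x = 0" and x: "x \<in> Om"
  shows "flow V t x \<in> Om"
proof (rule ccontr)
  assume "flow V t x \<notin> Om"
  then have "flow V (- t) (flow V t x) = flow V t x" using zero flow_fixed by blast
  then have "x = flow V t x" using flow_add[of "- t" t x] flow_0 by simp
  then show False using x \<open>flow V t x \<notin> Om\<close> by simp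
qed

text \<open>
  The field is smooth on an invariant open set and only Lipschitz across its boundary. The variational
  argument takes place inside the set; the Lipschitz bound makes the flow global.
\<close>

theorem flow_Ck:
  assumes Om: "open Om" and zero: "\<And>x. x \<notin> Om \<Longrightarrow> V x = 0"
    and smooth: "\<And>k. Ck_on k Om V"
  shows "Ck_on k (UNIV \<times> Om) (\<lambda>p. flow V (fst p) (snd p))"
proof (rule ode_param_Ck[OF Om lipschitz_constant_nonneg Om, where G="\<lambda>q. V (snd (snd q))"])
  have D: "open (UNIV \<times> Om \<times> Om :: (real \<times> 'a \<times> 'a) set)" using Om by (simp add: open_Times)
  show "Ck_on k (UNIV \<times> Om \<times> Om :: (real \<times> 'a \<times> 'a) set) (\<lambda>q. V (snd (snd q)))"
    by (rule Ck_on_compose[OF D smooth]) (auto intro!: Ck_on_snd Ck_on_ident D)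
  have "flow V 0 = (\<lambda>x. x)" by (rule ext) (rule flow_0)
  then show "Ck_on k Om (flow V 0)" using Ck_on_ident[OF Om] by simp
  show "flow V t x \<in> Om" if "x \<in> Om" for t x using flow_invariant[OF zero that] by blast
qed (simp_all add: lip flow_derivative)

end

section \<open>Fibrations of the sphere by the argument of a transverse function\<close>

text \<open>
  How an inversion in a sphere changes distances; it enters because the field of unit angular speed is
  the image of a gradient under an inversion.
\<close>

lemma inversion_dist:
  fixes p q :: "'a::real_inner"
  assumes "p \<noteq> 0" "q \<noteq> 0"
  shows "norm (p /\<^sub>R (p \<bullet> p) - q /\<^sub>R (q \<bullet> q)) = norm (p - q) / (norm p * norm q)"
proof (rule power2_eq_imp_eq)
  have pq: "p \<bullet> p \<noteq> 0" "q \<bullet> q \<noteq> 0" using assms by auto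
  have "(norm (p /\<^sub>R (p \<bullet> p) - q /\<^sub>R (q \<bullet> q)))\<^sup>2 =
      (p \<bullet> p - 2 * (p \<bullet> q) + q \<bullet> q) / ((p \<bullet> p) * (q \<bullet> q))"
    unfolding power2_norm_eq_inner
    using pq by (simp add: inner_diff_left inner_diff_right inner_commute[of q p] field_simps)
  also have "\<dots> = (norm (p - q) / (norm p * norm q))\<^sup>2"
    unfolding power_divide power_mult_distrib power2_norm_eq_inner
    by (simp add: inner_diff_left inner_diff_right inner_commute[of q p])
  finally show "(norm (p /\<^sub>R (p \<bullet> p) - q /\<^sub>R (q \<bullet> q)))\<^sup>2 = (norm (p - q) / (norm p * norm q))\<^sup>2" .
qed auto

lemma scaled_inversion_bound:
  fixes p :: "'a::real_inner"
  assumes c: "c > 0" and a: "a \<ge> 0" "c * a \<le> norm p"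
  shows "norm ((a\<^sup>2 / (p \<bullet> p)) *\<^sub>R p) \<le> a / c"
proof (cases "a = 0")
  case False
  then have p: "norm p > 0" using c a by (smt (verit) mult_pos_pos)
  have "norm ((a\<^sup>2 / (p \<bullet> p)) *\<^sub>R p) = a * a / norm p"
    using p by (simp add: power2_eq_square flip: power2_norm_eq_inner)
  also have "\<dots> \<le> a * a / (c * a)"
    using c a False p by (intro divide_left_mono) auto
  finally show ?thesis using False by simp
qed (use c in simp)

text \<open>
  With \<open>a\<close> and \<open>b\<close> the values of \<open>|f|\<close> and \<open>p\<close> and \<open>q\<close> the gradients at two points, this bounds the
  variation of the field of unit angular speed. The lower bounds on \<open>|p|\<close> and \<open>|q|\<close> compensate the
  singularity of the inversion, also at points where \<open>f\<close> vanishes.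
\<close>

lemma scaled_inversion_lipschitz:
  fixes p q :: "'a::real_inner"
  assumes c: "c > 0" and a: "a \<ge> 0" "c * a \<le> norm p" and b: "b \<ge> 0" "c * b \<le> norm q"
  shows "norm ((a\<^sup>2 / (p \<bullet> p)) *\<^sub>R p - (b\<^sup>2 / (q \<bullet> q)) *\<^sub>R q) \<le> 2 / c * \<bar>a - b\<bar> + norm (p - q) / c\<^sup>2"
proof -
  have *: "norm ((a\<^sup>2 / (p \<bullet> p)) *\<^sub>R p - (b\<^sup>2 / (q \<bullet> q)) *\<^sub>R q) \<le> 2 / c * \<bar>a - b\<bar> + norm (p - q) / c\<^sup>2"
    if a: "a \<ge> 0" "c * a \<le> norm p" and b: "b \<ge> 0" "c * b \<le> norm q" and ba: "b \<le> a" for a b and p q :: 'a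
  proof (cases "b = 0")
    case True
    have "norm ((a\<^sup>2 / (p \<bullet> p)) *\<^sub>R p) \<le> a / c" by (rule scaled_inversion_bound[OF c a])
    also have "\<dots> \<le> 2 / c * a" using a c by (simp add: field_simps)
    also have "\<dots> \<le> 2 / c * a + norm (p - q) / c\<^sup>2" by simp
    finally show ?thesis using True a by simp
  next
    case False
    then have b0: "b > 0" and a0: "a > 0" using b ba by auto
    have p: "norm p > 0" and q: "norm q > 0" using c a b a0 b0 by (smt (verit) mult_pos_pos)+
    have "(a\<^sup>2 / (p \<bullet> p)) *\<^sub>R p - (b\<^sup>2 / (q \<bullet> q)) *\<^sub>R q =
        ((a\<^sup>2 - b\<^sup>2) / (p \<bullet> p)) *\<^sub>R p + b\<^sup>2 *\<^sub>R (p /\<^sub>R (p \<bullet> p) - q /\<^sub>R (q \<bullet> q))"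
      by (simp add: scaleR_diff_right scaleR_diff_left left_diff_distrib divide_inverse)
    also have "norm \<dots> \<le> norm (((a\<^sup>2 - b\<^sup>2) / (p \<bullet> p)) *\<^sub>R p) + norm (b\<^sup>2 *\<^sub>R (p /\<^sub>R (p \<bullet> p) - q /\<^sub>R (q \<bullet> q)))"
      by (rule norm_triangle_ineq)
    also have "norm (((a\<^sup>2 - b\<^sup>2) / (p \<bullet> p)) *\<^sub>R p) \<le> 2 / c * \<bar>a - b\<bar>"
    proof -
      have "norm (((a\<^sup>2 - b\<^sup>2) / (p \<bullet> p)) *\<^sub>R p) = \<bar>a\<^sup>2 - b\<^sup>2\<bar> / norm p"
        using p by (simp add: power2_eq_square flip: power2_norm_eq_inner)
      also have "\<bar>a\<^sup>2 - b\<^sup>2\<bar> = (a + b) * \<bar>a - b\<bar>"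
        using a b by (simp add: power2_eq_square square_diff_square_factored abs_mult)
      also have "(a + b) * \<bar>a - b\<bar> / norm p \<le> (2 * a) * \<bar>a - b\<bar> / (c * a)"
        using a b ba c a0 p by (intro frac_le mult_right_mono) auto
      finally show ?thesis using a0 by simp
    qed
    also have "norm (b\<^sup>2 *\<^sub>R (p /\<^sub>R (p \<bullet> p) - q /\<^sub>R (q \<bullet> q))) \<le> norm (p - q) / c\<^sup>2"
    proof -
      have "c\<^sup>2 * b\<^sup>2 \<le> norm p * norm q"
        using mult_mono[of "c * b" "norm p" "c * b" "norm q"] a b ba c
        by (smt (verit) mult_left_mono mult_nonneg_nonneg norm_ge_zero power2_eq_square mult.assoc mult.left_commute)
      then have "norm (p - q) * (c\<^sup>2 * b\<^sup>2) \<le> norm (p - q) * (norm p * norm q)"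
        by (rule mult_left_mono) simp
      then have "b\<^sup>2 * (norm (p - q) / (norm p * norm q)) \<le> norm (p - q) / c\<^sup>2"
        using p q c by (simp add: field_simps)
      then show ?thesis using inversion_dist[of p q] p q by simp
    qed
    finally show ?thesis by simp
  qed
  show ?thesis
  proof (cases "b \<le> a")
    case True
    then show ?thesis using *[OF a b] by simp
  next
    case False
    then show ?thesis using *[OF b a] by (simp add: norm_minus_commute abs_minus_commute)
  qed
qed

lemma radial_extension_lipschitz:
  fixes G :: "'a::real_normed_vector \<Rightarrow> 'b::real_normed_vector"
  assumes lip: "\<And>x y. norm x = 1 \<Longrightarrow> norm y = 1 \<Longrightarrow> norm (G x - G y) \<le> L * norm (x - y)"
    and bd: "\<And>x. norm x = 1 \<Longrightarrow> norm (G x) \<le> M" and "0 \<le> L" "0 \<le> M"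
  shows "norm (norm x *\<^sub>R G (x /\<^sub>R norm x) - norm y *\<^sub>R G (y /\<^sub>R norm y)) \<le> (2 * L + M) * norm (x - y)"
proof (cases "x = 0 \<or> y = 0")
  case True
  have "norm (norm z *\<^sub>R G (z /\<^sub>R norm z)) \<le> (2 * L + M) * norm z" for z
  proof (cases "z = 0")
    case False
    then have "norm z * norm (G (z /\<^sub>R norm z)) \<le> norm z * (2 * L + M)"
      using bd[of "z /\<^sub>R norm z"] \<open>0 \<le> L\<close> by (intro mult_left_mono) auto
    then show ?thesis by (simp add: mult.commute)
  qed simp
  from this[of x] this[of y] show ?thesis using True by auto
next
  case False
  let ?x = "x /\<^sub>R norm x" and ?y = "y /\<^sub>R norm y"
  have u: "norm ?x = 1" "norm ?y = 1" using False by auto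
  have "norm x * norm (?x - ?y) = norm (norm x *\<^sub>R (?x - ?y))" by simp
  also have "norm x *\<^sub>R (?x - ?y) = (x - y) + (norm y - norm x) *\<^sub>R ?y"
    using False by (simp add: scaleR_diff_right scaleR_diff_left left_diff_distrib)
  also have "norm \<dots> \<le> norm (x - y) + \<bar>norm y - norm x\<bar> * 1"
  proof -
    have "norm ((norm y - norm x) *\<^sub>R ?y) = \<bar>norm y - norm x\<bar> * 1"
      by (subst norm_scaleR) (simp only: u)
    then show ?thesis using norm_triangle_ineq[of "x - y" "(norm y - norm x) *\<^sub>R ?y"] by linarith
  qed
  also have "\<dots> \<le> 2 * norm (x - y)"
    using norm_triangle_ineq3[of y x] by (simp add: norm_minus_commute)
  finally have 1: "norm x * norm (?x - ?y) \<le> 2 * norm (x - y)" .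
  have "norm x *\<^sub>R G ?x - norm y *\<^sub>R G ?y = norm x *\<^sub>R (G ?x - G ?y) + (norm x - norm y) *\<^sub>R G ?y"
    by (simp add: scaleR_diff_right scaleR_diff_left)
  also have "norm \<dots> \<le> norm x * norm (G ?x - G ?y) + \<bar>norm x - norm y\<bar> * norm (G ?y)"
    using norm_triangle_ineq[of "norm x *\<^sub>R (G ?x - G ?y)" "(norm x - norm y) *\<^sub>R G ?y"] by simp
  also have "\<dots> \<le> norm x * (L * norm (?x - ?y)) + norm (x - y) * M"
    using lip[OF u] bd[OF u(2)] norm_triangle_ineq3[of x y]
    by (intro add_mono mult_left_mono mult_mono) auto
  also have "\<dots> \<le> L * (2 * norm (x - y)) + norm (x - y) * M"
    using mult_left_mono[OF 1 \<open>0 \<le> L\<close>] by (simp add: mult.left_commute)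
  finally show ?thesis by (simp add: algebra_simps)
qed

lemma C1_lipschitz_on_cball:
  fixes g :: "'a::euclidean_space \<Rightarrow> 'b::euclidean_space"
  assumes "Ck_on 1 UNIV g"
  shows "\<exists>L\<ge>0. \<forall>x\<in>cball 0 1. \<forall>y\<in>cball 0 1. norm (g x - g y) \<le> L * norm (x - y)"
proof -
  let ?D = "\<lambda>x. frechet_derivative g (at x)"
  have dg: "(g has_derivative ?D x) (at x)" for x
    using assms by (intro Ck_on_Suc_has_derivative[of 0 UNIV]) simp_all
  have cont: "continuous_on UNIV (\<lambda>x. ?D x e)" for e using assms by simp
  have "\<exists>M. \<forall>x\<in>cball 0 1. norm (?D x e) \<le> M" for e
    using compact_imp_bounded[OF compact_continuous_image[OF continuous_on_subset[OF cont] compact_cball, of 0 1 e]]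
    unfolding bounded_iff by auto
  then obtain M where M: "\<And>e x. x \<in> cball 0 1 \<Longrightarrow> norm (?D x e) \<le> M e" by metis
  have M0: "M e \<ge> 0" for e using M[of 0 e] order_trans[OF norm_ge_zero] by auto
  have "norm (g x - g y) \<le> (\<Sum>e\<in>Basis. M e) * norm (x - y)" if "x \<in> cball 0 1" "y \<in> cball 0 1" for x y
  proof (rule differentiable_bound[OF convex_cball])
    show "(g has_derivative ?D x) (at x within cball 0 1)" for x
      using dg by (rule has_derivative_at_withinI)
    show "onorm (?D x) \<le> (\<Sum>e\<in>Basis. M e)" if x: "x \<in> cball 0 1" for x
    proof (rule onorm_bound)
      show "norm (?D x v) \<le> (\<Sum>e\<in>Basis. M e) * norm v" for v
        by (rule linear_norm_bound[OF has_derivative_linear[OF dg] M[OF x]])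
    qed (simp add: sum_nonneg M0)
  qed (use that in auto)
  then show ?thesis by (intro exI[of _ "\<Sum>e\<in>Basis. M e"]) (auto intro: sum_nonneg M0)
qed

lemma cis_Im_Ln: "z \<noteq> 0 \<Longrightarrow> cis (Im (Ln z)) = sgn z"
  by (simp add: cis_Arg flip: Arg_eq_Im_Ln)

lemma Im_cnj_mult_eq_inner: "Im (cnj z * w) = (\<i> * z) \<bullet> w"
  by (simp add: inner_complex_def)

text \<open>
  The gradient at \<open>x\<close> of the restriction of \<open>Im (cnj \<zeta> * f)\<close> to the sphere of radius 1, as a function of
  \<open>\<zeta>\<close> as well. For \<open>\<zeta> = f x\<close> it is \<open>|f x|\<^sup>2\<close> times the gradient of the argument; for unit \<open>\<zeta>\<close> it need not
  vanish at the zeros of \<open>f\<close>.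
\<close>

definition tangential_grad :: "('a::euclidean_space \<Rightarrow> complex) \<Rightarrow> 'a \<Rightarrow> complex \<Rightarrow> 'a" where
  "tangential_grad f x \<zeta> = (let g = \<Sum>e\<in>Basis. ((\<i> * \<zeta>) \<bullet> frechet_derivative f (at x) e) *\<^sub>R e in g - (g \<bullet> x) *\<^sub>R x)"

text \<open>
  The multiple of the gradient of the argument along which the argument grows at unit speed. At a zero
  of \<open>f\<close> the numerator, the denominator and the vector vanish, and the value is 0.
\<close>

definition arg_field :: "('a::euclidean_space \<Rightarrow> complex) \<Rightarrow> 'a \<Rightarrow> 'a" where
  "arg_field f x = ((norm (f x))\<^sup>2 / (tangential_grad f x (f x) \<bullet> tangential_grad f x (f x))) *\<^sub>R tangential_grad f x (f x)"

text \<open>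
  The extension that is homogeneous of degree 1 is Lipschitz on the whole space, including the origin,
  and tangent to all spheres; so the flow exists for all times and preserves the unit sphere.
\<close>

definition cone_arg_field :: "('a::euclidean_space \<Rightarrow> complex) \<Rightarrow> 'a \<Rightarrow> 'a" where
  "cone_arg_field f x = norm x *\<^sub>R arg_field f (x /\<^sub>R norm x)"

context
  fixes f :: "'a::euclidean_space \<Rightarrow> complex"
  assumes smooth: "\<And>k. Ck_on k UNIV f"
    and trans: "\<And>x \<zeta>. norm x = 1 \<Longrightarrow> norm \<zeta> = 1 \<Longrightarrow> f x = of_real (norm (f x)) * \<zeta> \<Longrightarrow>
      \<exists>w. w \<bullet> x = 0 \<and> Im (cnj \<zeta> * frechet_derivative f (at x) w) \<noteq> 0"
    and ex: "\<exists>x. norm x = 1 \<and> f x \<noteq> 0"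
begin

lemma f_deriv: "(f has_derivative frechet_derivative f (at x)) (at x)"
  using smooth[of "Suc 0"] by (rule Ck_on_Suc_has_derivative) simp

lemma tangential_grad_inner:
  assumes "w \<bullet> x = 0"
  shows "tangential_grad f x \<zeta> \<bullet> w = (\<i> * \<zeta>) \<bullet> frechet_derivative f (at x) w"
proof -
  have "(\<Sum>e\<in>Basis. ((\<i> * \<zeta>) \<bullet> frechet_derivative f (at x) e) *\<^sub>R e) \<bullet> w =
      (\<Sum>e\<in>Basis. ((\<i> * \<zeta>) \<bullet> frechet_derivative f (at x) e) * (w \<bullet> e))"
    unfolding inner_sum_left by (simp add: inner_commute)
  also have "\<dots> = (\<i> * \<zeta>) \<bullet> (\<Sum>e\<in>Basis. (w \<bullet> e) *\<^sub>R frechet_derivative f (at x) e)"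
    by (simp add: inner_sum_right mult.commute)
  also have "(\<Sum>e\<in>Basis. (w \<bullet> e) *\<^sub>R frechet_derivative f (at x) e) = frechet_derivative f (at x) w"
    by (rule linear_basis_expansion[OF has_derivative_linear[OF f_deriv], symmetric])
  finally show ?thesis using assms by (simp add: tangential_grad_def Let_def inner_diff_left inner_commute[of x w])
qed

lemma tangential_grad_tangent: "norm x = 1 \<Longrightarrow> tangential_grad f x \<zeta> \<bullet> x = 0"
  by (simp add: tangential_grad_def Let_def inner_diff_left dot_square_norm)

lemma tangential_grad_scale: "tangential_grad f x (of_real r * \<zeta>) = r *\<^sub>R tangential_grad f x \<zeta>"
proof -
  have "(\<i> * (of_real r * \<zeta>)) \<bullet> w = r * ((\<i> * \<zeta>) \<bullet> w)" for w
    by (simp add: inner_complex_def algebra_simps)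
  then show ?thesis
    unfolding tangential_grad_def Let_def
    by (simp only: scaleR_scaleR[symmetric] scaleR_sum_right[symmetric]
        inner_scaleR_left scaleR_diff_right)
qed

lemma tangential_grad_Ck:
  assumes W: "open W" and "Ck_on k W g" "Ck_on k W h"
  shows "Ck_on k W (\<lambda>p. tangential_grad f (g p) (h p))"
proof -
  have 1: "Ck_on k W (\<lambda>p. frechet_derivative f (at (g p)) e)" for e
    using smooth[of "Suc k"] by (intro Ck_on_compose[OF W _ assms(2), of UNIV]) auto
  have 2: "Ck_on k W (\<lambda>p. \<i> * h p)" by (intro Ck_on_mult Ck_on_const assms)
  have 3: "Ck_on k W (\<lambda>p. \<Sum>e\<in>Basis. ((\<i> * h p) \<bullet> frechet_derivative f (at (g p)) e) *\<^sub>R e)"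
    by (intro Ck_on_sum[OF W] Ck_on_scaleR[OF W] Ck_on_inner[OF W] Ck_on_const[OF W] 1 2)
  show ?thesis
    unfolding tangential_grad_def Let_def
    by (intro Ck_on_diff[OF W] Ck_on_scaleR[OF W] Ck_on_inner[OF W] 3 assms)
qed

text \<open>
  The pairs \<open>(x, \<zeta>)\<close> with \<open>f x = |f x| \<zeta>\<close> form a compact set, which over a zero of \<open>f\<close> contains the whole
  circle. By transversality \<open>tangential_grad f x \<zeta>\<close> vanishes nowhere on it and is therefore bounded
  below; scaling \<open>\<zeta>\<close> to \<open>f x\<close> gives the factor \<open>|f x|\<close>.
\<close>

lemma tangential_grad_lower_bound:
  "\<exists>c>0. \<forall>x. norm x = 1 \<longrightarrow> c * norm (f x) \<le> norm (tangential_grad f x (f x))"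
proof -
  let ?C = "(sphere 0 1 \<times> sphere 0 1) \<inter> {p. f (fst p) - of_real (norm (f (fst p))) * snd p = 0}"
  have cf: "continuous_on UNIV f" by (rule Ck_on_imp_continuous_on[OF smooth])
  have cf': "continuous_on UNIV (\<lambda>p :: 'a \<times> complex. f (fst p))"
    by (rule continuous_on_compose2[OF cf]) (auto intro: continuous_intros)
  have "closed {p :: 'a \<times> complex. f (fst p) - of_real (norm (f (fst p))) * snd p = 0}"
    by (intro closed_Collect_eq continuous_intros cf')
  then have C: "compact ?C" by (intro compact_Int_closed compact_Times) auto
  obtain x0 where x0: "norm x0 = 1" "f x0 \<noteq> 0" using ex by blast
  have mem: "(x, sgn (f x)) \<in> ?C" if "norm x = 1" "f x \<noteq> 0" for x
    using that by (simp add: norm_mult norm_inverse sgn_div_norm scaleR_conv_of_real)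
  then have ne: "?C \<noteq> {}" using x0 by blast
  have "Ck_on 0 UNIV (\<lambda>p :: 'a \<times> complex. tangential_grad f (fst p) (snd p))"
    by (intro tangential_grad_Ck Ck_on_fst Ck_on_snd Ck_on_ident open_UNIV)
  then have "continuous_on UNIV (\<lambda>p :: 'a \<times> complex. tangential_grad f (fst p) (snd p))" by simp
  then have "continuous_on ?C (\<lambda>p. norm (tangential_grad f (fst p) (snd p)))"
    by (intro continuous_on_norm) (rule continuous_on_subset, auto)
  from continuous_attains_inf[OF C ne this]
  obtain p where p: "p \<in> ?C" "\<And>q. q \<in> ?C \<Longrightarrow> norm (tangential_grad f (fst p) (snd p)) \<le> norm (tangential_grad f (fst q) (snd q))"
    by blast
  have "norm (tangential_grad f (fst p) (snd p)) > 0"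
  proof -
    have "norm (fst p) = 1" "norm (snd p) = 1" "f (fst p) = of_real (norm (f (fst p))) * snd p"
      using p(1) by (auto simp: mem_Times_iff)
    from trans[OF this] obtain w where w: "w \<bullet> fst p = 0"
      "Im (cnj (snd p) * frechet_derivative f (at (fst p)) w) \<noteq> 0" by blast
    then show ?thesis using tangential_grad_inner[OF w(1), of "snd p"] unfolding Im_cnj_mult_eq_inner by auto
  qed
  moreover have "norm (tangential_grad f (fst p) (snd p)) * norm (f x) \<le> norm (tangential_grad f x (f x))" if x: "norm x = 1" for x
  proof (cases "f x = 0")
    case False
    have "norm (f x) * norm (tangential_grad f (fst p) (snd p)) \<le> norm (f x) * norm (tangential_grad f x (sgn (f x)))"
      using p(2)[OF mem[OF x False]] by (intro mult_left_mono) auto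
    also have "\<dots> = norm (norm (f x) *\<^sub>R tangential_grad f x (sgn (f x)))" by simp
    also have "norm (f x) *\<^sub>R tangential_grad f x (sgn (f x)) = tangential_grad f x (f x)"
      using False by (simp add: sgn_eq flip: tangential_grad_scale)
    finally show ?thesis by (simp add: mult.commute)
  qed simp
  ultimately show ?thesis by blast
qed

lemma tangential_grad_nonzero: "norm x = 1 \<Longrightarrow> f x \<noteq> 0 \<Longrightarrow> tangential_grad f x (f x) \<noteq> 0"
  using tangential_grad_lower_bound by (force simp: mult_le_0_iff)

lemma cone_arg_field_lipschitz:
  "\<exists>L. \<forall>x y. norm (cone_arg_field f x - cone_arg_field f y) \<le> L * norm (x - y)"
proof -
  obtain c where c: "c > 0" "\<And>x. norm x = 1 \<Longrightarrow> c * norm (f x) \<le> norm (tangential_grad f x (f x))"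
    using tangential_grad_lower_bound by blast
  obtain Lf where Lf: "Lf \<ge> 0" "\<And>x y. norm x = 1 \<Longrightarrow> norm y = 1 \<Longrightarrow> norm (f x - f y) \<le> Lf * norm (x - y)"
  proof -
    obtain K where "K \<ge> 0" "\<forall>x\<in>cball 0 1. \<forall>y\<in>cball 0 1. norm (f x - f y) \<le> K * norm (x - y)"
      using C1_lipschitz_on_cball[OF smooth[of 1]] by blast
    then show ?thesis using that[of K] by simp
  qed
  have "Ck_on 1 UNIV (\<lambda>x. tangential_grad f x (f x))"
    by (rule tangential_grad_Ck[OF open_UNIV Ck_on_ident[OF open_UNIV] smooth])
  then obtain La where La: "La \<ge> 0"
    "\<And>x y. norm x = 1 \<Longrightarrow> norm y = 1 \<Longrightarrow> norm (tangential_grad f x (f x) - tangential_grad f y (f y)) \<le> La * norm (x - y)"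
  proof -
    assume "Ck_on 1 UNIV (\<lambda>x. tangential_grad f x (f x))"
    then obtain K where "K \<ge> 0" "\<forall>x\<in>cball 0 1. \<forall>y\<in>cball 0 1.
        norm (tangential_grad f x (f x) - tangential_grad f y (f y)) \<le> K * norm (x - y)"
      using C1_lipschitz_on_cball by blast
    then show ?thesis using that[of K] by simp
  qed
  have "compact (f ` sphere 0 1)"
    by (intro compact_continuous_image compact_sphere continuous_on_subset[OF Ck_on_imp_continuous_on[OF smooth]]) auto
  then obtain M where M: "\<And>x. norm x = 1 \<Longrightarrow> norm (f x) \<le> M"
  proof -
    assume "compact (f ` sphere 0 1)"
    from bounded_iff[THEN iffD1, OF compact_imp_bounded[OF this]]
    obtain K where "\<forall>z\<in>f ` sphere 0 1. norm z \<le> K" ..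
    then show ?thesis using that[of K] by simp
  qed
  have M0: "M \<ge> 0" using ex M order_trans[OF norm_ge_zero] by blast
  define L where "L = 2 / c * Lf + La / c\<^sup>2"
  have "norm (cone_arg_field f x - cone_arg_field f y) \<le> (2 * L + M / c) * norm (x - y)" for x y
    unfolding cone_arg_field_def
  proof (rule radial_extension_lipschitz)
    show "0 \<le> L" "0 \<le> M / c" using c Lf La M0 by (auto simp: L_def)
    fix x :: 'a assume x: "norm x = 1"
    have "norm (arg_field f x) \<le> norm (f x) / c"
      unfolding arg_field_def by (rule scaled_inversion_bound) (use c x in auto)
    also have "\<dots> \<le> M / c" using M[OF x] c by (simp add: divide_right_mono)
    finally show "norm (arg_field f x) \<le> M / c" .
    fix y :: 'a assume y: "norm y = 1"
    have "norm (arg_field f x - arg_field f y)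
        \<le> 2 / c * \<bar>norm (f x) - norm (f y)\<bar> + norm (tangential_grad f x (f x) - tangential_grad f y (f y)) / c\<^sup>2"
      unfolding arg_field_def by (rule scaled_inversion_lipschitz) (use c x y in auto)
    also have "\<dots> \<le> 2 / c * (Lf * norm (x - y)) + La * norm (x - y) / c\<^sup>2"
      using order_trans[OF norm_triangle_ineq3 Lf(2)[OF x y]] La(2)[OF x y] c
      by (intro add_mono mult_left_mono divide_right_mono) auto
    also have "\<dots> = L * norm (x - y)" by (simp add: L_def algebra_simps)
    finally show "norm (arg_field f x - arg_field f y) \<le> L * norm (x - y)" .
  qed
  then show ?thesis by blast
qed

definition "regular_cone = {x. x \<noteq> 0 \<and> f (x /\<^sub>R norm x) \<noteq> 0}"

lemma normalize_Ck: "open W \<Longrightarrow> 0 \<notin> W \<Longrightarrow> Ck_on k W (\<lambda>x :: 'a. x /\<^sub>R norm x)"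
  by (intro Ck_on_scaleR Ck_on_inverse Ck_on_norm Ck_on_ident) auto

lemma regular_cone_open: "open regular_cone"
proof -
  have "continuous_on (UNIV - {0}) (\<lambda>x :: 'a. f (x /\<^sub>R norm x))"
    by (rule continuous_on_compose2[OF Ck_on_imp_continuous_on[OF smooth]
        Ck_on_imp_continuous_on[OF normalize_Ck]]) auto
  then have "open ((UNIV - {0}) \<inter> (\<lambda>x :: 'a. f (x /\<^sub>R norm x)) -` (- {0}))"
    by (rule continuous_open_preimage) auto
  moreover have "(UNIV - {0}) \<inter> (\<lambda>x :: 'a. f (x /\<^sub>R norm x)) -` (- {0}) = regular_cone"
    by (auto simp: regular_cone_def)
  ultimately show ?thesis by simp
qed

lemma cone_arg_field_Ck: "Ck_on k regular_cone (cone_arg_field f)"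
proof -
  have 0: "0 \<notin> regular_cone" by (simp add: regular_cone_def)
  have n: "Ck_on k regular_cone (\<lambda>x. x /\<^sub>R norm x)" by (rule normalize_Ck[OF regular_cone_open 0])
  have fn: "Ck_on k regular_cone (\<lambda>x. f (x /\<^sub>R norm x))"
    by (rule Ck_on_compose[OF regular_cone_open smooth n]) auto
  have an: "Ck_on k regular_cone (\<lambda>x. tangential_grad f (x /\<^sub>R norm x) (f (x /\<^sub>R norm x)))" (is "Ck_on k regular_cone ?a")
    by (rule tangential_grad_Ck[OF regular_cone_open n fn])
  have nz: "?a x \<bullet> ?a x \<noteq> 0" if "x \<in> regular_cone" for x
    using tangential_grad_nonzero[of "x /\<^sub>R norm x"] that by (simp add: regular_cone_def)
  have "Ck_on k regular_cone (\<lambda>x. norm x *\<^sub>R ((f (x /\<^sub>R norm x) \<bullet> f (x /\<^sub>R norm x)) * inverse (?a x \<bullet> ?a x)) *\<^sub>R ?a x)"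
    by (intro Ck_on_scaleR[OF regular_cone_open] Ck_on_mult[OF regular_cone_open] Ck_on_inner[OF regular_cone_open]
        Ck_on_inverse[OF regular_cone_open] Ck_on_norm[OF regular_cone_open] Ck_on_ident[OF regular_cone_open] fn an nz)
      (use 0 in auto)
  then show ?thesis
    by (simp add: cone_arg_field_def[abs_def] arg_field_def power2_norm_eq_inner divide_inverse)
qed

lemma cone_arg_field_zero: "x \<notin> regular_cone \<Longrightarrow> cone_arg_field f x = 0"
  by (auto simp: regular_cone_def cone_arg_field_def arg_field_def)

lemma cone_arg_field_sphere: "norm x = 1 \<Longrightarrow> cone_arg_field f x = arg_field f x"
  by (simp add: cone_arg_field_def)

lemma cone_arg_field_tangent: "cone_arg_field f x \<bullet> x = 0"
proof (cases "x = 0")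
  case False
  have "arg_field f (x /\<^sub>R norm x) \<bullet> (x /\<^sub>R norm x) = 0"
    using tangential_grad_tangent[of "x /\<^sub>R norm x"] False by (simp add: arg_field_def)
  then show ?thesis using False by (simp add: cone_arg_field_def)
qed simp

definition arg_flow :: "real \<Rightarrow> 'a \<Rightarrow> 'a" where "arg_flow = flow (cone_arg_field f)"

lemma arg_flow_0: "arg_flow 0 x = x"
  and arg_flow_derivative: "((\<lambda>t. arg_flow t x) has_vector_derivative cone_arg_field f (arg_flow t x)) (at t)"
  and arg_flow_add: "arg_flow (s + t) x = arg_flow s (arg_flow t x)"
  and arg_flow_cone: "x \<in> regular_cone \<Longrightarrow> arg_flow t x \<in> regular_cone"
  and arg_flow_Ck: "Ck_on k (UNIV \<times> regular_cone) (\<lambda>p. arg_flow (fst p) (snd p))"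
proof -
  obtain L where L: "\<And>x y. norm (cone_arg_field f x - cone_arg_field f y) \<le> L * norm (x - y)"
    using cone_arg_field_lipschitz by blast
  show "arg_flow 0 x = x" "((\<lambda>t. arg_flow t x) has_vector_derivative cone_arg_field f (arg_flow t x)) (at t)"
    "arg_flow (s + t) x = arg_flow s (arg_flow t x)"
    unfolding arg_flow_def using flow_0[OF L] flow_derivative[OF L] flow_add[OF L] by blast+
  show "x \<in> regular_cone \<Longrightarrow> arg_flow t x \<in> regular_cone"
    unfolding arg_flow_def using flow_invariant[OF L cone_arg_field_zero] by blast
  show "Ck_on k (UNIV \<times> regular_cone) (\<lambda>p. arg_flow (fst p) (snd p))"
    unfolding arg_flow_def by (rule flow_Ck[OF L regular_cone_open cone_arg_field_zero cone_arg_field_Ck])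
qed

lemma arg_flow_norm: "norm (arg_flow t x) = norm x"
proof -
  have "((\<lambda>t. arg_flow t x \<bullet> arg_flow t x) has_derivative (\<lambda>h. 0)) (at t)" for t
  proof -
    have d: "((\<lambda>t. arg_flow t x) has_derivative (\<lambda>h. h *\<^sub>R cone_arg_field f (arg_flow t x))) (at t)"
      using arg_flow_derivative[of x t] by (simp add: has_vector_derivative_def)
    show ?thesis
      by (rule has_derivative_eq_rhs[OF has_derivative_inner[OF d d]])
        (simp add: cone_arg_field_tangent inner_commute[of "arg_flow t x"])
  qed
  then have "arg_flow t x \<bullet> arg_flow t x = arg_flow 0 x \<bullet> arg_flow 0 x"
    by (intro has_derivative_zero_unique[of UNIV]) auto
  then show ?thesis by (simp add: arg_flow_0 norm_eq_sqrt_inner)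
qed

definition "regular_sphere = sphere 0 1 - f -` {0}"

lemma regular_sphere_subset_cone: "x \<in> regular_sphere \<Longrightarrow> x \<in> regular_cone"
  by (auto simp: regular_sphere_def regular_cone_def)

lemma regular_sphere_iff: "x \<in> regular_sphere \<longleftrightarrow> norm x = 1 \<and> f x \<noteq> 0"
  by (auto simp: regular_sphere_def)

lemma arg_flow_sphere: "x \<in> regular_sphere \<Longrightarrow> arg_flow t x \<in> regular_sphere"
  using arg_flow_cone[of x t] arg_flow_norm[of t x] regular_sphere_subset_cone[of x] by (auto simp: regular_sphere_iff regular_cone_def)

text \<open>
  Along an integral curve the logarithmic derivative of \<open>f\<close> has imaginary part 1, so that \<open>sgn f\<close> solves
  \<open>y' = \<i> y\<close>.
\<close>

lemma arg_flow_rotates: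
  assumes x: "x \<in> regular_sphere"
  shows "sgn (f (arg_flow t x)) = cis t * sgn (f x)"
proof -
  let ?q = "\<lambda>t. f (arg_flow t x)"
  have "((\<lambda>t. cis (- t) * sgn (?q t)) has_derivative (\<lambda>h. 0)) (at t)" for t
  proof -
    define u where "u = arg_flow t x"
    define q' where "q' = frechet_derivative f (at u) (arg_field f u)"
    have u: "norm u = 1" "f u \<noteq> 0" using arg_flow_sphere[OF x, of t] by (auto simp: u_def regular_sphere_iff)
    have dq: "(?q has_vector_derivative q') (at t)"
    proof -
      have "((\<lambda>t. arg_flow t x) has_derivative (\<lambda>h. h *\<^sub>R arg_field f u)) (at t)"
        using arg_flow_derivative[of x t] cone_arg_field_sphere[OF u(1)] by (simp add: has_vector_derivative_def u_def)
      from diff_chain_at[OF this f_deriv] show ?thesis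
        using linear_cmul[OF has_derivative_linear[OF f_deriv[of u]]]
        by (simp add: has_vector_derivative_def o_def q'_def flip: u_def)
    qed
    have speed: "(\<i> * f u) \<bullet> q' = (norm (f u))\<^sup>2"
    proof -
      have "arg_field f u \<bullet> u = 0"
        using cone_arg_field_tangent[of u] cone_arg_field_sphere[OF u(1)] by simp
      then have "(\<i> * f u) \<bullet> q' = tangential_grad f u (f u) \<bullet> arg_field f u"
        using tangential_grad_inner by (simp add: q'_def)
      also have "\<dots> = (norm (f u))\<^sup>2"
        using tangential_grad_nonzero[OF u] by (simp add: arg_field_def)
      finally show ?thesis .
    qed
    define n where "n = norm (f u)"
    have n: "n > 0" "(Re (f u))\<^sup>2 + (Im (f u))\<^sup>2 = n\<^sup>2" using u by (auto simp: n_def cmod_power2)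
    have d: "(?q has_derivative (\<lambda>h. h *\<^sub>R q')) (at t)"
      using dq by (simp only: has_vector_derivative_def)
    have "((\<lambda>t. ?q t \<bullet> ?q t) has_derivative (\<lambda>h. ?q t \<bullet> (h *\<^sub>R q') + (h *\<^sub>R q') \<bullet> ?q t)) (at t)"
      by (rule has_derivative_inner[OF d d])
    also have "(\<lambda>h. ?q t \<bullet> (h *\<^sub>R q') + (h *\<^sub>R q') \<bullet> ?q t) = (*) (2 * (f u \<bullet> q'))"
      unfolding u_def[symmetric] by (rule ext) (simp add: inner_commute)
    finally have sq: "((\<lambda>t. ?q t \<bullet> ?q t) has_real_derivative 2 * (f u \<bullet> q')) (at t)"
      unfolding has_field_derivative_def .
    have pos: "?q t \<bullet> ?q t > 0" using u(2) unfolding u_def[symmetric] by simp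
    have sqrt: "sqrt (?q t \<bullet> ?q t) = n" by (simp only: n_def u_def norm_eq_sqrt_inner)
    have dn: "((\<lambda>t. norm (?q t)) has_real_derivative (f u \<bullet> q') / n) (at t)"
    proof -
      have "inverse (sqrt (?q t \<bullet> ?q t)) / 2 * (2 * (f u \<bullet> q')) = (f u \<bullet> q') / n"
        unfolding sqrt using n(1) by (simp add: field_simps)
      with DERIV_chain2[OF DERIV_real_sqrt[OF pos] sq]
      have "((\<lambda>t. sqrt (?q t \<bullet> ?q t)) has_real_derivative (f u \<bullet> q') / n) (at t)"
        by (simp only:)
      then show ?thesis by (simp only: norm_eq_sqrt_inner)
    qed
    have din: "((\<lambda>t. inverse (norm (?q t))) has_real_derivative - ((f u \<bullet> q') / n / n\<^sup>2)) (at t)"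
    proof -
      have fn: "norm (?q t) = n" unfolding n_def u_def ..
      have "- (inverse n * ((f u \<bullet> q') / n) * inverse n) = - ((f u \<bullet> q') / n / n\<^sup>2)"
        using n(1) by (simp add: field_simps power2_eq_square)
      moreover have "norm (?q t) \<noteq> 0" using fn n(1) by simp
      from DERIV_inverse'[OF dn this]
      have "((\<lambda>t. inverse (norm (?q t))) has_real_derivative - (inverse n * ((f u \<bullet> q') / n) * inverse n)) (at t)"
        unfolding fn .
      ultimately show ?thesis by (simp only:)
    qed
    have ds: "((\<lambda>t. sgn (?q t)) has_vector_derivative \<i> * sgn (f u)) (at t)"
    proof -
      have "((\<lambda>t. inverse (norm (?q t)) *\<^sub>R ?q t) has_vector_derivative
          inverse n *\<^sub>R q' + (- ((f u \<bullet> q') / n / n\<^sup>2)) *\<^sub>R f u) (at t)"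
        using has_vector_derivative_scaleR[OF din dq] by (simp add: u_def[symmetric] n_def[symmetric])
      moreover have "inverse n *\<^sub>R q' + (- ((f u \<bullet> q') / n / n\<^sup>2)) *\<^sub>R f u = \<i> * sgn (f u)"
      proof -
        have nq: "n\<^sup>2 *\<^sub>R q' = (f u \<bullet> q') *\<^sub>R f u + ((\<i> * f u) \<bullet> q') *\<^sub>R (\<i> * f u)"
          unfolding n(2)[symmetric]
          by (simp add: complex_eq_iff inner_complex_def algebra_simps power2_eq_square)
        have "inverse n *\<^sub>R q' = (inverse n / n\<^sup>2) *\<^sub>R (n\<^sup>2 *\<^sub>R q')" using n(1) by simp
        also have "\<dots> = ((f u \<bullet> q') / n / n\<^sup>2) *\<^sub>R f u + inverse n *\<^sub>R (\<i> * f u)"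
        proof -
          have "inverse n / n\<^sup>2 * (f u \<bullet> q') = (f u \<bullet> q') / n / n\<^sup>2" using n(1) by (simp add: field_simps)
          moreover have "inverse n / n\<^sup>2 * n\<^sup>2 = inverse n" using n(1) by simp
          ultimately show ?thesis
            unfolding nq speed n_def[symmetric] by (simp only: scaleR_add_right scaleR_scaleR)
        qed
        finally show ?thesis by (simp add: sgn_div_norm n_def)
      qed
      ultimately show ?thesis by (simp add: sgn_div_norm)
    qed
    have "((\<lambda>t. cis (- t)) has_vector_derivative - \<i> * cis (- t)) (at t)"
      unfolding has_vector_derivative_def by (auto intro!: derivative_eq_intros)
    from has_vector_derivative_mult[OF this ds]
    show ?thesis by (simp add: has_vector_derivative_def u_def)
  qed
  then have "cis (- t) * sgn (?q t) = cis (- 0) * sgn (?q 0)"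
    by (intro has_derivative_zero_unique[of UNIV]) auto
  then have "cis t * (cis (- t) * sgn (?q t)) = cis t * sgn (f x)" by (simp add: arg_flow_0)
  then show ?thesis by (simp add: cis_mult flip: mult.assoc)
qed

definition "arg_map x = arg_circle (f x)"

lemma arg_map_sgn: "f x \<noteq> 0 \<Longrightarrow> arg_map x = sgn (f x)"
  by (simp add: arg_map_def arg_circle_def cis_Arg)

lemma arg_map_flow: "x \<in> regular_sphere \<Longrightarrow> arg_map (arg_flow t x) = cis t * arg_map x"
  using arg_flow_rotates[of x t] arg_flow_sphere[of x t] by (simp add: arg_map_sgn regular_sphere_iff)

text \<open>
  A lift of the argument is stationary at a critical point along every curve, but it grows at unit
  speed along the flow.
\<close>

theorem no_phase_critical: "x \<in> regular_sphere \<Longrightarrow> \<not> phase_critical (sphere 0 1) f x"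
proof
  assume x: "x \<in> regular_sphere" and "phase_critical (sphere 0 1) f x"
  then obtain U \<theta> where U: "openin (top_of_set (sphere 0 1)) U" "x \<in> U"
    and \<theta>: "\<And>y. y \<in> U \<Longrightarrow> f y \<noteq> 0 \<and> cis (\<theta> y) = arg_circle (f y)"
    and "(\<theta> has_derivative (\<bullet>) 0) (at x within sphere 0 1)"
    unfolding phase_critical_def has_arg_gradient_on_def has_gradient_on_def by auto
  then have d\<theta>: "(\<theta> has_derivative (\<lambda>y. 0)) (at x within sphere 0 1)"
    by (simp add: inner_zero_left[abs_def])
  have darg_flow: "((\<lambda>t. arg_flow t x) has_derivative (\<lambda>h. h *\<^sub>R cone_arg_field f x)) (at 0)"
    using arg_flow_derivative[of x 0] by (simp add: has_vector_derivative_def arg_flow_0)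
  have "(\<theta> has_derivative (\<lambda>y. 0)) (at (arg_flow 0 x) within range (\<lambda>t. arg_flow t x))"
    unfolding arg_flow_0 by (rule has_derivative_subset[OF d\<theta>]) (use x in \<open>auto simp: arg_flow_norm regular_sphere_iff\<close>)
  from has_derivative_in_compose[OF darg_flow this]
  have "((\<lambda>t. \<theta> (arg_flow t x)) has_derivative (\<lambda>h. 0)) (at 0)" by simp
  from has_derivative_cis[OF this]
  have 1: "((\<lambda>t. cis (\<theta> (arg_flow t x))) has_derivative (\<lambda>h. 0)) (at 0)" by simp
  have "((\<lambda>t. cis t * arg_map x) has_vector_derivative \<i> * arg_map x) (at 0)"
    unfolding has_vector_derivative_def by (auto intro!: derivative_eq_intros)
  moreover have "((\<lambda>t. cis t * arg_map x) has_vector_derivative 0) (at 0)"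
  proof -
    obtain T where T: "open T" "U = sphere 0 1 \<inter> T" using U(1) by (auto simp: openin_open)
    have "open ((\<lambda>t. arg_flow t x) -` T)"
      by (intro open_vimage T continuous_at_imp_continuous_on ballI has_vector_derivative_continuous[OF arg_flow_derivative])
    moreover have "0 \<in> (\<lambda>t. arg_flow t x) -` T" using U(2) T(2) by (simp add: arg_flow_0)
    moreover have "cis (\<theta> (arg_flow t x)) = cis t * arg_map x" if "t \<in> (\<lambda>t. arg_flow t x) -` T" for t
    proof -
      have "arg_flow t x \<in> U" using that T(2) x by (simp add: arg_flow_norm regular_sphere_iff)
      then show ?thesis using \<theta>[of "arg_flow t x"] arg_map_flow[OF x, of t] by (simp add: arg_map_def)
    qed
    ultimately have "((\<lambda>t. cis t * arg_map x) has_derivative (\<lambda>h. 0)) (at 0)"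
      by (rule has_derivative_transform_within_open[OF 1])
    then show ?thesis by (simp add: has_vector_derivative_def)
  qed
  ultimately have "\<i> * arg_map x = 0" by (rule vector_derivative_unique_at)
  then show False using x by (simp add: arg_map_sgn regular_sphere_iff sgn_zero_iff)
qed

lemma sgn_f_Ck:
  assumes "open W" "\<And>y. y \<in> W \<Longrightarrow> f y \<noteq> 0"
  shows "Ck_on k W (\<lambda>y. sgn (f y))"
  unfolding sgn_div_norm
  by (intro Ck_on_scaleR Ck_on_inverse Ck_on_norm Ck_on_subset[OF smooth] assms) (use assms in auto)

lemma open_nonzero: "open {y. f y \<noteq> 0}"
  by (intro open_Collect_neq Ck_on_imp_continuous_on[OF smooth] continuous_on_const)

lemma smooth_map_arg_map: "smooth_map regular_sphere arg_map"
  unfolding smooth_map_def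
proof
  fix x assume "x \<in> regular_sphere"
  then show "\<exists>U g. open U \<and> x \<in> U \<and> (\<forall>k. Ck_on k U g) \<and> (\<forall>y\<in>U \<inter> regular_sphere. g y = arg_map y)"
    by (intro exI[of _ "{y. f y \<noteq> 0}"] exI[of _ "\<lambda>y. sgn (f y)"])
      (auto simp: arg_map_sgn regular_sphere_iff intro!: open_nonzero sgn_f_Ck)
qed

lemma arg_map_image: "arg_map ` regular_sphere = sphere 0 1"
proof
  show "arg_map ` regular_sphere \<subseteq> sphere 0 1" by (auto simp: arg_map_sgn regular_sphere_iff norm_sgn)
  show "sphere 0 1 \<subseteq> arg_map ` regular_sphere"
  proof
    fix b :: complex assume "b \<in> sphere 0 1"
    then have b: "norm b = 1" by simp
    obtain x0 where x0: "x0 \<in> regular_sphere" using ex by (auto simp: regular_sphere_iff)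
    have "arg_map x0 = cis (Arg (f x0))" by (simp add: arg_map_def arg_circle_def)
    moreover have "b = cis (Arg b)"
    proof -
      have "b \<noteq> 0" using b by auto
      from cis_Arg[OF this] show ?thesis using b by (simp add: sgn_div_norm)
    qed
    ultimately have "b = arg_map (arg_flow (Arg b - Arg (f x0)) x0)"
      by (simp add: arg_map_flow[OF x0] cis_mult)
    then show "b \<in> arg_map ` regular_sphere" by (rule image_eqI) (rule arg_flow_sphere[OF x0])
  qed
qed

text \<open>
  The flow carries fibres to fibres, which trivialises the map over the circle without the point
  opposite to \<open>b\<close>: flowing back by a continuous choice \<open>\<tau>\<close> of the argument projects every point to the
  fibre over 1.
\<close>

theorem fibre_bundle: "smooth_fibre_bundle arg_map regular_sphere (sphere 0 1)"
  unfolding smooth_fibre_bundle_def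
proof (intro conjI smooth_map_arg_map arg_map_image exI[of _ "{y \<in> regular_sphere. arg_map y = 1}"] ballI)
  let ?F = "{y \<in> regular_sphere. arg_map y = 1}"
  fix b :: complex assume "b \<in> sphere 0 1"
  then have b: "norm b = 1" by simp
  then have b0: "b \<noteq> 0" by auto
  define N where "N = {z. z / b \<notin> \<real>\<^sub>\<le>\<^sub>0}"
  define U where "U = sphere 0 1 \<inter> N"
  define \<tau> where "\<tau> = (\<lambda>z. Im (Ln (z / b)) + Arg b)"
  have N: "open N"
  proof -
    have "continuous_on UNIV (\<lambda>z. z / b)" using b0 by (intro continuous_intros) auto
    from open_vimage[OF open_Compl[OF closed_nonpos_Reals_complex] this] show ?thesis
      by (simp add: N_def vimage_def Compl_eq)
  qed
  have \<tau>: "cis (\<tau> z) = z" if "z \<in> U" for z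
  proof -
    have z: "norm z = 1" "z / b \<noteq> 0" using that b0 by (auto simp: U_def)
    have "cis (\<tau> z) = sgn (z / b) * sgn b"
      using z(2) b0 by (simp add: \<tau>_def cis_Im_Ln cis_Arg flip: cis_mult)
    then show ?thesis using z(1) b b0 by (simp add: sgn_div_norm norm_divide)
  qed
  have C\<tau>: "Ck_on k W (\<lambda>y. \<tau> (g y))" if "open W" "Ck_on k W g" "g ` W \<subseteq> N" for k g and W :: "'x::euclidean_space set"
  proof -
    have "Ck_on k W (\<lambda>y. g y * inverse b)" by (intro Ck_on_mult Ck_on_const that)
    then have "Ck_on k W (\<lambda>y. Ln (g y / b))"
      using that by (intro Ck_on_Ln) (auto simp: N_def divide_inverse)
    then have "Ck_on k W (\<lambda>y. Im (Ln (g y / b)))"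
      by (rule Ck_on_linear_compose[OF bounded_linear_Im that(1)])
    then show ?thesis unfolding \<tau>_def by (intro Ck_on_add Ck_on_const that)
  qed
  define M where "M = regular_sphere \<inter> arg_map -` U"
  define \<Phi> where "\<Phi> = (\<lambda>x. (arg_map x, arg_flow (- \<tau> (arg_map x)) x))"
  define \<Psi> where "\<Psi> = (\<lambda>(z, y). arg_flow (\<tau> z) y)"
  have \<Psi>M: "\<Psi> p \<in> M" and \<Phi>\<Psi>: "\<Phi> (\<Psi> p) = p" if p: "p \<in> U \<times> ?F" for p
  proof -
    obtain z y where zy: "p = (z, y)" "z \<in> U" "y \<in> regular_sphere" "arg_map y = 1" using p by auto
    have pz: "arg_map (arg_flow (\<tau> z) y) = z" using arg_map_flow[OF zy(3)] zy \<tau> by simp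
    show "\<Psi> p \<in> M" using zy arg_flow_sphere pz by (simp add: \<Psi>_def M_def)
    show "\<Phi> (\<Psi> p) = p" using zy pz by (simp add: \<Phi>_def \<Psi>_def arg_flow_0 flip: arg_flow_add)
  qed
  have \<Phi>UF: "\<Phi> x \<in> U \<times> ?F" and \<Psi>\<Phi>: "\<Psi> (\<Phi> x) = x" if x: "x \<in> M" for x
  proof -
    have xE: "x \<in> regular_sphere" "arg_map x \<in> U" using x by (auto simp: M_def)
    have "arg_map (arg_flow (- \<tau> (arg_map x)) x) = cis (- \<tau> (arg_map x)) * cis (\<tau> (arg_map x))"
      using arg_map_flow[OF xE(1)] \<tau>[OF xE(2)] by simp
    then show "\<Phi> x \<in> U \<times> ?F" using xE arg_flow_sphere by (simp add: \<Phi>_def cis_mult)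
    show "\<Psi> (\<Phi> x) = x" by (simp add: \<Phi>_def \<Psi>_def arg_flow_0 flip: arg_flow_add)
  qed
  have bij: "bij_betw \<Phi> M (U \<times> ?F)"
    by (rule bij_betw_byWitness[where f'=\<Psi>]) (use \<Psi>M \<Phi>\<Psi> \<Phi>UF \<Psi>\<Phi> in blast)+
  have inv: "inv_into M \<Phi> p = \<Psi> p" if "p \<in> U \<times> ?F" for p
    by (rule inv_into_f_eq[OF bij_betw_imp_inj_on[OF bij] \<Psi>M[OF that] \<Phi>\<Psi>[OF that]])
  have "smooth_map M \<Phi>"
    unfolding smooth_map_def
  proof
    fix x assume x: "x \<in> M"
    let ?R = "regular_cone \<inter> {y. f y \<noteq> 0}"
    let ?W = "?R \<inter> (\<lambda>y. sgn (f y)) -` N"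
    have W0: "open ?R" using regular_cone_open open_nonzero by auto
    have W: "open ?W"
    proof (rule continuous_open_preimage[OF _ W0 N])
      show "continuous_on ?R (\<lambda>y. sgn (f y))"
        by (rule Ck_on_imp_continuous_on[OF sgn_f_Ck[OF W0]]) simp
    qed
    have s: "Ck_on k ?W (\<lambda>y. sgn (f y))" for k by (rule sgn_f_Ck[OF W]) auto
    have *: "Ck_on k ?W (\<lambda>y. (- \<tau> (sgn (f y)), y))" for k
      by (intro Ck_on_Pair[OF W] Ck_on_minus[OF W] C\<tau>[OF W s] Ck_on_ident[OF W]) auto
    have "Ck_on k ?W (\<lambda>y. arg_flow (fst (- \<tau> (sgn (f y)), y)) (snd (- \<tau> (sgn (f y)), y)))" for k
      by (rule Ck_on_compose[OF W arg_flow_Ck]) (rule *, auto)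
    then have "Ck_on k ?W (\<lambda>y. arg_flow (- \<tau> (sgn (f y))) y)" for k by (simp only: fst_conv snd_conv)
    then have C: "Ck_on k ?W (\<lambda>y. (sgn (f y), arg_flow (- \<tau> (sgn (f y))) y))" for k
      by (intro Ck_on_Pair[OF W] s)
    show "\<exists>W g. open W \<and> x \<in> W \<and> (\<forall>k. Ck_on k W g) \<and> (\<forall>y\<in>W \<inter> M. g y = \<Phi> y)"
    proof (intro exI conjI allI ballI)
      show "open ?W" by (rule W)
      show "x \<in> ?W" using x regular_sphere_subset_cone by (auto simp: M_def U_def regular_sphere_iff arg_map_sgn)
      show "Ck_on k ?W (\<lambda>y. (sgn (f y), arg_flow (- \<tau> (sgn (f y))) y))" for k by (rule C)
      show "(sgn (f y), arg_flow (- \<tau> (sgn (f y))) y) = \<Phi> y" if "y \<in> ?W \<inter> M" for y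
        using that by (simp add: \<Phi>_def arg_map_sgn)
    qed
  qed
  moreover have "smooth_map (U \<times> ?F) (inv_into M \<Phi>)"
    unfolding smooth_map_def
  proof
    fix p assume p: "p \<in> U \<times> ?F"
    let ?W = "N \<times> regular_cone"
    have W: "open ?W" by (intro open_Times N regular_cone_open)
    have *: "Ck_on k ?W (\<lambda>p. (\<tau> (fst p), snd p))" for k
      by (intro Ck_on_Pair[OF W] C\<tau>[OF W] Ck_on_fst[OF W] Ck_on_snd[OF W] Ck_on_ident[OF W]) auto
    have "Ck_on k ?W (\<lambda>p. arg_flow (fst (\<tau> (fst p), snd p)) (snd (\<tau> (fst p), snd p)))" for k
      by (rule Ck_on_compose[OF W arg_flow_Ck]) (rule *, auto)
    then have C: "Ck_on k ?W (\<lambda>p. arg_flow (\<tau> (fst p)) (snd p))" for k by (simp only: fst_conv snd_conv)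
    show "\<exists>W g. open W \<and> p \<in> W \<and> (\<forall>k. Ck_on k W g) \<and> (\<forall>y\<in>W \<inter> (U \<times> ?F). g y = inv_into M \<Phi> y)"
    proof (intro exI conjI allI ballI)
      show "open ?W" by (rule W)
      show "p \<in> ?W" using p regular_sphere_subset_cone by (auto simp: U_def)
      show "Ck_on k ?W (\<lambda>p. arg_flow (\<tau> (fst p)) (snd p))" for k by (rule C)
      show "arg_flow (\<tau> (fst q)) (snd q) = inv_into M \<Phi> q" if "q \<in> ?W \<inter> (U \<times> ?F)" for q
        using inv[of q] that by (simp add: \<Psi>_def case_prod_beta)
    qed
  qed
  ultimately have diffeo: "diffeomorphism_betw \<Phi> (regular_sphere \<inter> arg_map -` U) (U \<times> ?F)"
    using bij by (simp add: diffeomorphism_betw_def M_def)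
  show "\<exists>U (\<Phi> :: 'a \<Rightarrow> complex \<times> 'a). openin (top_of_set (sphere 0 1)) U \<and> b \<in> U \<and>
      diffeomorphism_betw \<Phi> (regular_sphere \<inter> arg_map -` U) (U \<times> ?F) \<and> (\<forall>x\<in>regular_sphere \<inter> arg_map -` U. fst (\<Phi> x) = arg_map x)"
  proof (intro exI conjI ballI)
    show "openin (top_of_set (sphere 0 1)) U" unfolding U_def by (rule openin_open_Int[OF N])
    show "b \<in> U" using b b0 by (simp add: U_def N_def)
    show "fst (\<Phi> x) = arg_map x" for x by (simp add: \<Phi>_def)
  qed (rule diffeo)
qed

end

text \<open>
  At a point where \<open>f x\<close> is nonzero the transversality hypothesis says that the point is not
  phase-critical; at a zero, where \<open>\<zeta>\<close> is arbitrary, it says that the restriction of \<open>f\<close> to the sphere has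
  surjective derivative.
\<close>

theorem sphere_arg_fibration:
  fixes f :: "'a::euclidean_space \<Rightarrow> complex"
  assumes "\<And>k. Ck_on k UNIV f"
    and "\<And>x \<zeta>. norm x = 1 \<Longrightarrow> norm \<zeta> = 1 \<Longrightarrow> f x = of_real (norm (f x)) * \<zeta> \<Longrightarrow>
      \<exists>w. w \<bullet> x = 0 \<and> Im (cnj \<zeta> * frechet_derivative f (at x) w) \<noteq> 0"
    and "\<exists>x. norm x = 1 \<and> f x \<noteq> 0"
  shows "\<not> (\<exists>x\<in>sphere 0 1 - f -` {0}. phase_critical (sphere 0 1) f x)"
    and "smooth_fibre_bundle (\<lambda>x. arg_circle (f x)) (sphere 0 1 - f -` {0}) (sphere 0 1)"
proof -
  have reg: "regular_sphere f = sphere 0 1 - f -` {0}" by (rule regular_sphere_def[OF assms])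
  have amap: "arg_map f = (\<lambda>x. arg_circle (f x))" by (rule ext) (rule arg_map_def[OF assms])
  show "\<not> (\<exists>x\<in>sphere 0 1 - f -` {0}. phase_critical (sphere 0 1) f x)"
    using no_phase_critical[OF assms] unfolding reg by blast
  show "smooth_fibre_bundle (\<lambda>x. arg_circle (f x)) (sphere 0 1 - f -` {0}) (sphere 0 1)"
    using fibre_bundle[OF assms] unfolding reg amap .
qed

section \<open>Laurent polynomials and their mixed counterparts\<close>

lemma laurent_exp_superset:
  "finite A \<Longrightarrow> Poly_Mapping.keys c \<subseteq> A \<Longrightarrow>
    laurent_exp c h = (\<Sum>k\<in>A. Poly_Mapping.lookup c k * exp (\<i> * of_int k * of_real h))"
  unfolding laurent_exp_def by (rule sum.mono_neutral_left) (auto simp: in_keys_iff)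

lemma laurent_mixed_superset:
  "finite A \<Longrightarrow> Poly_Mapping.keys c \<subseteq> A \<Longrightarrow>
    laurent_mixed c v = (\<Sum>k\<in>A. Poly_Mapping.lookup c k * (if k \<ge> 0 then v ^ nat k else cnj v ^ nat \<bar>k\<bar>))"
  unfolding laurent_mixed_def by (rule sum.mono_neutral_left) (auto simp: in_keys_iff)

lemma laurent_exp_0 [simp]: "laurent_exp 0 h = 0" and laurent_mixed_0 [simp]: "laurent_mixed 0 v = 0"
  by (simp_all add: laurent_exp_def laurent_mixed_def)

lemma laurent_exp_add: "laurent_exp (c + d) h = laurent_exp c h + laurent_exp d h"
  using laurent_exp_superset[of "Poly_Mapping.keys c \<union> Poly_Mapping.keys d"] Poly_Mapping.keys_add[of c d]
  by (simp add: lookup_add distrib_right sum.distrib)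

lemma laurent_exp_single: "laurent_exp (Poly_Mapping.single k z) h = z * exp (\<i> * of_int k * of_real h)"
  using laurent_exp_superset[of "{k}" "Poly_Mapping.single k z" h] by simp

lemma laurent_mixed_single:
  "laurent_mixed (Poly_Mapping.single k z) v = z * (if k \<ge> 0 then v ^ nat k else cnj v ^ nat \<bar>k\<bar>)"
  using laurent_mixed_superset[of "{k}" "Poly_Mapping.single k z" v] by simp

lemma cis_power_nat:
  assumes "k \<ge> 0"
  shows "cis h ^ nat k = exp (\<i> * of_int k * of_real h)"
proof -
  have eq: "real (nat k) = real_of_int k" using assms by simp
  have "cis h ^ nat k = cis (real (nat k) * h)" by (rule Complex.DeMoivre)
  also have "\<dots> = exp (\<i> * of_real (real (nat k) * h))" by (rule cis_conv_exp)
  also have "\<i> * of_real (real (nat k) * h) = \<i> * of_int k * (of_real h :: complex)"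
    by (simp only: eq of_real_mult of_real_of_int_eq mult.assoc)
  finally show ?thesis .
qed

lemma laurent_mixed_cis: "laurent_mixed c (cis h) = laurent_exp c h"
proof -
  have "(if k \<ge> 0 then cis h ^ nat k else cnj (cis h) ^ nat \<bar>k\<bar>) = exp (\<i> * of_int k * of_real h)" for k :: int
    using cis_power_nat[of k h] cis_power_nat[of "- k" "- h"] by (simp add: cis_cnj)
  then show ?thesis by (simp add: laurent_mixed_def laurent_exp_def)
qed

lemma laurent_mixed_Ck: "Ck_on k UNIV (laurent_mixed c)"
proof -
  have cnj: "Ck_on k UNIV cnj" by (rule Ck_on_bounded_linear[OF bounded_linear_cnj open_UNIV])
  have "Ck_on k UNIV (\<lambda>v. if i \<ge> 0 then v ^ nat i else cnj v ^ nat \<bar>i\<bar>)" for i :: int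
    by (cases "i \<ge> 0") (simp_all add: Ck_on_power cnj Ck_on_ident)
  then show ?thesis
    unfolding laurent_mixed_def[abs_def]
    by (intro Ck_on_sum[OF open_UNIV] Ck_on_mult[OF open_UNIV] Ck_on_const[OF open_UNIV])
qed

text \<open>
  Multiplied by a large power of \<open>exp (\<i> h)\<close>, the Laurent polynomial becomes a polynomial that vanishes on
  infinitely many points of the circle.
\<close>

lemma laurent_exp_eq_0:
  assumes "\<And>h. h \<in> {0..2 * pi} \<Longrightarrow> laurent_exp c h = 0"
  shows "c = 0"
proof -
  let ?K = "Poly_Mapping.keys c"
  define N where "N = (\<Sum>k\<in>?K. \<bar>k\<bar>)"
  have N: "k + N \<ge> 0" if "k \<in> ?K" for k
    using member_le_sum[of k ?K abs] that by (auto simp: N_def)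
  define q where "q = (\<Sum>k\<in>?K. monom (Poly_Mapping.lookup c k) (nat (k + N)))"
  have root: "poly q (cis h) = 0" if "h \<in> {0..2 * pi}" for h
  proof -
    have "poly q (cis h) = (\<Sum>k\<in>?K. Poly_Mapping.lookup c k * cis h ^ nat (k + N))"
      by (simp add: q_def poly_sum poly_monom)
    also have "\<dots> = (\<Sum>k\<in>?K. exp (\<i> * of_int N * of_real h) * (Poly_Mapping.lookup c k * exp (\<i> * of_int k * of_real h)))"
    proof (rule sum.cong[OF refl])
      fix k assume "k \<in> ?K"
      then have "cis h ^ nat (k + N) = exp (\<i> * of_int (k + N) * of_real h)"
        by (intro cis_power_nat N)
      also have "\<i> * of_int (k + N) * of_real h = \<i> * of_int N * of_real h + \<i> * of_int k * of_real h"
        by (simp add: algebra_simps)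
      also have "exp \<dots> = exp (\<i> * of_int N * of_real h) * exp (\<i> * of_int k * of_real h)"
        by (rule exp_add)
      finally have "cis h ^ nat (k + N) = exp (\<i> * of_int N * of_real h) * exp (\<i> * of_int k * of_real h)" .
      then show "Poly_Mapping.lookup c k * cis h ^ nat (k + N) = exp (\<i> * of_int N * of_real h) * (Poly_Mapping.lookup c k * exp (\<i> * of_int k * of_real h))"
        by simp
    qed
    also have "\<dots> = exp (\<i> * of_int N * of_real h) * laurent_exp c h"
      by (simp add: laurent_exp_def sum_distrib_left)
    finally show ?thesis using assms[OF that] by simp
  qed
  have "inj_on cis {0..pi}"
    by (auto simp: inj_on_def complex_eq_iff intro: cos_inj_pi)
  then have "infinite (cis ` {0..pi})"
    using finite_imageD infinite_Icc pi_gt_zero by blast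
  moreover have "cis ` {0..pi} \<subseteq> {z. poly q z = 0}" using root by auto
  ultimately have q0: "q = 0" using poly_roots_finite finite_subset by metis
  have "Poly_Mapping.lookup c k = 0" for k
  proof (cases "k \<in> ?K")
    case True
    have "coeff q (nat (k + N)) = (\<Sum>i\<in>?K. if i = k then Poly_Mapping.lookup c i else 0)"
      unfolding q_def coeff_sum
    proof (rule sum.cong[OF refl])
      fix i assume "i \<in> ?K"
      then show "coeff (monom (Poly_Mapping.lookup c i) (nat (i + N))) (nat (k + N)) = (if i = k then Poly_Mapping.lookup c i else 0)"
        using N[of i] N[OF True] by auto
    qed
    then show ?thesis using q0 True by simp
  qed (simp add: in_keys_iff)
  then show ?thesis by (intro poly_mapping_eqI) simp
qed

lemma laurent_exp_inject:
  assumes "\<And>h. h \<in> {0..2 * pi} \<Longrightarrow> laurent_exp c h = laurent_exp d h"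
  shows "c = d"
proof -
  have "laurent_exp (c - d) h = laurent_exp c h - laurent_exp d h" for h
    using laurent_exp_add[of "c - d" d h] by simp
  then have "c - d = 0" by (intro laurent_exp_eq_0) (simp add: assms)
  then show ?thesis by simp
qed

lemma laurent_map_scale:
  fixes g :: "int \<Rightarrow> complex"
  obtains d where "\<And>k. Poly_Mapping.lookup d k = g k * Poly_Mapping.lookup c k"
proof -
  have "finite {k. g k * Poly_Mapping.lookup c k \<noteq> 0}"
    by (rule finite_subset[of _ "{k. Poly_Mapping.lookup c k \<noteq> 0}"]) auto
  then show ?thesis using that[of "Abs_poly_mapping (\<lambda>k. g k * Poly_Mapping.lookup c k)"] by simp
qed

text \<open>
  Uniqueness of coefficients transfers linear relations from the circle to the mixed polynomials in \<open>v\<close>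
  and \<open>cnj v\<close>.
\<close>

lemma laurent_mixed_scale:
  assumes "\<And>h. laurent_exp c h = z * laurent_exp d h"
  shows "laurent_mixed c v = z * laurent_mixed d v"
proof -
  obtain e where e: "\<And>k. Poly_Mapping.lookup e k = z * Poly_Mapping.lookup d k" using laurent_map_scale[of "\<lambda>_. z" d] by blast
  have ke: "Poly_Mapping.keys e \<subseteq> Poly_Mapping.keys d" by (auto simp: in_keys_iff e)
  have "laurent_exp e h = z * laurent_exp d h" for h
    unfolding laurent_exp_superset[OF finite_keys ke] laurent_exp_def[of d]
    by (simp add: e sum_distrib_left mult.assoc)
  then have "c = e" by (intro laurent_exp_inject) (simp add: assms)
  then show ?thesis
    using laurent_mixed_superset[OF _ ke, of v] by (simp add: e laurent_mixed_def sum_distrib_left mult.assoc)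
qed

lemma laurent_mixed_const:
  assumes "\<And>h. laurent_exp c h = z"
  shows "laurent_mixed c v = z"
proof -
  have "c = Poly_Mapping.single 0 z"
    by (rule laurent_exp_inject) (simp add: assms laurent_exp_single)
  then show ?thesis by (simp add: laurent_mixed_single)
qed

text \<open>
  Trigonometric polynomials in \<open>h / s\<close>: the strands, and with them the coefficients of the product over
  all strands, are of this form.
\<close>

inductive trig_poly :: "nat \<Rightarrow> (real \<Rightarrow> complex) \<Rightarrow> bool" for s where
  monomial: "trig_poly s (\<lambda>h. z * exp (\<i> * of_int k * of_real (h / real s)))"
| add: "trig_poly s f \<Longrightarrow> trig_poly s g \<Longrightarrow> trig_poly s (\<lambda>h. f h + g h)"

lemma trig_poly_const: "trig_poly s (\<lambda>h. z)"
  using monomial[of s z 0] by simp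

lemma trig_poly_sum: "(\<And>i. i \<in> I \<Longrightarrow> trig_poly s (f i)) \<Longrightarrow> trig_poly s (\<lambda>h. \<Sum>i\<in>I. f i h)"
  by (induction I rule: infinite_finite_induct) (auto intro: trig_poly_const trig_poly.add)

lemma trig_poly_mult:
  assumes "trig_poly s f" "trig_poly s g"
  shows "trig_poly s (\<lambda>h. f h * g h)"
  using assms(1)
proof induction
  case (monomial z k)
  from assms(2) show ?case
  proof induction
    case (monomial z' k')
    show ?case
      using trig_poly.monomial[of s "z * z'" "k + k'"]
      by (simp add: algebra_simps exp_add)
  qed (simp add: distrib_left trig_poly.add)
qed (simp add: distrib_right trig_poly.add)

lemma trig_poly_laurent: "trig_poly s f \<Longrightarrow> \<exists>c. \<forall>h. f h = laurent_exp c (h / real s)"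
proof (induction rule: trig_poly.induct)
  case (monomial z k)
  show ?case by (rule exI[of _ "Poly_Mapping.single k z"]) (simp add: laurent_exp_single)
qed (metis laurent_exp_add)

text \<open>
  Translation by the period multiplies the coefficient of \<open>exp (\<i> k h / s)\<close> by a power of a root of unity. By
  uniqueness of coefficients this factor is 1 wherever the coefficient is nonzero, that is, only
  multiples of \<open>s\<close> occur as exponents.
\<close>

lemma trig_poly_periodic:
  assumes "s > 0" "trig_poly s f" "\<And>h. f (h + 2 * pi) = f h"
  shows "\<exists>c. \<forall>h. f h = laurent_exp c h"
proof -
  obtain c where c: "\<And>h. f h = laurent_exp c (h / real s)" using trig_poly_laurent[OF assms(2)] by blast
  let ?w = "\<lambda>k :: int. exp (\<i> * of_int k * of_real (2 * pi / real s)) :: complex"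
  obtain d where d: "\<And>k. Poly_Mapping.lookup d k = ?w k * Poly_Mapping.lookup c k" using laurent_map_scale[of ?w c] by blast
  have kd: "Poly_Mapping.keys d \<subseteq> Poly_Mapping.keys c" by (auto simp: in_keys_iff d)
  have "d = c"
  proof (rule laurent_exp_inject)
    fix x
    have "laurent_exp d x = laurent_exp c (x + 2 * pi / real s)"
      unfolding laurent_exp_superset[OF finite_keys kd, of x] unfolding laurent_exp_def
      by (rule sum.cong) (simp_all add: d algebra_simps exp_add)
    also have "\<dots> = f (real s * x + 2 * pi)" using assms(1) by (simp add: c add_divide_distrib)
    also have "\<dots> = laurent_exp c x" unfolding assms(3) using assms(1) by (simp add: c)
    finally show "laurent_exp d x = laurent_exp c x" .
  qed
  have dvd: "int s dvd k" if "k \<in> Poly_Mapping.keys c" for k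
  proof -
    have "?w k * Poly_Mapping.lookup c k = Poly_Mapping.lookup c k" using d[of k] \<open>d = c\<close> by simp
    then have "?w k = 1" using that by (simp add: in_keys_iff)
    then obtain n :: int where "real_of_int k * (2 * pi / real s) = of_int (2 * n) * pi"
      by (auto simp: exp_eq_1)
    then have "real_of_int k = real_of_int (n * int s)" using assms(1) by (simp add: field_simps)
    then have "k = n * int s" by (simp only: of_int_eq_iff)
    then show ?thesis by simp
  qed
  have "f h = (\<Sum>k\<in>Poly_Mapping.keys c. Poly_Mapping.lookup c k * exp (\<i> * of_int (k div int s) * of_real (h / real 1)))" for h
    unfolding c laurent_exp_def
  proof (rule sum.cong[OF refl])
    fix k assume "k \<in> Poly_Mapping.keys c"
    then have "k = k div int s * int s" using dvd by simp
    then have "(of_int k :: complex) = of_int (k div int s) * of_nat s" by (metis of_int_mult of_int_of_nat_eq)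
    then show "Poly_Mapping.lookup c k * exp (\<i> * of_int k * of_real (h / real s))
        = Poly_Mapping.lookup c k * exp (\<i> * of_int (k div int s) * of_real (h / real 1))" using assms(1) by (simp add: mult.assoc)
  qed
  then have "f = (\<lambda>h. \<Sum>k\<in>Poly_Mapping.keys c. Poly_Mapping.lookup c k * exp (\<i> * of_int (k div int s) * of_real (h / real 1)))"
    by (rule ext)
  moreover have "trig_poly 1 \<dots>" by (rule trig_poly_sum) (rule trig_poly.monomial)
  ultimately have "trig_poly 1 f" by simp
  then show ?thesis using trig_poly_laurent[of 1 f] by simp
qed

section \<open>The polynomial of the lemniscate braid\<close>

context
  fixes l s r :: nat and a b :: real
  assumes pos: "l > 0" "s > 0"
begin

abbreviation "Z \<equiv> lem_Z s r l a b"

definition "strand_poly lam h = (\<Prod>j = 1..s. [:- Z lam j h, 1:])"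

lemma lem_p_strand_poly: "lem_p s r l a b lam (u, h) = poly (strand_poly lam h) u"
  by (simp add: lem_p_def strand_poly_def poly_prod)

lemma trig_poly_Z: "trig_poly s (\<lambda>h. Z lam j h)"
proof -
  let ?c = "2 * pi * (real j - 1) / real s"
  have cos: "trig_poly s (\<lambda>h. of_real (cos (real m * ((real r * h + 2 * pi * (real j - 1)) / real s))))"
    and sin: "trig_poly s (\<lambda>h. of_real (sin (real m * ((real r * h + 2 * pi * (real j - 1)) / real s))))" for m
  proof -
    have t: "trig_poly s (\<lambda>h. exp (\<i> * of_int k * of_real ((real r * h + 2 * pi * (real j - 1)) / real s)))" for k
    proof -
      have "(\<lambda>h. exp (\<i> * of_int k * of_real ((real r * h + 2 * pi * (real j - 1)) / real s))) =
          (\<lambda>h. exp (\<i> * of_int k * of_real ?c) * exp (\<i> * of_int (k * int r) * of_real (h / real s)))"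
      proof
        fix h
        have "\<i> * of_int k * of_real ((real r * h + 2 * pi * (real j - 1)) / real s) =
            \<i> * of_int k * of_real ?c + \<i> * of_int (k * int r) * (of_real (h / real s) :: complex)"
          by (simp add: add_divide_distrib ring_distribs diff_divide_distrib)
        then show "exp (\<i> * of_int k * of_real ((real r * h + 2 * pi * (real j - 1)) / real s)) =
            exp (\<i> * of_int k * of_real ?c) * exp (\<i> * of_int (k * int r) * of_real (h / real s))"
          by (simp only: exp_add)
      qed
      then show ?thesis by (simp only: trig_poly.monomial)
    qed
    have "trig_poly s (\<lambda>h. 1 / 2 * (exp (\<i> * of_int (int m) * of_real ((real r * h + 2 * pi * (real j - 1)) / real s))
        + exp (\<i> * of_int (- int m) * of_real ((real r * h + 2 * pi * (real j - 1)) / real s))))"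
      by (intro trig_poly_mult trig_poly_const trig_poly.add t)
    then show "trig_poly s (\<lambda>h. of_real (cos (real m * ((real r * h + 2 * pi * (real j - 1)) / real s))))"
      by (simp add: cos_of_real[symmetric] cos_exp_eq mult.assoc)
    have "trig_poly s (\<lambda>h. 1 / (2 * \<i>) * (exp (\<i> * of_int (int m) * of_real ((real r * h + 2 * pi * (real j - 1)) / real s))
        + (- 1) * exp (\<i> * of_int (- int m) * of_real ((real r * h + 2 * pi * (real j - 1)) / real s))))"
      by (intro trig_poly_mult trig_poly_const trig_poly.add t)
    then show "trig_poly s (\<lambda>h. of_real (sin (real m * ((real r * h + 2 * pi * (real j - 1)) / real s))))"
      by (simp add: sin_of_real[symmetric] sin_exp_eq mult.assoc)
  qed
  have "trig_poly s (\<lambda>h. of_real lam * (of_real a * of_real (cos (real 1 * ((real r * h + 2 * pi * (real j - 1)) / real s)))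
      + \<i> * of_real (b / real l) * of_real (sin (real l * ((real r * h + 2 * pi * (real j - 1)) / real s)))))"
    by (intro trig_poly_mult trig_poly_const trig_poly.add cos sin)
  then show ?thesis by (simp add: lem_Z_def mult.assoc)
qed

lemma coeff_linear_mult: "coeff ([:z, 1:] * p) n = z * coeff p n + (if n = 0 then 0 else coeff p (n - 1))"
  for z :: complex
  by (cases n) (simp_all add: coeff_pCons)

lemma trig_poly_coeff_prod:
  "trig_poly s (\<lambda>h. coeff (\<Prod>j\<in>J. [:- Z lam j h, 1:]) n)"
proof (induction J arbitrary: n rule: infinite_finite_induct)
  case (insert j J)
  have m: "trig_poly s (\<lambda>h. - Z lam j h)"
    using trig_poly_mult[OF trig_poly_const[of s "-1"] trig_poly_Z] by simp
  have "trig_poly s (\<lambda>h. if n = 0 then 0 else coeff (\<Prod>j\<in>J. [:- Z lam j h, 1:]) (n - 1))"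
    by (cases "n = 0") (simp_all add: trig_poly_const insert.IH)
  then have "trig_poly s (\<lambda>h. - Z lam j h * coeff (\<Prod>j\<in>J. [:- Z lam j h, 1:]) n +
      (if n = 0 then 0 else coeff (\<Prod>j\<in>J. [:- Z lam j h, 1:]) (n - 1)))"
    by (intro trig_poly.add trig_poly_mult m insert.IH)
  then show ?case unfolding prod.insert[OF insert.hyps(1,2)] coeff_linear_mult .
qed (simp_all add: trig_poly_const)

lemma Z_shift: "Z lam j (h + 2 * pi) = Z lam (j + r) h" and Z_period: "Z lam (j + s) h = Z lam j h"
proof -
  have "real r * (h + 2 * pi) + 2 * pi * (real j - 1) = real r * h + 2 * pi * (real (j + r) - 1)"
    by (simp add: algebra_simps)
  then show "Z lam j (h + 2 * pi) = Z lam (j + r) h" by (simp only: lem_Z_def)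
  let ?x = "(real r * h + 2 * pi * (real j - 1)) / real s"
  have 1: "(real r * h + 2 * pi * (real (j + s) - 1)) / real s = ?x + 2 * pi"
    using pos by (simp add: field_simps)
  have 2: "real l * (real r * h + 2 * pi * (real (j + s) - 1)) / real s = real l * ?x + 2 * pi * real l"
    using pos by (simp add: field_simps)
  have "sin (real l * ?x + 2 * pi * real l) = sin (real l * ?x)"
  proof -
    have "2 * pi * real l = 2 * real l * pi" by simp
    then show ?thesis by (simp only: sin_add sin_2npi cos_2npi)
  qed
  then show "Z lam (j + s) h = Z lam j h"
    unfolding lem_Z_def 1 2 by simp
qed

lemma prod_cyclic_shift:
  fixes F :: "nat \<Rightarrow> 'b::comm_monoid_mult"
  assumes per: "\<And>j. F (j + s) = F j"
  shows "(\<Prod>j = 1..s. F (j + m)) = (\<Prod>j = 1..s. F j)"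
proof (induction m)
  case (Suc m)
  have "(\<Prod>j = 1..s. F (j + Suc m)) = (\<Prod>j = Suc 1..Suc s. F (j + m))"
    by (subst prod.shift_bounds_cl_Suc_ivl) simp
  also have "\<dots> = (\<Prod>j = Suc 1..s. F (j + m)) * F (Suc s + m)"
    using pos by (subst prod.nat_ivl_Suc') (auto simp: mult.commute)
  also have "F (Suc s + m) = F (1 + m)" using per[of "1 + m"] by (simp add: add.commute add.left_commute)
  also have "(\<Prod>j = Suc 1..s. F (j + m)) * F (1 + m) = (\<Prod>j = 1..s. F (j + m))"
    using pos by (subst (2) prod.atLeast_Suc_atMost) (auto simp: mult.commute)
  finally show ?case using Suc by simp
qed simp

lemma strand_poly_periodic: "strand_poly lam (h + 2 * pi) = strand_poly lam h"
  using prod_cyclic_shift[of "\<lambda>j. [:- Z lam j h, 1:]" r] by (simp add: strand_poly_def Z_shift Z_period)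

lemma degree_strand_poly: "degree (strand_poly lam h) = s"
  by (simp add: strand_poly_def degree_prod_eq_sum_degree)

lemma lead_coeff_strand_poly: "coeff (strand_poly lam h) s = 1"
proof -
  have "lead_coeff (strand_poly lam h) = 1" unfolding strand_poly_def lead_coeff_prod by simp
  then show ?thesis by (simp add: degree_strand_poly)
qed

text \<open>
  The coefficients of the product over the strands are \<open>2 * pi\<close>-periodic, because the period permutes the
  strands cyclically, and so they are Laurent polynomials in \<open>exp (\<i> h)\<close>. Since these are determined by
  their values, the definite description in \<^const>\<open>lem_poly\<close> denotes the polynomial so obtained.
\<close>

lemma lem_poly_spec:
  "laurent_exp (coeff (lem_poly s r l a b lam) n) h = coeff (strand_poly lam h) n"
proof -
  have "\<exists>c. \<forall>h. coeff (strand_poly lam h) n = laurent_exp c h" for n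
    using trig_poly_periodic[OF pos(2), of "\<lambda>h. coeff (strand_poly lam h) n"] trig_poly_coeff_prod[of lam "{1..s}" n] strand_poly_periodic
    by (simp add: strand_poly_def)
  then obtain C where C: "\<And>n h. coeff (strand_poly lam h) n = laurent_exp (C n) h" by metis
  define P where "P = (\<Sum>n\<le>s. monom (C n) n)"
  have P: "laurent_exp (coeff P n) h = coeff (strand_poly lam h) n" for n h
  proof (cases "n \<le> s")
    case True
    then have "coeff P n = C n" by (simp add: P_def coeff_sum)
    then show ?thesis by (simp add: C)
  next
    case False
    then have "coeff P n = 0" by (auto simp: P_def coeff_sum intro!: sum.neutral)
    then show ?thesis using False by (simp add: coeff_eq_0 degree_strand_poly)
  qed
  have spec: "(\<forall>u. \<forall>h\<in>{0..2 * pi}. lem_p s r l a b lam (u, h) = poly (map_poly (\<lambda>c. laurent_exp c h) P') u)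
      \<longleftrightarrow> P' = P" for P'
  proof
    assume *: "\<forall>u. \<forall>h\<in>{0..2 * pi}. lem_p s r l a b lam (u, h) = poly (map_poly (\<lambda>c. laurent_exp c h) P') u"
    have "map_poly (\<lambda>c. laurent_exp c h) P' = strand_poly lam h" if "h \<in> {0..2 * pi}" for h
    proof -
      have "poly (map_poly (\<lambda>c. laurent_exp c h) P') = poly (strand_poly lam h)"
        using * that by (auto simp: lem_p_strand_poly)
      then show ?thesis by (simp add: poly_eq_poly_eq_iff)
    qed
    then have "laurent_exp (coeff P' n) h = laurent_exp (coeff P n) h" if "h \<in> {0..2 * pi}" for n h
      using that P[of n h] coeff_map_poly[of "\<lambda>c. laurent_exp c h" P' n] by simp
    then show "P' = P" by (intro poly_eqI laurent_exp_inject) auto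
  next
    assume "P' = P"
    moreover have "map_poly (\<lambda>c. laurent_exp c h) P = strand_poly lam h" for h
      by (rule poly_eqI) (simp add: coeff_map_poly P)
    ultimately show "\<forall>u. \<forall>h\<in>{0..2 * pi}. lem_p s r l a b lam (u, h) = poly (map_poly (\<lambda>c. laurent_exp c h) P') u"
      by (simp add: lem_p_strand_poly)
  qed
  have "lem_poly s r l a b lam = P"
    unfolding lem_poly_def spec by simp
  then show ?thesis by (simp add: P)
qed

definition "mixed_coeff lam n v = laurent_mixed (coeff (lem_poly s r l a b lam) n) v"

lemma mixed_coeff_cis: "mixed_coeff lam n (cis h) = coeff (strand_poly lam h) n"
  by (simp add: mixed_coeff_def laurent_mixed_cis lem_poly_spec)

lemma mixed_coeff_Ck: "Ck_on k UNIV (mixed_coeff lam n)"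
  unfolding mixed_coeff_def[abs_def] by (rule laurent_mixed_Ck)

lemma mixed_coeff_lead: "mixed_coeff lam s v = 1"
  unfolding mixed_coeff_def by (rule laurent_mixed_const) (simp add: lem_poly_spec lead_coeff_strand_poly)

lemma mixed_coeff_zero: "n > s \<Longrightarrow> mixed_coeff lam n v = 0"
  unfolding mixed_coeff_def by (rule laurent_mixed_const) (simp add: lem_poly_spec coeff_eq_0 degree_strand_poly)

lemma lem_f_sum: "lem_f s r l a b lam (u, v) = u ^ s + (\<Sum>n<s. mixed_coeff lam n v * u ^ n)"
proof -
  let ?p = "map_poly (\<lambda>c. laurent_mixed c v) (lem_poly s r l a b lam)"
  have c: "coeff ?p n = mixed_coeff lam n v" for n by (simp add: coeff_map_poly mixed_coeff_def)
  have deg: "degree ?p \<le> s" by (rule degree_le) (simp add: c mixed_coeff_zero)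
  have "lem_f s r l a b lam (u, v) = (\<Sum>n\<le>degree ?p. coeff ?p n * u ^ n)"
    by (simp add: lem_f_def poly_altdef)
  also have "\<dots> = (\<Sum>n\<le>s. coeff ?p n * u ^ n)"
    by (rule sum.mono_neutral_left) (use deg in \<open>auto simp: coeff_eq_0\<close>)
  also have "\<dots> = u ^ s + (\<Sum>n<s. mixed_coeff lam n v * u ^ n)"
    by (simp add: c mixed_coeff_lead lessThan_Suc_atMost[symmetric])
  finally show ?thesis .
qed

lemma lem_f_cis: "lem_f s r l a b lam (u, cis h) = lem_p s r l a b lam (u, h)"
proof -
  have "poly (strand_poly lam h) u = (\<Sum>n\<le>s. coeff (strand_poly lam h) n * u ^ n)"
    by (simp add: poly_altdef degree_strand_poly)
  also have "\<dots> = u ^ s + (\<Sum>n<s. mixed_coeff lam n (cis h) * u ^ n)"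
    by (simp add: mixed_coeff_cis lead_coeff_strand_poly lessThan_Suc_atMost[symmetric])
  finally show ?thesis by (simp add: lem_p_strand_poly lem_f_sum)
qed

lemma Z_scale: "Z lam j h = of_real lam * Z 1 j h"
  by (simp add: lem_Z_def)

text \<open>
  The coefficient of \<open>u ^ n\<close> is homogeneous of degree \<open>s - n\<close> in the roots; the form without subtraction
  suits the induction.
\<close>

lemma coeff_strand_poly_scale: "coeff (strand_poly lam h) n * of_real lam ^ n = of_real lam ^ s * coeff (strand_poly 1 h) n"
proof -
  have "coeff (\<Prod>j\<in>J. [:- Z lam j h, 1:]) n * of_real lam ^ n =
      of_real lam ^ card J * coeff (\<Prod>j\<in>J. [:- Z 1 j h, 1:]) n" if "finite J" for J
    using that
  proof (induction J arbitrary: n)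
    case empty
    show ?case by (cases n) simp_all
  next
    case (insert j J)
    show ?case
    proof (cases n)
      case 0
      then show ?thesis using insert.IH[of 0] insert.hyps
        by (simp add: coeff_linear_mult Z_scale[of lam])
    next
      case (Suc m)
      then show ?thesis using insert.IH[of n] insert.IH[of m] insert.hyps
        by (simp add: coeff_linear_mult Z_scale[of lam] algebra_simps)
    qed
  qed
  from this[of "{1..s}"] show ?thesis by (simp add: strand_poly_def)
qed

lemma lem_f_scale:
  assumes "lam > 0"
  shows "lem_f s r l a b lam (of_real lam * w, v) = of_real lam ^ s * lem_f s r l a b 1 (w, v)"
proof -
  have "mixed_coeff lam n v * of_real lam ^ n = of_real lam ^ s * mixed_coeff 1 n v" for n
  proof -
    have "mixed_coeff lam n v = (of_real lam ^ s / of_real lam ^ n) * mixed_coeff 1 n v"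
      unfolding mixed_coeff_def
      by (rule laurent_mixed_scale)
        (use assms coeff_strand_poly_scale[of lam _ n] in \<open>simp add: lem_poly_spec field_simps\<close>)
    then show ?thesis using assms by simp
  qed
  then have "(\<Sum>n<s. mixed_coeff lam n v * (of_real lam * w) ^ n) = (\<Sum>n<s. of_real lam ^ s * (mixed_coeff 1 n v * w ^ n))"
    by (intro sum.cong refl) (simp add: power_mult_distrib flip: mult.assoc)
  then show ?thesis by (simp add: lem_f_sum power_mult_distrib sum_distrib_left distrib_left)
qed

end

text \<open>
  If the curve \<open>(a cos t, (b / l) sin (l t))\<close> takes the same value at two parameters, these agree up to
  the period or are opposite, \<open>t\<close> and \<open>- t\<close> with \<open>sin (l t) = 0\<close>. The parameters of two strands at the same
  \<open>h\<close> differ by a multiple of \<open>2 pi / s\<close>, so in the second case \<open>t\<close> is a multiple of \<open>pi / l\<close> and of \<open>pi / s\<close> up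
  to multiples of \<open>pi\<close>, which coprimality of \<open>l\<close> and \<open>s\<close> excludes for different strands.
\<close>

lemma strands_distinct:
  assumes pos: "l > 0" "s > 0" and co: "coprime s l" and ab: "a > 0" "b > 0"
    and ij: "i \<in> {1..s}" "j \<in> {1..s}" and eq: "lem_Z s r l a b 1 i h = lem_Z s r l a b 1 j h"
  shows "i = j"
proof (rule ccontr)
  assume ne: "i \<noteq> j"
  let ?t = "\<lambda>j :: nat. (real r * h + 2 * pi * (real j - 1)) / real s"
  have c: "cos (?t i) = cos (?t j)" and sn: "sin (real l * ?t i) = sin (real l * ?t j)"
    using eq ab pos by (auto simp: lem_Z_def complex_eq_iff)
  have diff: "?t i - ?t j = 2 * pi * (real i - real j) / real s"
    using pos by (simp add: field_simps)
  have nz: "\<not> int s dvd (int i - int j)"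
  proof
    assume "int s dvd int i - int j"
    then show False using ij ne zdvd_imp_le[of "int s" "int i - int j"] zdvd_imp_le[of "int s" "int j - int i"]
      by (cases "i < j") (auto simp: dvd_diff_commute)
  qed
  from c consider n :: int where "?t i = ?t j + 2 * of_int n * pi" | n :: int where "?t i = - ?t j + 2 * of_int n * pi"
    unfolding cos_eq by (auto elim!: Ints_cases)
  then show False
  proof cases
    case 1
    then have "2 * pi * (real i - real j) = 2 * pi * (of_int n * real s)"
      using diff pos by (simp add: field_simps)
    then have "real i - real j = of_int n * real s" by simp
    then have "real_of_int (int i - int j) = real_of_int (n * int s)" by simp
    then have "int i - int j = n * int s" by (simp only: of_int_eq_iff)
    then show False using nz by simp
  next
    case 2
    have "sin (real l * ?t i) = - sin (real l * ?t j)"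
    proof -
      have "real l * x = - (real l * y) + 2 * pi * of_int (int l * n)"
        if "x = - y + 2 * of_int n * pi" for x y
        unfolding that by (simp add: algebra_simps)
      from this[OF 2]
      have eq: "real l * ?t i = - (real l * ?t j) + 2 * pi * of_int (int l * n)" .
      show ?thesis unfolding eq sin_add cos_int_2pin sin_int_2pin by simp
    qed
    then have "sin (real l * ?t j) = 0" using sn by simp
    then obtain m :: int where m: "real l * ?t j = of_int m * pi"
      unfolding sin_zero_iff_int2 by blast
    have "2 * ?t j = 2 * of_int n * pi - 2 * pi * (real i - real j) / real s"
      using 2 diff by linarith
    moreover have "x * real s = (of_int n * real s - (real i - real j)) * pi"
      if "2 * x = 2 * of_int n * pi - 2 * pi * (real i - real j) / real s" for x
    proof -
      have "x = of_int n * pi - pi * (real i - real j) / real s" using that by simp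
      then show ?thesis using pos by (simp add: field_simps)
    qed
    ultimately have "?t j * real s = (of_int n * real s - (real i - real j)) * pi" by blast
    then have "(of_int m * pi) * real s = real l * ((of_int n * real s - (real i - real j)) * pi)"
      by (metis m mult.assoc)
    then have "of_int m * real s * pi = real l * (of_int n * real s - (real i - real j)) * pi"
      by (simp only: mult_ac)
    then have "of_int m * real s = real l * (of_int n * real s - (real i - real j))" by simp
    then have "real_of_int (int l * (int i - int j)) = real_of_int (int s * (int l * n - m))"
      by (simp add: algebra_simps)
    then have "int l * (int i - int j) = int s * (int l * n - m)" by (simp only: of_int_eq_iff)
    then have "int s dvd int l * (int i - int j)" by simp
    moreover have "coprime (int s) (int l)" using co by simp
    ultimately have "int s dvd int i - int j" by (simp add: coprime_dvd_mult_right_iff)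
    then show False using nz by simp
  qed
qed

lemma simple_roots:
  assumes pos: "l > 0" "s > 0" and co: "coprime s l" and ab: "a > 0" "b > 0"
    and root: "lem_p s r l a b 1 (w, h) = 0"
    and d: "((\<lambda>u. lem_p s r l a b 1 (u, h)) has_field_derivative D) (at w)"
  shows "D \<noteq> 0"
proof -
  let ?z = "\<lambda>j. lem_Z s r l a b 1 j h"
  obtain i where i: "i \<in> {1..s}" "w = ?z i" using root by (auto simp: lem_p_def)
  let ?g = "\<lambda>u. \<Prod>j\<in>{1..s} - {i}. (u - ?z j)"
  have split: "lem_p s r l a b 1 (u, h) = (u - ?z i) * ?g u" for u
    using i by (simp add: lem_p_def prod.remove)
  have "?g = poly (\<Prod>j\<in>{1..s} - {i}. [:- ?z j, 1:])"
    by (simp add: poly_prod fun_eq_iff)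
  then obtain g' where g': "(?g has_field_derivative g') (at w)" using poly_DERIV by metis
  have "((\<lambda>u. (u - ?z i) * ?g u) has_field_derivative (1 - 0) * ?g w + g' * (w - ?z i)) (at w)"
    by (intro DERIV_mult DERIV_diff DERIV_ident DERIV_const g')
  then have "D = ?g w" using DERIV_unique[OF d] i by (simp add: split)
  moreover have "w - ?z j \<noteq> 0" if "j \<in> {1..s} - {i}" for j
    using strands_distinct[OF pos co ab i(1), of j r h] that i(2) by auto
  then have "?g w \<noteq> 0" by simp
  ultimately show ?thesis by simp
qed

section \<open>Small rescalings\<close>

text \<open>
  Near \<open>x\<close> the function \<open>Im (Ln (g y / g x))\<close> is a lift of the argument, shifted by a constant.
\<close>

lemma phase_criticalI:
  fixes g :: "'a::euclidean_space \<Rightarrow> complex"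
  assumes cont: "continuous_on UNIV g" and dg: "(g has_derivative g') (at x)" and nz: "g x \<noteq> 0"
    and zero: "\<And>v. Im (cnj (g x) * g' v) = 0"
  shows "phase_critical UNIV g x"
proof -
  define U where "U = {y. g y / g x \<notin> \<real>\<^sub>\<le>\<^sub>0}"
  define \<theta> where "\<theta> = (\<lambda>y. Im (Ln (g y / g x)) + Arg (g x))"
  have cq: "continuous_on UNIV (\<lambda>y. g y / g x)" using nz by (intro continuous_intros cont) auto
  have "open ((\<lambda>y. g y / g x) -` (- \<real>\<^sub>\<le>\<^sub>0))"
    by (intro open_vimage open_Compl closed_nonpos_Reals_complex cq)
  then have U: "open U" by (simp add: U_def vimage_def Compl_eq)
  have xU: "x \<in> U" using nz by (simp add: U_def)
  have c\<theta>: "continuous_on U \<theta>"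
    unfolding \<theta>_def
    by (intro continuous_intros continuous_on_subset[OF cq]) (auto simp: U_def)
  have lift: "g y \<noteq> 0 \<and> cis (\<theta> y) = arg_circle (g y)" if "y \<in> U" for y
  proof -
    have y: "g y \<noteq> 0" using that nz by (auto simp: U_def)
    then have "cis (\<theta> y) = sgn (g y / g x) * sgn (g x)"
      using nz by (simp add: \<theta>_def cis_Im_Ln cis_Arg flip: cis_mult)
    also have "\<dots> = sgn (g y / g x * g x)" by (rule sgn_mult[symmetric])
    also have "\<dots> = sgn (g y)" using nz by simp
    finally show ?thesis using y by (simp add: arg_circle_def cis_Arg)
  qed
  have "((\<lambda>y. g y * inverse (g x)) has_derivative (\<lambda>v. g' v * inverse (g x))) (at x)"
    by (rule has_derivative_mult_left[OF dg])
  then have dq: "((\<lambda>y. g y / g x) has_derivative (\<lambda>v. g' v / g x)) (at x)"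
    by (simp only: divide_inverse)
  have "(Ln has_derivative (\<lambda>z. z)) (at (g x / g x))"
  proof -
    have "(*) (1 :: complex) = (\<lambda>z. z)" by (simp add: fun_eq_iff)
    then show ?thesis using has_field_derivative_Ln[of 1] nz by (simp add: has_field_derivative_def)
  qed
  from diff_chain_at[OF dq this]
  have "((\<lambda>y. Ln (g y / g x)) has_derivative (\<lambda>v. g' v / g x)) (at x)" by (simp add: o_def)
  from bounded_linear.has_derivative[OF bounded_linear_Im this]
  have "((\<lambda>y. Im (Ln (g y / g x)) + Arg (g x)) has_derivative (\<lambda>v. Im (g' v / g x))) (at x)"
    by (rule has_derivative_add_const)
  moreover have "Im (g' v / g x) = 0" for v
    using zero[of v] by (simp add: Im_divide mult.commute)
  ultimately have d\<theta>: "(\<theta> has_derivative (\<lambda>v. 0)) (at x)"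
    by (simp add: \<theta>_def)
  have "(0 :: 'a) \<in> tangent_space UNIV x"
    unfolding tangent_space_def by (auto intro!: exI[of _ "\<lambda>_. x"])
  with d\<theta> have "has_gradient_on UNIV \<theta> x 0" by (simp add: has_gradient_on_def)
  then show ?thesis
    unfolding phase_critical_def has_arg_gradient_on_def
    using nz U xU c\<theta> lift by (intro conjI exI[of _ U] exI[of _ \<theta>]) (auto simp: openin_open)
qed

text \<open>
  The hypotheses say that \<open>A\<close> and \<open>B\<close> are real multiples of \<open>\<zeta>\<close>.
\<close>

lemma Im_mult_real_multiples:
  assumes "norm \<zeta> = 1" "Im (cnj \<zeta> * A) = 0" "Im (cnj \<zeta> * B) = 0"
  shows "Im (cnj A * B) = 0"
proof -
  have z: "\<zeta> * cnj \<zeta> = 1" using assms(1) by (simp flip: complex_norm_square)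
  have eq: "C = \<zeta> * of_real (Re (cnj \<zeta> * C))" if "Im (cnj \<zeta> * C) = 0" for C
  proof -
    have "C = \<zeta> * (cnj \<zeta> * C)" using z by (simp flip: mult.assoc)
    also have "cnj \<zeta> * C = of_real (Re (cnj \<zeta> * C))" using that by (simp add: complex_eq_iff)
    finally show ?thesis .
  qed
  have "cnj A * B = (\<zeta> * cnj \<zeta>) * of_real (Re (cnj \<zeta> * A) * Re (cnj \<zeta> * B))"
    by (subst eq[OF assms(2)], subst eq[OF assms(3)]) (simp add: mult_ac)
  then show ?thesis by (simp add: z)
qed

context
  fixes F :: "complex \<times> complex \<Rightarrow> complex" and m :: "nat \<Rightarrow> complex \<Rightarrow> complex" and s :: nat
  assumes s: "s > 0"
    and F: "\<And>w v. F (w, v) = w ^ s + (\<Sum>n<s. m n v * w ^ n)"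
    and m: "\<And>n k. Ck_on k UNIV (m n)"
begin

definition "dF_first = (\<lambda>(w, v). of_nat s * w ^ (s - 1) + (\<Sum>n<s. m n v * (of_nat n * w ^ (n - 1))))"
definition "DF x = frechet_derivative F (at x)"

lemma F_Ck: "Ck_on k UNIV F"
proof -
  have "Ck_on k UNIV (\<lambda>x :: complex \<times> complex. fst x ^ s + (\<Sum>n<s. m n (snd x) * fst x ^ n))"
    by (intro Ck_on_add Ck_on_sum Ck_on_mult Ck_on_power Ck_on_fst Ck_on_ident open_UNIV
        Ck_on_compose[OF open_UNIV m Ck_on_snd[OF open_UNIV Ck_on_ident[OF open_UNIV]]]) auto
  moreover have "(\<lambda>x :: complex \<times> complex. fst x ^ s + (\<Sum>n<s. m n (snd x) * fst x ^ n)) = F"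
    by (simp add: fun_eq_iff F)
  ultimately show ?thesis by simp
qed

lemma F_deriv: "(F has_derivative DF x) (at x)"
  unfolding DF_def using F_Ck[of "Suc 0"] by (rule Ck_on_Suc_has_derivative) simp

lemma linear_DF: "linear (DF x)"
  using F_deriv has_derivative_linear by blast

lemma F_field_deriv: "((\<lambda>w. F (w, v)) has_field_derivative dF_first (w, v)) (at w)"
  unfolding F dF_first_def
  by (auto intro!: derivative_eq_intros simp: mult_ac)

lemma DF_first: "DF (w, v) (\<xi>, 0) = dF_first (w, v) * \<xi>"
proof -
  have "((\<lambda>w. (w, v)) has_derivative (\<lambda>\<xi>. (\<xi>, 0))) (at w)" by (auto intro!: derivative_eq_intros)
  from diff_chain_at[OF this F_deriv]
  have "((\<lambda>w. F (w, v)) has_derivative (\<lambda>\<xi>. DF (w, v) (\<xi>, 0))) (at w)" by (simp add: o_def)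
  moreover have "((\<lambda>w. F (w, v)) has_derivative (*) (dF_first (w, v))) (at w)"
    using F_field_deriv by (simp add: has_field_derivative_def)
  ultimately have "(\<lambda>\<xi>. DF (w, v) (\<xi>, 0)) = (*) (dF_first (w, v))" by (rule has_derivative_unique)
  then show ?thesis by metis
qed

lemma DF_split: "DF (w, v) (\<xi>, \<eta>) = dF_first (w, v) * \<xi> + DF (w, v) (0, \<eta>)"
  using linear_add[OF linear_DF, of "(w, v)" "(\<xi>, 0)" "(0, \<eta>)"] by (simp add: DF_first)

lemma DF_second: "DF x (0, \<eta>) = Re \<eta> *\<^sub>R DF x (0, 1) + Im \<eta> *\<^sub>R DF x (0, \<i>)"
proof -
  have "(0, \<eta>) = Re \<eta> *\<^sub>R (0 :: complex, 1) + Im \<eta> *\<^sub>R (0, \<i>)"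
    by (simp add: complex_eq_iff)
  then show ?thesis by (simp only: linear_add[OF linear_DF] linear_cmul[OF linear_DF])
qed

lemma continuous_on_DF_second:
  assumes "continuous_on S x" "continuous_on S \<eta>"
  shows "continuous_on S (\<lambda>q. DF (x q) (0, \<eta> q))"
proof -
  have c: "continuous_on UNIV (\<lambda>x. DF x e)" for e
    using F_Ck[of "Suc 0"] by (simp add: DF_def del: split_paired_All)
  have c': "continuous_on S (\<lambda>q. DF (x q) e)" for e
    by (rule continuous_on_compose2[OF c assms(1)]) auto
  show ?thesis
    by (subst DF_second) (intro continuous_intros c' assms)
qed

lemma continuous_on_F: "continuous_on S x \<Longrightarrow> continuous_on S (\<lambda>q. F (x q))"
  by (rule continuous_on_compose2[OF Ck_on_imp_continuous_on[OF F_Ck]]) auto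

lemma continuous_on_dF_first: "continuous_on S w \<Longrightarrow> continuous_on S v \<Longrightarrow> continuous_on S (\<lambda>q. dF_first (w q, v q))"
  unfolding dF_first_def prod.case
  by (intro continuous_intros continuous_on_compose2[OF Ck_on_imp_continuous_on[OF m], of S v]) auto

text \<open>
  For large \<open>w\<close> the leading term dominates, uniformly in the disc \<open>|v| \<le> 1\<close>: \<open>F\<close> is close to \<open>w ^ s\<close> and
  \<open>w * dF_first\<close> to \<open>s * w ^ s\<close>. The inequality says that \<open>arg F\<close> increases when \<open>w\<close> is rotated.
\<close>

lemma far_region:
  "\<exists>R>0. \<forall>w v. R \<le> norm w \<longrightarrow> norm v \<le> 1 \<longrightarrow> Re (cnj (F (w, v)) * (w * dF_first (w, v))) > 0"
proof -
  have "\<exists>M. \<forall>v\<in>cball 0 1. norm (m n v) \<le> M" for n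
    using bounded_iff[THEN iffD1, OF compact_imp_bounded[OF compact_continuous_image[OF
          continuous_on_subset[OF Ck_on_imp_continuous_on[OF m[of 0 n]]] compact_cball, of 0 1]]] by auto
  then obtain M' where M': "\<And>n v. v \<in> cball 0 1 \<Longrightarrow> norm (m n v) \<le> M' n" by metis
  define M where "M = (\<Sum>n<s. \<bar>M' n\<bar>)"
  have M: "norm (m n v) \<le> M" if "n < s" "norm v \<le> 1" for n v
  proof -
    have "norm (m n v) \<le> \<bar>M' n\<bar>" using M'[of v n] that by auto
    also have "\<dots> \<le> M" unfolding M_def using that by (intro member_le_sum) auto
    finally show ?thesis .
  qed
  have M0: "M \<ge> 0" by (simp add: M_def sum_nonneg)
  \<comment> \<open>this makes both error terms at most a quarter of the corresponding leading terms\<close>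
  define R where "R = 4 * real s * M + 1"
  have R: "R \<ge> 1" using M0 by (simp add: R_def)
  have "Re (cnj (F (w, v)) * (w * dF_first (w, v))) > 0" if w: "R \<le> norm w" and v: "norm v \<le> 1" for w v
  proof -
    define A where "A = w ^ s"
    define e1 where "e1 = (\<Sum>n<s. m n v * w ^ n)"
    define e2 where "e2 = (\<Sum>n<s. of_nat n * (m n v * w ^ n))"
    have w1: "norm w \<ge> 1" using w R by simp
    have FA: "F (w, v) = A + e1" by (simp add: F A_def e1_def)
    have wF: "w * dF_first (w, v) = of_nat s * A + e2"
    proof -
      have pw: "w * (c * w ^ (n - 1)) = c * w ^ n" if "n > 0" for n and c :: complex
        using that by (cases n) auto
      have "w * (m n v * (of_nat n * w ^ (n - 1))) = of_nat n * (m n v * w ^ n)" for n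
        by (cases n) (auto simp: mult_ac)
      then show ?thesis using pw[OF s, of "of_nat s"]
        unfolding dF_first_def A_def e2_def prod.case by (simp only: distrib_left sum_distrib_left)
    qed
    have A: "norm A = norm w * norm w ^ (s - 1)" using s by (cases s) (auto simp: A_def norm_power norm_mult)
    have each: "norm (m n v * w ^ n) \<le> M * norm w ^ (s - 1)" if "n < s" for n
      unfolding norm_mult norm_power
      using M[OF that v] w1 that M0 by (intro mult_mono power_increasing) auto
    have small: "4 * (real s * (M * norm w ^ (s - 1))) \<le> norm A"
    proof -
      have "4 * real s * M \<le> norm w" using w by (simp add: R_def)
      then have "4 * real s * M * norm w ^ (s - 1) \<le> norm w * norm w ^ (s - 1)"
        by (rule mult_right_mono) simp
      then show ?thesis by (simp add: A mult.assoc)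
    qed
    have "norm e1 \<le> (\<Sum>n<s. M * norm w ^ (s - 1))"
      unfolding e1_def by (rule sum_norm_le) (use each in auto)
    then have e1: "4 * norm e1 \<le> norm A" using small by simp
    have "norm e2 \<le> (\<Sum>n<s. real s * (M * norm w ^ (s - 1)))"
      unfolding e2_def
    proof (rule sum_norm_le)
      fix n assume "n \<in> {..<s}"
      then show "norm (of_nat n * (m n v * w ^ n)) \<le> real s * (M * norm w ^ (s - 1))"
        using each[of n] unfolding norm_mult[of "of_nat n"] by (intro mult_mono) auto
    qed
    then have "4 * norm e2 \<le> real s * (4 * (real s * (M * norm w ^ (s - 1))))" by simp
    also have "\<dots> \<le> real s * norm A" using small by (rule mult_left_mono) simp
    finally have e2: "4 * norm e2 \<le> real s * norm A" .
    have A0: "norm A > 0" using w1 s by (auto simp: A_def)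
    let ?a = "norm A" and ?S = "real s"
    have "cnj (F (w, v)) * (w * dF_first (w, v)) =
        of_nat s * (A * cnj A) + (cnj A * e2 + cnj e1 * (of_nat s * A) + cnj e1 * e2)"
      unfolding FA wF by (simp add: algebra_simps)
    also have "of_nat s * (A * cnj A) = of_real (?S * ?a\<^sup>2)"
      unfolding complex_norm_square[symmetric] by simp
    finally have "cnj (F (w, v)) * (w * dF_first (w, v)) =
        of_real (?S * ?a\<^sup>2) + (cnj A * e2 + cnj e1 * (of_nat s * A) + cnj e1 * e2)" .
    then have "Re (cnj (F (w, v)) * (w * dF_first (w, v))) =
        ?S * ?a\<^sup>2 + Re (cnj A * e2 + cnj e1 * (of_nat s * A) + cnj e1 * e2)" by simp
    moreover have "norm (cnj A * e2 + cnj e1 * (of_nat s * A) + cnj e1 * e2)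
        \<le> ?a * norm e2 + norm e1 * (?S * ?a) + norm e1 * norm e2"
      by (intro order_trans[OF norm_triangle_ineq] add_mono) (simp_all add: norm_mult)
    moreover have "\<dots> \<le> ?a * (?S * ?a / 4) + ?a / 4 * (?S * ?a) + ?a / 4 * (?S * ?a / 4)"
      using e1 e2 by (intro add_mono mult_mono) auto
    moreover have "\<dots> = (9 / 16) * (?S * ?a\<^sup>2)" by (simp add: power2_eq_square)
    moreover have "?S * ?a\<^sup>2 > 0" using s A0 by simp
    ultimately show ?thesis
      using abs_Re_le_cmod[of "cnj A * e2 + cnj e1 * (of_nat s * A) + cnj e1 * e2"] by linarith
  qed
  then show ?thesis using R by (intro exI[of _ R]) auto
qed

text \<open>
  The point \<open>(lam * w, v)\<close> of the sphere with \<open>v\<close> of argument \<open>h\<close>, in the coordinates \<open>(w, v)\<close> of \<open>F\<close>. For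
  \<open>lam = 0\<close> these points form the solid torus on which the braid polynomial is defined.
\<close>

definition "tube lam w h = (w, of_real (sqrt (1 - lam\<^sup>2 * (norm w)\<^sup>2)) * cis h)"

text \<open>
  The derivatives of \<open>F\<close> along two kinds of tangent vectors of the sphere: \<open>slide\<close> moves \<open>w\<close> in the
  direction \<open>\<xi>\<close> and corrects the modulus of \<open>v\<close>, and \<open>spin\<close> rotates \<open>v\<close>. Suppose that \<open>F = |F| \<zeta>\<close> with \<open>|\<zeta>| = 1\<close>
  and that all these derivatives are real multiples of \<open>\<zeta>\<close>, as at a phase-critical point or where 0 is
  not a regular value. Then both summands of \<open>defect\<close> vanish.
\<close>

definition "slide lam w h \<xi> = dF_first (tube lam w h) * \<xi> +
  DF (tube lam w h) (0, - of_real (lam\<^sup>2 * (w \<bullet> \<xi>) / (1 - lam\<^sup>2 * (norm w)\<^sup>2)) * snd (tube lam w h))"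
definition "spin lam w h = DF (tube lam w h) (0, \<i> * snd (tube lam w h))"
definition "defect lam w h = \<bar>Im (cnj (slide lam w h 1) * slide lam w h \<i>)\<bar>
  + \<bar>Im (cnj (F (tube lam w h)) * spin lam w h)\<bar>"

text \<open>
  At \<open>lam = 0\<close> the defect is \<open>|dF_first|\<^sup>2 + |Im (cnj F * dF/dh)|\<close>, which is positive by hypothesis.
  It is continuous, and for \<open>|w| \<le> R\<close> the variables \<open>w\<close> and \<open>h\<close> range over a compact set, so it remains
  nonzero for small \<open>lam\<close>.
\<close>

lemma near_region:
  assumes H: "\<And>w h. h \<in> {0..2 * pi} \<Longrightarrow> dF_first (w, cis h) = 0 \<Longrightarrow>
      Im (cnj (F (w, cis h)) * DF (w, cis h) (0, \<i> * cis h)) \<noteq> 0"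
    and R: "R > 0"
  shows "\<exists>lam0>0. \<forall>lam w h. 0 < lam \<longrightarrow> lam < lam0 \<longrightarrow> norm w \<le> R \<longrightarrow> h \<in> {0..2 * pi} \<longrightarrow>
    lam * norm w < 1 \<and> defect lam w h \<noteq> 0"
proof -
  \<comment> \<open>keeps the modulus of \<open>v\<close> away from 0, so that \<open>slide\<close> is continuous\<close>
  define l1 where "l1 = 1 / (2 * R)"
  have l1: "l1 > 0" using R by (simp add: l1_def)
  let ?C = "cball (0 :: complex) R \<times> {0..2 * pi}" and ?U = "{0..l1}"
  have half: "lam * norm w \<le> 1 / 2" if "lam \<in> ?U" "norm w \<le> R" for lam and w :: complex
  proof -
    have "lam * norm w \<le> l1 * R" using that l1 by (intro mult_mono) auto
    then show ?thesis using R by (simp add: l1_def)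
  qed
  have pos: "1 - lam\<^sup>2 * (norm w)\<^sup>2 > 0" if "lam \<in> ?U" "norm w \<le> R" for lam and w :: complex
  proof -
    have "(lam * norm w)\<^sup>2 \<le> (1 / 2)\<^sup>2" using half[OF that] that by (intro power_mono) auto
    then have "lam\<^sup>2 * (norm w)\<^sup>2 \<le> 1 / 4" by (simp add: power_mult_distrib power_divide)
    then show ?thesis by simp
  qed
  let ?S = "?U \<times> ?C"
  have cr: "continuous_on ?S (\<lambda>q. 1 - (fst q)\<^sup>2 * (norm (fst (snd q)))\<^sup>2)" by (intro continuous_intros)
  have cv: "continuous_on ?S (\<lambda>q. snd (tube (fst q) (fst (snd q)) (snd (snd q))))"
    unfolding tube_def snd_conv by (intro continuous_intros cr)
  have ct: "continuous_on ?S (\<lambda>q. tube (fst q) (fst (snd q)) (snd (snd q)))"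
    unfolding tube_def by (intro continuous_intros cr)
  have cFw: "continuous_on ?S (\<lambda>q. dF_first (tube (fst q) (fst (snd q)) (snd (snd q))))"
    unfolding tube_def by (intro continuous_on_dF_first continuous_intros cr)
  have cs: "continuous_on ?S (\<lambda>q. slide (fst q) (fst (snd q)) (snd (snd q)) \<xi>)" for \<xi>
    unfolding slide_def
    by (intro continuous_intros continuous_on_DF_second cFw ct cv cr) (use pos in force)
  have csp: "continuous_on ?S (\<lambda>q. spin (fst q) (fst (snd q)) (snd (snd q)))"
    unfolding spin_def by (intro continuous_intros continuous_on_DF_second ct cv)
  have cd: "continuous_on ?S (\<lambda>q. defect (fst q) (fst (snd q)) (snd (snd q)))"
    unfolding defect_def by (intro continuous_intros cs csp continuous_on_F ct)
  have d0: "defect 0 w h > 0" if "h \<in> {0..2 * pi}" for w h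
  proof -
    have t: "tube 0 w h = (w, cis h)" by (simp add: tube_def)
    have z: "DF x (0, 0) = 0" for x using linear_0[OF linear_DF] by (simp add: zero_prod_def)
    have "Im (cnj (dF_first (w, cis h)) * (dF_first (w, cis h) * \<i>)) = (norm (dF_first (w, cis h)))\<^sup>2"
      unfolding cmod_power2 by (simp add: power2_eq_square)
    then have "defect 0 w h = (norm (dF_first (w, cis h)))\<^sup>2 + \<bar>Im (cnj (F (w, cis h)) * DF (w, cis h) (0, \<i> * cis h))\<bar>"
      by (simp add: defect_def slide_def spin_def t z)
    then show ?thesis using H[OF that, of w] by (cases "dF_first (w, cis h) = 0") (auto intro: add_pos_nonneg)
  qed
  have C: "compact ?C" by (intro compact_Times) auto
  have ne: "?C \<noteq> {}" using R by auto
  have "continuous_on ?C (\<lambda>p. (0 :: real, p))" by (intro continuous_intros)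
  moreover have "(\<lambda>p. (0 :: real, p)) ` ?C \<subseteq> ?S" using l1 by auto
  ultimately have "continuous_on ?C (\<lambda>p. defect 0 (fst p) (snd p))"
    using continuous_on_compose2[OF cd, of ?C "\<lambda>p. (0, p)"] by simp
  from continuous_attains_inf[OF C ne this]
  obtain p0 where p0: "p0 \<in> ?C" "\<And>p. p \<in> ?C \<Longrightarrow> defect 0 (fst p0) (snd p0) \<le> defect 0 (fst p) (snd p)" by blast
  define q where "q = defect 0 (fst p0) (snd p0)"
  have q: "q > 0" unfolding q_def using d0 p0(1) by auto
  have "0 \<in> ?U" using l1 by simp
  obtain X0 where X0: "0 \<in> X0" "open X0"
    "\<And>lam w h. lam \<in> X0 \<Longrightarrow> lam \<in> ?U \<Longrightarrow> (w, h) \<in> ?C \<Longrightarrow> dist (defect lam w h) (defect 0 w h) \<le> q / 2"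
    by (rule continuous_on_prod_compactE[OF cd C \<open>0 \<in> ?U\<close> half_gt_zero[OF q]]) (rule that, auto)
  obtain e where e: "e > 0" "ball 0 e \<subseteq> X0" using X0(1,2) open_contains_ball by blast
  show ?thesis
  proof (intro exI[of _ "min e l1"] conjI allI impI)
    show "min e l1 > 0" using e l1 by simp
    fix lam h :: real and w :: complex
    assume lam: "0 < lam" "lam < min e l1" and w: "norm w \<le> R" and h: "h \<in> {0..2 * pi}"
    have lU: "lam \<in> X0 \<inter> ?U" using lam e(2) by (auto simp: subset_eq)
    have p: "(w, h) \<in> ?C" using w h by simp
    show "lam * norm w < 1" using half[of lam w] lU w by auto
    have "dist (defect lam w h) (defect 0 w h) \<le> q / 2" using X0(3)[OF _ _ p] lU by simp
    moreover have "q \<le> defect 0 w h" using p0(2)[OF p] by (simp add: q_def)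
    ultimately show "defect lam w h \<noteq> 0" using q by (auto simp: dist_real_def)
  qed
qed

definition "rescaled lam x = of_real lam ^ s * F (fst x / of_real lam, snd x)"

lemma rescaled_Ck: "Ck_on k UNIV (rescaled lam)"
  unfolding rescaled_def[abs_def] divide_inverse
  by (intro Ck_on_mult[OF open_UNIV] Ck_on_const[OF open_UNIV] Ck_on_compose[OF open_UNIV F_Ck]
      Ck_on_Pair[OF open_UNIV] Ck_on_fst[OF open_UNIV] Ck_on_snd[OF open_UNIV] Ck_on_ident[OF open_UNIV]) auto

lemma rescaled_derivative:
  assumes "lam > 0"
  shows "frechet_derivative (rescaled lam) (at (of_real lam * w, v)) (of_real lam * \<xi>, \<eta>) =
    of_real lam ^ s * DF (w, v) (\<xi>, \<eta>)"
proof -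
  have nz: "(of_real lam :: complex) \<noteq> 0" using assms by simp
  have "((\<lambda>x :: complex \<times> complex. (fst x / of_real lam, snd x)) has_derivative
      (\<lambda>v. (fst v / of_real lam, snd v))) (at (of_real lam * w, v))"
    by (auto intro!: derivative_eq_intros simp: divide_inverse)
  from diff_chain_at[OF this F_deriv]
  have "((\<lambda>x. F (fst x / of_real lam, snd x)) has_derivative
      (\<lambda>v'. DF (w, v) (fst v' / of_real lam, snd v'))) (at (of_real lam * w, v))"
    using nz by (simp add: o_def)
  from has_derivative_mult_right[OF this, of "of_real lam ^ s"]
  have "(rescaled lam has_derivative (\<lambda>v'. of_real lam ^ s * DF (w, v) (fst v' / of_real lam, snd v')))
      (at (of_real lam * w, v))" by (simp add: rescaled_def[abs_def])
  from frechet_derivative_at[OF this, symmetric] show ?thesis using nz by simp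
qed

text \<open>
  At points with \<open>|w| \<ge> R\<close> the tangent vector that rotates the first coordinate works. At the others, if
  \<open>Im (cnj \<zeta> * DF t)\<close> vanished for all tangent vectors \<open>t\<close>, then both summands of the defect would vanish.
\<close>

lemma transversality:
  assumes H: "\<And>w h. h \<in> {0..2 * pi} \<Longrightarrow> dF_first (w, cis h) = 0 \<Longrightarrow>
      Im (cnj (F (w, cis h)) * DF (w, cis h) (0, \<i> * cis h)) \<noteq> 0"
  shows "\<exists>lam0>0. \<forall>lam. 0 < lam \<longrightarrow> lam < lam0 \<longrightarrow>
    (\<forall>x \<zeta>. norm x = 1 \<longrightarrow> norm \<zeta> = 1 \<longrightarrow> rescaled lam x = of_real (norm (rescaled lam x)) * \<zeta> \<longrightarrow>
      (\<exists>t. t \<bullet> x = 0 \<and> Im (cnj \<zeta> * frechet_derivative (rescaled lam) (at x) t) \<noteq> 0)) \<and>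
    (\<exists>x. norm x = 1 \<and> rescaled lam x \<noteq> 0)"
proof -
  obtain R where R: "R > 0"
    "\<And>w v. R \<le> norm w \<Longrightarrow> norm v \<le> 1 \<Longrightarrow> Re (cnj (F (w, v)) * (w * dF_first (w, v))) > 0"
    using far_region by blast
  obtain l0 where l0: "l0 > 0"
    "\<And>lam w h. 0 < lam \<Longrightarrow> lam < l0 \<Longrightarrow> norm w \<le> R \<Longrightarrow> h \<in> {0..2 * pi} \<Longrightarrow>
      lam * norm w < 1 \<and> defect lam w h \<noteq> 0"
    using near_region[OF H R(1)] by blast
  show ?thesis
  proof (intro exI[of _ "min l0 (1 / R)"] conjI allI impI)
    show "min l0 (1 / R) > 0" using l0 R by simp
    fix lam :: real assume lam: "0 < lam" "lam < min l0 (1 / R)"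
    let ?L = "of_real lam :: complex"
    have L: "?L \<noteq> 0" "?L ^ s \<noteq> 0" using lam by auto
    show "\<exists>x. norm x = 1 \<and> rescaled lam x \<noteq> 0"
    proof (intro exI[of _ "(1, 0)"] conjI)
      have "R \<le> norm (1 / ?L)" using lam R by (simp add: norm_divide field_simps)
      then have "F (1 / ?L, 0) \<noteq> 0" using R(2)[of "1 / ?L" 0] by auto
      then show "rescaled lam (1, 0) \<noteq> 0" using L by (simp add: rescaled_def)
    qed simp
    fix x :: "complex \<times> complex" and \<zeta> :: complex
    assume x: "norm x = 1" and \<zeta>: "norm \<zeta> = 1" and Gx: "rescaled lam x = of_real (norm (rescaled lam x)) * \<zeta>"
    define w where "w = fst x / ?L"
    define v where "v = snd x"
    have xwv: "x = (?L * w, v)" using L by (simp add: w_def v_def)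
    have n: "(lam * norm w)\<^sup>2 + (norm v)\<^sup>2 = 1"
      using x lam by (simp add: xwv norm_Pair norm_mult)
    have v1: "norm v \<le> 1"
    proof (rule power2_le_imp_le)
      show "(norm v)\<^sup>2 \<le> 1\<^sup>2" using n zero_le_power2[of "lam * norm w"] unfolding one_power2 by linarith
    qed simp
    have GF: "rescaled lam x = ?L ^ s * F (w, v)" using L by (simp add: rescaled_def xwv)
    have FF: "F (w, v) = of_real (norm (F (w, v))) * \<zeta>"
    proof -
      have "norm (rescaled lam x) = lam ^ s * norm (F (w, v))" using lam by (simp add: GF norm_mult norm_power)
      then have "?L ^ s * F (w, v) = ?L ^ s * (of_real (norm (F (w, v))) * \<zeta>)"
        using Gx by (simp add: GF)
      then show ?thesis using L by simp
    qed
    have dG: "Im (cnj \<zeta> * frechet_derivative (rescaled lam) (at x) (?L * \<xi>, \<eta>)) =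
        lam ^ s * Im (cnj \<zeta> * DF (w, v) (\<xi>, \<eta>))" for \<xi> \<eta>
    proof -
      have "cnj \<zeta> * frechet_derivative (rescaled lam) (at x) (?L * \<xi>, \<eta>) = of_real (lam ^ s) * (cnj \<zeta> * DF (w, v) (\<xi>, \<eta>))"
        unfolding xwv rescaled_derivative[OF lam(1)] by simp
      then show ?thesis by (simp only: Im_complex_of_real Re_complex_of_real times_complex.sel)
    qed
    have tangent: "(?L * \<xi>, \<eta>) \<bullet> x = lam\<^sup>2 * (\<xi> \<bullet> w) + \<eta> \<bullet> v" for \<xi> \<eta>
      by (simp add: xwv inner_complex_def algebra_simps power2_eq_square)
    show "\<exists>t. t \<bullet> x = 0 \<and> Im (cnj \<zeta> * frechet_derivative (rescaled lam) (at x) t) \<noteq> 0"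
    proof (rule ccontr)
      assume "\<not> ?thesis"
      then have crit: "Im (cnj \<zeta> * DF (w, v) (\<xi>, \<eta>)) = 0" if "lam\<^sup>2 * (\<xi> \<bullet> w) + \<eta> \<bullet> v = 0" for \<xi> \<eta>
        using dG[of \<xi> \<eta>] tangent[of \<xi> \<eta>] that lam(1) by force
      show False
      proof (cases "R \<le> norm w")
        case True
        have "Im (cnj \<zeta> * DF (w, v) (\<i> * w, 0)) = 0" by (rule crit) (simp add: inner_complex_def)
        then have "Re (cnj \<zeta> * (w * dF_first (w, v))) = 0" by (simp add: DF_first algebra_simps)
        moreover have "Re (cnj (F (w, v)) * (w * dF_first (w, v))) = norm (F (w, v)) * Re (cnj \<zeta> * (w * dF_first (w, v)))"
          by (subst FF) (simp add: algebra_simps)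
        ultimately show False using R(2)[OF True v1] by simp
      next
        case False
        define h where "h = Arg2pi v"
        have h: "h \<in> {0..2 * pi}" "v = of_real (norm v) * cis h"
          using Arg2pi[of v] Arg2pi_eq[of v] by (auto simp: h_def cis_conv_exp)
        have wl: "lam * norm w < 1" "defect lam w h \<noteq> 0"
          using l0(2)[OF lam(1) _ _ h(1), of w] False lam(2) by auto
        have rho: "1 - lam\<^sup>2 * (norm w)\<^sup>2 = (norm v)\<^sup>2" using n by (simp add: power_mult_distrib)
        have vpos: "norm v > 0"
        proof -
          have "(lam * norm w)\<^sup>2 < 1" using wl(1) lam(1) by (simp add: abs_square_less_1)
          then show ?thesis using n by (cases "v = 0") auto
        qed
        have t: "tube lam w h = (w, v)" unfolding tube_def rho using h(2) by simp
        have sl: "Im (cnj \<zeta> * slide lam w h \<xi>) = 0" for \<xi>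
        proof -
          let ?c = "lam\<^sup>2 * (w \<bullet> \<xi>) / (norm v)\<^sup>2"
          have "slide lam w h \<xi> = DF (w, v) (\<xi>, - of_real ?c * v)"
            unfolding slide_def t rho snd_conv DF_split[of w v \<xi>] ..
          moreover have "(- of_real c * v) \<bullet> v = - c * (norm v)\<^sup>2" for c
            unfolding cmod_power2 inner_complex_def by (simp add: power2_eq_square algebra_simps)
          from this[of ?c] have "lam\<^sup>2 * (\<xi> \<bullet> w) + (- of_real ?c * v) \<bullet> v = 0"
            using vpos by (simp add: inner_commute)
          ultimately show ?thesis using crit by simp
        qed
        have sp: "Im (cnj \<zeta> * spin lam w h) = 0"
          unfolding spin_def t snd_conv by (rule crit) (simp add: inner_complex_def)
        have "Im (cnj (slide lam w h 1) * slide lam w h \<i>) = 0"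
          by (rule Im_mult_real_multiples[OF \<zeta> sl sl])
        moreover have "Im (cnj (F (w, v)) * spin lam w h) = norm (F (w, v)) * Im (cnj \<zeta> * spin lam w h)"
          by (subst FF) (simp add: algebra_simps)
        ultimately have "defect lam w h = 0" using sp by (simp add: defect_def t)
        then show False using wl(2) by simp
      qed
    qed
  qed
qed

text \<open>
  On the cylinder the first variable is holomorphic, so the derivative of the argument vanishes as soon
  as \<open>dF_first\<close> and the derivative of the argument along \<open>h\<close> do. Through this lemma the hypothesis on
  the braid polynomial enters.
\<close>

lemma phase_critical_pullback:
  assumes "dF_first (w, cis h) = 0" and zero: "Im (cnj (F (w, cis h)) * DF (w, cis h) (0, \<i> * cis h)) = 0"
    and "F (w, cis h) \<noteq> 0" and lam: "lam > 0"
  shows "phase_critical UNIV (\<lambda>(u, t). rescaled lam (u, cis t)) (of_real lam * w, h)"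
proof (rule phase_criticalI)
  let ?L = "of_real lam :: complex"
  have nz: "?L \<noteq> 0" using lam by simp
  have "((\<lambda>p :: complex \<times> real. (fst p / ?L, cis (snd p))) has_derivative
      (\<lambda>v. (fst v / ?L, snd v *\<^sub>R (\<i> * cis h)))) (at (?L * w, h))"
    by (auto intro!: derivative_eq_intros simp: divide_inverse)
  from diff_chain_at[OF this F_deriv]
  have "((\<lambda>p :: complex \<times> real. F (fst p / ?L, cis (snd p))) has_derivative
      (\<lambda>v. DF (w, cis h) (fst v / ?L, snd v *\<^sub>R (\<i> * cis h)))) (at (?L * w, h))"
    using nz by (simp add: o_def)
  from has_derivative_mult_right[OF this, of "?L ^ s"]
  have d: "((\<lambda>p :: complex \<times> real. rescaled lam (fst p, cis (snd p))) has_derivative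
      (\<lambda>v. ?L ^ s * DF (w, cis h) (fst v / ?L, snd v *\<^sub>R (\<i> * cis h)))) (at (?L * w, h))"
    by (simp add: rescaled_def)
  moreover have "DF (w, cis h) (\<xi>, \<tau> *\<^sub>R (\<i> * cis h)) = \<tau> *\<^sub>R DF (w, cis h) (0, \<i> * cis h)" for \<xi> \<tau>
    using assms(1) linear_cmul[OF linear_DF, of "(w, cis h)" \<tau> "(0, \<i> * cis h)"] by (simp add: DF_split[of w "cis h" \<xi>])
  ultimately show "((\<lambda>(u, t). rescaled lam (u, cis t)) has_derivative
      (\<lambda>v. ?L ^ s * (snd v *\<^sub>R DF (w, cis h) (0, \<i> * cis h)))) (at (?L * w, h))"
    by (simp add: case_prod_beta')
  have Gw: "rescaled lam (?L * w, cis h) = ?L ^ s * F (w, cis h)" using nz by (simp add: rescaled_def)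
  then show "(case (?L * w, h) of (u, t) \<Rightarrow> rescaled lam (u, cis t)) \<noteq> 0" using assms(3) nz by simp
  show "Im (cnj (case (?L * w, h) of (u, t) \<Rightarrow> rescaled lam (u, cis t)) *
      (?L ^ s * (snd v *\<^sub>R DF (w, cis h) (0, \<i> * cis h)))) = 0" for v :: "complex \<times> real"
  proof -
    have "cnj (?L ^ s * F (w, cis h)) * (?L ^ s * (snd v *\<^sub>R DF (w, cis h) (0, \<i> * cis h))) =
        of_real (lam ^ s * lam ^ s * snd v) * (cnj (F (w, cis h)) * DF (w, cis h) (0, \<i> * cis h))"
      by (simp add: scaleR_conv_of_real mult_ac)
    then show ?thesis using zero by (simp add: Gw)
  qed
  have "continuous_on UNIV (\<lambda>p :: complex \<times> real. rescaled lam (fst p, cis (snd p)))"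
    by (rule continuous_on_compose2[OF Ck_on_imp_continuous_on[OF rescaled_Ck]]) (auto intro!: continuous_intros)
  then show "continuous_on UNIV (\<lambda>(u, t). rescaled lam (u, cis t))" by (simp add: case_prod_beta')
qed

text \<open>
  Simplicity of the roots is needed at the zeros of the braid polynomial, and absence of phase-critical
  points elsewhere; together they give the positivity of the defect at \<open>lam = 0\<close>.
\<close>

theorem small_rescaling_fibration:
  assumes simple: "\<forall>w h. F (w, cis h) = 0 \<longrightarrow> \<not> ((\<lambda>u. F (u, cis h)) has_field_derivative 0) (at w)"
    and lam1: "lam1 > 0"
    and noncrit: "\<not> (\<exists>x0 \<in> UNIV \<times> {0..2 * pi}. phase_critical UNIV
      (\<lambda>(u, t). of_real lam1 ^ s * F (u / of_real lam1, cis t)) x0)"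
  shows "\<exists>lam0>0. \<forall>lam. 0 < lam \<longrightarrow> lam < lam0 \<longrightarrow>
    (\<forall>g. g = (\<lambda>x. of_real lam ^ s * F (fst x / of_real lam, snd x)) \<longrightarrow>
      \<not> (\<exists>x\<in>sphere 0 1 - g -` {0}. phase_critical (sphere 0 1) g x) \<and>
      smooth_fibre_bundle (\<lambda>x. arg_circle (g x)) (sphere 0 1 - g -` {0}) (sphere 0 1))"
proof -
  have H: "Im (cnj (F (w, cis h)) * DF (w, cis h) (0, \<i> * cis h)) \<noteq> 0"
    if h: "h \<in> {0..2 * pi}" and 0: "dF_first (w, cis h) = 0" for w h
  proof
    assume z: "Im (cnj (F (w, cis h)) * DF (w, cis h) (0, \<i> * cis h)) = 0"
    have "F (w, cis h) \<noteq> 0" using simple F_field_deriv[of "cis h" w] 0 by auto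
    from phase_critical_pullback[OF 0 z this lam1] noncrit h
    show False by (auto simp: rescaled_def)
  qed
  obtain lam0 where lam0: "lam0 > 0"
    "\<And>lam. 0 < lam \<Longrightarrow> lam < lam0 \<Longrightarrow>
      (\<forall>x \<zeta>. norm x = 1 \<longrightarrow> norm \<zeta> = 1 \<longrightarrow> rescaled lam x = of_real (norm (rescaled lam x)) * \<zeta> \<longrightarrow>
        (\<exists>t. t \<bullet> x = 0 \<and> Im (cnj \<zeta> * frechet_derivative (rescaled lam) (at x) t) \<noteq> 0)) \<and>
      (\<exists>x. norm x = 1 \<and> rescaled lam x \<noteq> 0)"
    using transversality[OF H] by blast
  have "\<not> (\<exists>x\<in>sphere 0 1 - rescaled lam -` {0}. phase_critical (sphere 0 1) (rescaled lam) x) \<and>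
      smooth_fibre_bundle (\<lambda>x. arg_circle (rescaled lam x)) (sphere 0 1 - rescaled lam -` {0}) (sphere 0 1)"
    if "0 < lam" "lam < lam0" for lam
    using sphere_arg_fibration[of "rescaled lam", OF rescaled_Ck] lam0(2)[OF that] by blast
  then show ?thesis using lam0(1) unfolding rescaled_def[abs_def] by (intro exI[of _ lam0]) blast
qed

end

section \<open>The fibration theorem\<close>

theorem theorem3p2:
  fixes l s r :: nat and a b :: real
  assumes "l > 0" and "s > 0" and "r > 0"
    and "coprime s l"
    and "a > 0" and "b > 0"
    and "\<exists>lam>0. \<not> (\<exists>x0 \<in> UNIV \<times> {0..2 * pi}. phase_critical UNIV (lem_p s r l a b lam) x0)"
  shows "\<forall>\<^sub>F lam in at_right 0.
           \<not> (\<exists>x \<in> S3 - lem_K s r l a b lam. phase_critical S3 (lem_f s r l a b lam) x) \<and>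
           smooth_fibre_bundle (\<lambda>x. arg_circle (lem_f s r l a b lam x))
             (S3 - lem_K s r l a b lam) (sphere 0 1)"
proof -
  obtain lam1 where lam1: "lam1 > 0"
    "\<not> (\<exists>x0 \<in> UNIV \<times> {0..2 * pi}. phase_critical UNIV (lem_p s r l a b lam1) x0)"
    using assms(7) by blast
  let ?F = "lem_f s r l a b 1"
  obtain m where m: "\<And>u v. ?F (u, v) = u ^ s + (\<Sum>n<s. m n v * u ^ n)" "\<And>n k. Ck_on k UNIV (m n)"
    using lem_f_sum[OF assms(1,2)] mixed_coeff_Ck[OF assms(1,2)] by metis
  have f: "lem_f s r l a b lam = (\<lambda>x. of_real lam ^ s * ?F (fst x / of_real lam, snd x))" if "lam > 0" for lam
  proof
    fix x
    show "lem_f s r l a b lam x = of_real lam ^ s * ?F (fst x / of_real lam, snd x)"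
      using lem_f_scale[OF assms(1,2) that, of r a b "fst x / of_real lam" "snd x"] that by simp
  qed
  have p: "lem_p s r l a b lam1 = (\<lambda>(u, t). of_real lam1 ^ s * ?F (u / of_real lam1, cis t))"
  proof
    fix x :: "complex \<times> real"
    show "lem_p s r l a b lam1 x = (case x of (u, t) \<Rightarrow> of_real lam1 ^ s * ?F (u / of_real lam1, cis t))"
      using f[OF lam1(1)] lem_f_cis[OF assms(1,2), of r a b lam1 "fst x" "snd x"]
      by (simp add: case_prod_beta)
  qed
  have simple: "\<forall>w h. ?F (w, cis h) = 0 \<longrightarrow> \<not> ((\<lambda>u. ?F (u, cis h)) has_field_derivative 0) (at w)"
    using simple_roots[OF assms(1,2,4,5,6), of r _ _ 0] by (auto simp: lem_f_cis[OF assms(1,2)])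
  have S3: "S3 = sphere 0 1"
    by (auto simp: S3_def norm_Pair)
  have K: "S3 - lem_K s r l a b lam = sphere 0 1 - lem_f s r l a b lam -` {0}" for lam
    by (auto simp: lem_K_def S3)
  obtain lam0 where "lam0 > 0" and *: "\<forall>lam. 0 < lam \<longrightarrow> lam < lam0 \<longrightarrow>
    (\<forall>g. g = (\<lambda>x. of_real lam ^ s * ?F (fst x / of_real lam, snd x)) \<longrightarrow>
      \<not> (\<exists>x\<in>sphere 0 1 - g -` {0}. phase_critical (sphere 0 1) g x) \<and>
      smooth_fibre_bundle (\<lambda>x. arg_circle (g x)) (sphere 0 1 - g -` {0}) (sphere 0 1))"
    using small_rescaling_fibration[OF assms(2) m simple lam1(1) lam1(2)[unfolded p]]
    by (elim exE conjE) (rule that)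
  show ?thesis
    unfolding eventually_at_right_field K unfolding S3
  proof (intro exI[of _ lam0] conjI allI impI)
    fix lam assume "0 < lam" "lam < lam0"
    from *[rule_format, OF this f[OF this(1)]]
    show "\<not> (\<exists>x\<in>sphere 0 1 - lem_f s r l a b lam -` {0}. phase_critical (sphere 0 1) (lem_f s r l a b lam) x)"
      "smooth_fibre_bundle (\<lambda>x. arg_circle (lem_f s r l a b lam x))
        (sphere 0 1 - lem_f s r l a b lam -` {0}) (sphere 0 1)" by blast+
  qed (rule \<open>lam0 > 0\<close>)
qed

end
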